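(* Let $d\ge1$ and let $\Delta=\operatorname{conv}(v_1,\ldots,v_{2d})\subset\mathbb{R}^{2d-1}$ be a $(2d-1)$-dimensional lattice simplex whose codimension-$1$ facets are basic lattice simplices. Then the following are equivalent: (1) for all $k=1,\ldots,d-1$, every lattice point $x\in k\Delta\cap\mathbb{Z}^{2d-1}$, written as $x=\sum_i\lambda_iv_i$ with $\lambda_i\ge0$, $\sum_i\lambda_i=k$, has all $\lambda_i\in\mathbb{Z}$; (2) for all $k=1,\ldots,d-1$, $\mathrm{Int}(k\Delta)\cap\mathbb{Z}^{2d-1}=\emptyset$; (3) $h^*_\Delta=1+(n-1)t^d$ for some integer $n\ge1$; (4) $\Delta\cong\Delta(a_1,\ldots,a_{d-1},n)$ for some integers $a_1,\ldots,a_{d-1},n$ with $n>0$ and $\gcd(a_1\cdots a_{d-1},n)=1$; (5) $\Delta\cong\Delta_1*\cdots*\Delta_d$ for some $1$-dimensional lattice simplices $\Delta_1,\ldots,\Delta_d\subset\mathbb{R}^d$.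
   Context: Basic simplex: $\operatorname{conv}(w_1,\ldots,w_{k+1})\subset\mathbb{R}^m$ with $w_1-w_{k+1},\ldots,w_k-w_{k+1}$ part of a lattice basis of $\mathbb{Z}^m$. $h^*$-polynomial: with $w_j=(v_j,1)$ and $\mathrm{Par}(\Delta)=\{\sum_j\lambda_jw_j:0\le\lambda_j<1\}$, $h^*_\Delta=\sum_kh^*_kt^k$ where $h^*_k$ is the number of lattice points of $\mathrm{Par}(\Delta)$ with last coordinate $k$. Cayley polytope: for lattice polytopes $\Sigma_1,\ldots,\Sigma_r\subset\mathbb{R}^d$ ($r\le d$), $\Sigma_1*\cdots*\Sigma_r=\operatorname{conv}(e_1\times\Sigma_1,\ldots,e_r\times\Sigma_r)\subset\mathbb{R}^r\times\mathbb{R}^d$, lying in $H=\{x:x_1+\cdots+x_r=1\}$ with lattice $H\cap\mathbb{Z}^{r+d}$. For integers $a_1,\ldots,a_{d-1},n$ with $n>0$ and $\gcd(a_1\cdots a_{d-1},n)=1$, $\Delta(a_1,\ldots,a_{d-1},n):=\Delta_1*\cdots*\Delta_d\subset\mathbb{R}^{2d}$ with $\Delta_i=\operatorname{conv}(0,e_i)\subset\mathbb{R}^d$ for $i\le d-1$ and $\Delta_d=\operatorname{conv}(0,(a_1,\ldots,a_{d-1},n))\subset\mathbb{R}^d$. For $P\subset H$ ($r=d$), $\Delta\cong P$ means there is an affine isomorphism $\varphi:\mathbb{R}^{2d-1}\to H$ with $\varphi(\mathbb{Z}^{2d-1})=H\cap\mathbb{Z}^{2d}$ and $\varphi(\Delta)=P$.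 *)

theory Defs
  imports "HOL-Analysis.Analysis" "HOL-Computational_Algebra.Polynomial"
begin

definition int_vecs :: "(real ^ 'm) set" where
  "int_vecs = {x. \<forall>i. x $ i \<in> \<int>}"

definition lattice_basis :: "(real ^ 'm) set \<Rightarrow> bool" where
  "lattice_basis B \<longleftrightarrow>
     finite B \<and> independent B \<and> int_vecs = {\<Sum>b\<in>B. of_int (c b) *\<^sub>R b | c :: real ^ 'm \<Rightarrow> int. True}"

text \<open>The library notion \<^const>\<open>simplex\<close>, with vertices required to be lattice points.\<close>

definition lattice_simplex :: "int \<Rightarrow> (real ^ 'm) set \<Rightarrow> bool" where
  "lattice_simplex n S \<longleftrightarrow>
     (\<exists>C. C \<subseteq> int_vecs \<and> \<not> affine_dependent C \<and> int (card C) = n + 1 \<and> S = convex hull C)"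

definition basic_simplex :: "(real ^ 'm) set \<Rightarrow> bool" where
  "basic_simplex S \<longleftrightarrow>
     (\<exists>(k :: nat) (w :: nat \<Rightarrow> real ^ 'm). (\<forall>i\<in>{1..k + 1}. w i \<in> int_vecs) \<and> S = convex hull (w ` {1..k + 1}) \<and>
        inj_on (\<lambda>i. w i - w (k + 1)) {1..k} \<and>
        (\<exists>B. lattice_basis B \<and> (\<lambda>i. w i - w (k + 1)) ` {1..k} \<subseteq> B))"

definition half_open_par :: "nat \<Rightarrow> (nat \<Rightarrow> real ^ 'm) \<Rightarrow> ((real ^ 'm) \<times> real) set" where
  "half_open_par N v =
     {\<Sum>j=1..N. c j *\<^sub>R (v j, 1) | c :: nat \<Rightarrow> real. \<forall>j\<in>{1..N}. 0 \<le> c j \<and> c j < 1}"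

definition h_star_coeff :: "nat \<Rightarrow> (nat \<Rightarrow> real ^ 'm) \<Rightarrow> nat \<Rightarrow> nat" where
  "h_star_coeff N v k = card {x \<in> half_open_par N v. fst x \<in> int_vecs \<and> snd x = real k}"

text \<open>Points of \<^term>\<open>half_open_par N v\<close> have last coordinate in the interval from 0 to
  \<^term>\<open>N\<close>, so the sum contains all the nonzero coefficients.\<close>

definition h_star :: "nat \<Rightarrow> (nat \<Rightarrow> real ^ 'm) \<Rightarrow> int poly" where
  "h_star N v = (\<Sum>k\<le>N. monom (int (h_star_coeff N v k)) k)"

definition cayley :: "('r \<Rightarrow> (real ^ 'd) set) \<Rightarrow> ((real ^ 'r) \<times> (real ^ 'd)) set" where
  "cayley S = convex hull (\<Union>i. {axis i 1} \<times> S i)"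

definition cayley_hyperplane :: "((real ^ 'r) \<times> (real ^ 'd)) set" where
  "cayley_hyperplane = {x. (\<Sum>i\<in>UNIV. fst x $ i) = 1}"

definition lattice_iso :: "(real ^ 'm) set \<Rightarrow> ((real ^ 'r) \<times> (real ^ 'd)) set \<Rightarrow> bool" where
  "lattice_iso D P \<longleftrightarrow>
     (\<exists>\<phi> f c. linear f \<and> \<phi> = (\<lambda>x. c + f x) \<and> bij_betw \<phi> UNIV cayley_hyperplane \<and>
        \<phi> ` int_vecs = cayley_hyperplane \<inter> (int_vecs \<times> int_vecs) \<and> \<phi> ` D = P)"

text \<open>The simplex \<open>\<Delta>(a\<^sub>1, \<dots>, a\<^sub>d\<^sub>-\<^sub>1, n)\<close>. The index \<^term>\<open>l :: 'd\<close> plays the role of the last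
  index \<open>d\<close>; the value \<^term>\<open>a l\<close> is not used.\<close>

definition Delta_simplex :: "'d \<Rightarrow> ('d \<Rightarrow> int) \<Rightarrow> int \<Rightarrow> ((real ^ 'd) \<times> (real ^ 'd)) set" where
  "Delta_simplex l a n = cayley (\<lambda>i. convex hull
     {0, if i = l then (\<chi> j. if j = l then of_int n else of_int (a j)) else axis i 1})"

definition tfae :: "bool list \<Rightarrow> bool" where
  "tfae ps \<longleftrightarrow> (\<forall>p\<in>set ps. \<forall>q\<in>set ps. p \<longleftrightarrow> q)"

end

theory Submission
  imports Defs "HOL-Number_Theory.Cong" "HOL-Computational_Algebra.Fundamental_Theorem_Algebra"
begin

text \<open>
  Write lattice points of the cone over the simplex in the coordinates \<open>c\<close> with respect to the
  vectors \<open>(v\<^sub>j, 1)\<close>. Basic facets force all coordinates of a lattice point to be integral as soon as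
  one of them is. Together with the symmetry \<open>c \<mapsto> 1 - c\<close>, this makes (1), (2) and (3) equivalent to
  the condition that each \<open>c\<close> with \<open>0 < c\<^sub>j < 1\<close> has coordinate sum \<open>d\<close>. In a Cayley polytope the
  coordinate sums over the \<open>d\<close> fibres are positive integers, so (5) implies this condition.

  For the converse, the group of lattice points modulo integral coordinates is cyclic, generated by
  some \<open>(b\<^sub>1, \<dots>, b\<^sub>2\<^sub>d) / n\<close> with all \<open>b\<^sub>j\<close> prime to \<open>n\<close>, and the condition reads
  \<open>\<Sum>\<^sub>j (1/2 - frac (k b\<^sub>j / n)) = 0\<close> whenever \<open>n\<close> does not divide \<open>k\<close>. It follows that the residues
  \<open>b\<^sub>j\<close> cancel in pairs \<open>b, - b\<close>, and such a pairing yields the isomorphism in (4). To see the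
  cancellation, put \<open>g(m) = \<Sum>\<^sub>j sin (2 \<pi> m b\<^sub>j / n)\<close>. By the Fourier series of the sawtooth function,
  \<open>\<Sum>\<^sub>m g(k m) / m = 0\<close> for all \<open>k\<close>. If \<open>g \<noteq> 0\<close>, then the commuting dilation operators have a common
  eigenvector in the space of all such \<open>g\<close>, that is, a completely multiplicative periodic function \<open>\<psi>\<close>
  of mean zero with \<open>L(1, \<psi>) = 0\<close>. This contradicts Dirichlet's nonvanishing theorem, proved by the
  3-4-1 inequality if \<open>\<psi>\<^sup>2\<close> has mean zero, and by Monsky's Lambert series argument if \<open>\<psi>\<close> is real.
\<close>

section \<open>Summation by parts and periodic functions\<close>

text \<open>The balance condition is known for every \<open>k\<close> that \<open>n\<close> does not
  divide, also for \<open>k\<close> sharing factors with \<open>n\<close>. Common eigenvectors are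
  therefore sought for all dilations, invertible or not, which spares the decomposition into
  characters modulo the divisors of \<open>n\<close>. The price is that \<open>\<psi>\<close> need
  not vanish at the primes dividing \<open>n\<close>; passing to its least positive period with
  vanishing sum repairs this.

  Two nonvanishing arguments are needed because of the orders of growth at 1 + e. The 3-4-1 product
  is at least 1. Its factors are O(e^(-3)) from zeta and O(e^4) from the supposed zero; if the
  squares have mean zero the last factor is bounded, and e tending to 0 gives a contradiction. If
  their mean is nonzero, the last factor grows like 1/e, the powers of e cancel, and nothing
  follows.

  Mean zero enters only through bounded partial sums. Summation by parts turns these into all
  estimates near the conditionally convergent point 1, so no analytic continuation is
  required.\<close>

lemma norm_sum_mult_decseq_le:
  fixes a :: "nat \<Rightarrow> 'a::{real_normed_field,banach}" and b :: "nat \<Rightarrow> real"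
  assumes A: "\<And>k. norm (\<Sum>m<k. a m) \<le> A" and b: "decseq b" "\<And>m. 0 \<le> b m"
  shows "norm (\<Sum>m<M. a m * of_real (b m)) \<le> A * b 0"
proof -
  define S where "S k = (\<Sum>m<k. a m)" for k
  \<comment> \<open>Abel summation: the nonnegative weights \<open>b m - b (Suc m)\<close> and the
    boundary weight \<open>b M\<close> add up to \<open>b 0\<close>.\<close>
  have eq: "(\<Sum>m<M. a m * of_real (b m)) = S M * of_real (b M) + (\<Sum>m<M. S (Suc m) * of_real (b m - b (Suc m)))"
    by (induction M) (simp_all add: S_def algebra_simps)
  have nS: "norm (S k) \<le> A" for k
    using A by (simp add: S_def)
  have "norm (\<Sum>m<M. S (Suc m) * of_real (b m - b (Suc m))) \<le> (\<Sum>m<M. A * (b m - b (Suc m)))"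
  proof (rule sum_norm_le)
    fix m
    have "0 \<le> b m - b (Suc m)" using b by (simp add: decseq_Suc_iff)
    then show "norm (S (Suc m) * of_real (b m - b (Suc m))) \<le> A * (b m - b (Suc m))"
      using nS[of "Suc m"] by (simp add: norm_mult mult_right_mono del: of_real_diff)
  qed
  also have "\<dots> = A * (b 0 - b M)"
    unfolding sum_distrib_left[symmetric] by (simp add: sum_lessThan_telescope')
  finally have 1: "norm (\<Sum>m<M. S (Suc m) * of_real (b m - b (Suc m))) \<le> A * (b 0 - b M)" .
  have 2: "norm (S M * of_real (b M)) \<le> A * b M"
    using nS[of M] b(2)[of M] by (simp add: norm_mult mult_right_mono)
  show ?thesis unfolding eq
    using norm_triangle_ineq[of "S M * of_real (b M)" "\<Sum>m<M. S (Suc m) * of_real (b m - b (Suc m))"] 1 2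
    by (simp add: algebra_simps)
qed

text \<open>The factor 2 arises because a block of consecutive terms is a difference of two partial
  sums.\<close>

lemma norm_sum_tail_decseq_le:
  fixes a :: "nat \<Rightarrow> 'a::{real_normed_field,banach}" and b :: "nat \<Rightarrow> real"
  assumes A: "\<And>k. norm (\<Sum>m<k. a m) \<le> A" and b: "decseq b" "\<And>m. 0 \<le> b m"
  shows "norm (\<Sum>m\<in>{N..<M}. a m * of_real (b m)) \<le> 2 * A * b N"
proof (cases "N \<le> M")
  case True
  have "norm (\<Sum>m<M - N. a (m + N) * of_real (b (m + N))) \<le> (2 * A) * b (0 + N)"
  proof (rule norm_sum_mult_decseq_le)
    fix k
    have "(\<Sum>m<k. a (m + N)) = (\<Sum>m<k + N. a m) - (\<Sum>m<N. a m)"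
      by (induction k) auto
    then show "norm (\<Sum>m<k. a (m + N)) \<le> 2 * A"
      using A[of "k + N"] A[of N] norm_triangle_ineq4[of "\<Sum>m<k + N. a m" "\<Sum>m<N. a m"] by simp
  qed (use b in \<open>auto simp: decseq_def\<close>)
  moreover have "(\<Sum>m\<in>{N..<M}. a m * of_real (b m)) = (\<Sum>m<M - N. a (m + N) * of_real (b (m + N)))"
    using True sum.shift_bounds_nat_ivl[of "\<lambda>m. a m * of_real (b m)" 0 N "M - N"]
    by (simp add: lessThan_atLeast0)
  ultimately show ?thesis by simp
next
  case False
  have "0 \<le> A" using A[of 0] by simp
  then show ?thesis using False b(2)[of N] by simp
qed

lemma norm_suminf_tail_decseq_le:
  fixes a :: "nat \<Rightarrow> 'a::{real_normed_field,banach}" and b :: "nat \<Rightarrow> real"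
  assumes A: "\<And>k. norm (\<Sum>m<k. a m) \<le> A" and b: "decseq b" "\<And>m. 0 \<le> b m"
    and s: "(\<lambda>m. a m * of_real (b m)) sums s"
  shows "norm (s - (\<Sum>m<N. a m * of_real (b m))) \<le> 2 * A * b N"
proof (rule Lim_bounded)
  show "(\<lambda>M. norm ((\<Sum>m<M. a m * of_real (b m)) - (\<Sum>m<N. a m * of_real (b m)))) \<longlonglongrightarrow> norm (s - (\<Sum>m<N. a m * of_real (b m)))"
    using s unfolding sums_def by (intro tendsto_intros)
  show "\<forall>M\<ge>N. norm ((\<Sum>m<M. a m * of_real (b m)) - (\<Sum>m<N. a m * of_real (b m))) \<le> 2 * A * b N"
  proof (intro allI impI)
    fix M assume "N \<le> M"
    then have "(\<Sum>m<M. a m * of_real (b m)) - (\<Sum>m<N. a m * of_real (b m)) = (\<Sum>m\<in>{N..<M}. a m * of_real (b m))"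
      by (metis (no_types, lifting) lessThan_atLeast0 sum_diff_nat_ivl zero_le)
    then show "norm ((\<Sum>m<M. a m * of_real (b m)) - (\<Sum>m<N. a m * of_real (b m))) \<le> 2 * A * b N"
      using norm_sum_tail_decseq_le[OF A b] by simp
  qed
qed

lemma periodic_sum_block:
  fixes g :: "nat \<Rightarrow> 'a::comm_monoid_add"
  assumes "\<And>m. g (m + n) = g m"
  shows "(\<Sum>m<n. g (m + k)) = (\<Sum>m<n. g m)"
proof (induction k)
  case (Suc k)
  show ?case
  proof (cases n)
    case (Suc n')
    have "(\<Sum>m<n. g (m + Suc k)) = (\<Sum>m<n'. g (m + Suc k)) + g k"
      using assms[of k] Suc by (simp add: add.commute)
    also have "\<dots> = (\<Sum>m<n. g (m + k))"
      unfolding Suc by (simp add: sum.lessThan_Suc_shift add.commute del: sum.lessThan_Suc)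
    finally show ?thesis using \<open>_ = (\<Sum>m<n. g m)\<close> by simp
  qed simp
qed simp

lemma periodic_mult:
  fixes g :: "nat \<Rightarrow> 'a"
  assumes "\<And>m. g (m + n) = g m"
  shows "g (m + k * n) = g m"
proof (induction k)
  case (Suc k)
  then show ?case using assms[of "m + k * n"] by (simp add: algebra_simps)
qed simp

lemma periodic_mod:
  fixes g :: "nat \<Rightarrow> 'a"
  assumes "\<And>m. g (m + n) = g m"
  shows "g (m mod n) = g m"
  using periodic_mult[of g n "m mod n" "m div n"] assms by simp

lemma periodic_cong:
  fixes g :: "nat \<Rightarrow> 'a"
  assumes "\<And>m. g (m + n) = g m" "m mod n = m' mod n"
  shows "g m = g m'"
  using periodic_mod[of g n] assms by metis

text \<open>Mean zero makes the partial sums periodic as well, so they take finitely many values.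
  The offset \<open>j\<close> allows sums that start at index 1.\<close>

lemma periodic_partial_sums_bounded:
  fixes g :: "nat \<Rightarrow> 'a::real_normed_vector"
  assumes per: "\<And>m. g (m + n) = g m" and "n > 0" and mean: "(\<Sum>m<n. g m) = 0"
  obtains A where "\<And>k. norm (\<Sum>m<k. g (m + j)) \<le> A"
proof -
  define S where "S k = (\<Sum>m<k. g (m + j))" for k
  have "S (k + n) = S k" for k
  proof -
    have "S (k + n) = S k + (\<Sum>m<n. g (m + (k + j)))"
      unfolding S_def by (induction n) (simp_all add: algebra_simps)
    then show ?thesis using periodic_sum_block[of g n "k + j"] per mean by simp
  qed
  then have mod: "S k = S (k mod n)" for k
    using periodic_mod[of S n k] by simp
  have "norm (S k) \<le> Max ((\<lambda>k. norm (S k)) ` {..<n})" for k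
    unfolding mod[of k] using \<open>n > 0\<close> by (intro Max_ge) auto
  then show ?thesis using that unfolding S_def by blast
qed

section \<open>Nonvanishing of \<open>L(1)\<close>\<close>

lemma norm_341_le:
  fixes z :: complex and x :: real
  assumes z: "norm z \<le> 1" and x: "0 \<le> x" "x < 1"
  shows "norm (1 - of_real x :: complex) ^ 3 * norm (1 - z * of_real x) ^ 4 * norm (1 - z\<^sup>2 * of_real x) \<le> 1"
proof -
  have Ln: "(\<lambda>k. - Re (w ^ k) / of_nat k) sums ln (norm (1 - w))" "1 - w \<noteq> 0" if "norm w < 1" for w :: complex
  proof -
    show nz: "1 - w \<noteq> 0" using that by auto
    have "(\<lambda>k. - (w ^ k) / of_nat k) sums Ln (1 - w)"
      using Ln_series'[of "- w"] that by simp
    from sums_Re[OF this] show "(\<lambda>k. - Re (w ^ k) / of_nat k) sums ln (norm (1 - w))"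
      using nz by simp
  qed
  have lt: "norm (of_real x :: complex) < 1" "norm (z * of_real x) < 1" "norm (z\<^sup>2 * of_real x) < 1"
    using x z by (auto simp: norm_mult norm_power abs_mult intro: le_less_trans[OF mult_left_le_one_le]
       le_less_trans[OF mult_left_le_one_le[OF _ _ power_le_one]])
  have "(\<lambda>k. 3 * (- Re (of_real x ^ k) / of_nat k) + 4 * (- Re ((z * of_real x) ^ k) / of_nat k)
         + (- Re ((z\<^sup>2 * of_real x) ^ k) / of_nat k)) sums
       (3 * ln (norm (1 - of_real x :: complex)) + 4 * ln (norm (1 - z * of_real x)) + ln (norm (1 - z\<^sup>2 * of_real x)))"
    by (intro sums_add sums_mult Ln lt)
  moreover have "3 * (- Re (of_real x ^ k) / of_nat k) + 4 * (- Re ((z * of_real x) ^ k) / of_nat k)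
         + (- Re ((z\<^sup>2 * of_real x) ^ k) / of_nat k) \<le> 0" for k
  proof -
    define w where "w = z ^ k"
    have "norm w \<le> 1" unfolding w_def norm_power using z by (simp add: power_le_one)
    then have "(Re w)\<^sup>2 + (Im w)\<^sup>2 \<le> 1" by (simp add: cmod_def)
    \<comment> \<open>On the unit circle this is 3 + 4 cos x + cos 2x = 2 (1 + cos x)^2. The last
      bracket, 1 - |w|^2, accounts for values inside the disc, such as zeros of the
      character.\<close>
    moreover have "3 + 4 * Re w + (Re w)\<^sup>2 - (Im w)\<^sup>2 = 2 * (1 + Re w)\<^sup>2 + (1 - (Re w)\<^sup>2 - (Im w)\<^sup>2)"
      by (simp add: power2_eq_square algebra_simps)
    ultimately have "0 \<le> 3 + 4 * Re w + (Re w)\<^sup>2 - (Im w)\<^sup>2"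
      using zero_le_power2[of "1 + Re w"] by linarith
    then have pos: "0 \<le> 3 + 4 * Re w + Re (w\<^sup>2)" by (simp add: Re_power2)
    have e1: "(z * of_real x) ^ k = w * of_real (x ^ k)" by (simp add: w_def power_mult_distrib)
    have e2: "(z\<^sup>2 * of_real x) ^ k = w\<^sup>2 * of_real (x ^ k)" 
      by (simp add: w_def power_mult_distrib) (metis power_mult mult.commute)
    have e3: "of_real x ^ k = (of_real (x ^ k) :: complex)" by simp
    have "3 * (- Re (of_real x ^ k) / of_nat k) + 4 * (- Re ((z * of_real x) ^ k) / of_nat k)
         + (- Re ((z\<^sup>2 * of_real x) ^ k) / of_nat k) = - ((3 + 4 * Re w + Re (w\<^sup>2)) * x ^ k / of_nat k)"
      unfolding e1 e2 e3 by (simp add: add_divide_distrib diff_divide_distrib algebra_simps del: of_real_power)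
    also have "\<dots> \<le> 0" using pos x by simp
    finally show ?thesis .
  qed
  ultimately have "3 * ln (norm (1 - of_real x :: complex)) + 4 * ln (norm (1 - z * of_real x)) + ln (norm (1 - z\<^sup>2 * of_real x)) \<le> 0"
    by (metis (no_types, lifting) sums_le sums_zero)
  moreover have "norm (1 - of_real x :: complex) > 0" "norm (1 - z * of_real x) > 0" "norm (1 - z\<^sup>2 * of_real x) > 0"
    using Ln(2)[OF lt(1)] Ln(2)[OF lt(2)] Ln(2)[OF lt(3)] by simp_all
  ultimately have "ln (norm (1 - of_real x :: complex) ^ 3 * norm (1 - z * of_real x) ^ 4 * norm (1 - z\<^sup>2 * of_real x)) \<le> 0"
    by (simp add: ln_mult ln_realpow)
  then show ?thesis
    using \<open>norm (1 - of_real x :: complex) > 0\<close> \<open>norm (1 - z * of_real x) > 0\<close> \<open>norm (1 - z\<^sup>2 * of_real x) > 0\<close>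
    by (subst (asm) ln_le_zero_iff) auto
qed

text \<open>A sieve: multiplying the full sum by \<open>1 - f p\<close> deletes the terms at
  multiples of \<open>p\<close>. After all primes up to \<open>N\<close> only index 1 and indices
  above \<open>N\<close> can contribute, and absolute convergence makes the latter
  negligible.\<close>

lemma euler_product_tendsto:
  fixes f :: "nat \<Rightarrow> complex"
  assumes f0: "f 0 = 0" and f1: "f 1 = 1" and mult: "\<And>a b. f (a * b) = f a * f b"
    and sm: "summable (\<lambda>m. norm (f m))"
  shows "(\<lambda>N. (\<Prod>p | prime p \<and> p \<le> N. 1 - f p) * (\<Sum>m. f m)) \<longlonglongrightarrow> 1"
proof -
  have "(\<lambda>m. norm (f m)) summable_on UNIV"
    using sm by (intro norm_summable_imp_summable_on) simp
  then have abs: "(\<lambda>m. norm (f m)) summable_on B" for B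
    using summable_on_subset_banach by blast
  then have so: "f summable_on B" for B
    using abs_summable_summable by blast
  \<comment> \<open>The indices surviving the sieve by \<open>P\<close>. Index 0 survives only for
    empty \<open>P\<close>; it contributes nothing by \<open>f0\<close>.\<close>
  define C where "C P = {m::nat. \<forall>p\<in>P. \<not> p dvd m}" for P
  have step: "infsum f (C (insert p P)) = (1 - f p) * infsum f (C P)"
    if P: "\<forall>q\<in>P. prime q" and p: "prime p" "p \<notin> P" for p P
  proof -
    have ne: "\<not> q dvd p" if "q \<in> P" for q
      using primes_dvd_imp_eq[of q p] that P p by blast
    have un: "C P = C (insert p P) \<union> (*) p ` C P"
    proof (intro equalityI subsetI)
      fix m assume m: "m \<in> C P"
      show "m \<in> C (insert p P) \<union> (*) p ` C P"
      proof (cases "p dvd m")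
        case True
        then obtain k where "m = p * k" by blast
        moreover from this m have "k \<in> C P" by (auto simp: C_def)
        ultimately show ?thesis by blast
      qed (use m in \<open>auto simp: C_def\<close>)
    next
      fix m assume "m \<in> C (insert p P) \<union> (*) p ` C P"
      then consider "m \<in> C (insert p P)" | k where "m = p * k" "k \<in> C P" by blast
      then show "m \<in> C P"
      proof cases
        case 2
        then show ?thesis unfolding C_def using P ne prime_dvd_multD[of _ p k] by blast
      qed (simp add: C_def)
    qed
    have "infsum f (C (insert p P) \<union> (*) p ` C P) = infsum f (C (insert p P)) + infsum f ((*) p ` C P)"
      by (rule infsum_Un_disjoint[OF so so]) (auto simp: C_def)
    then have "infsum f (C P) = infsum f (C (insert p P)) + infsum f ((*) p ` C P)"
      unfolding un[symmetric] .
    also have "infsum f ((*) p ` C P) = infsum (f \<circ> (*) p) (C P)"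
      by (rule infsum_reindex) (use p in \<open>auto simp: inj_on_def\<close>)
    also have "\<dots> = f p * infsum f (C P)"
      unfolding o_def mult by (rule infsum_cmult_right')
    finally show ?thesis by (metis (no_types) add_diff_cancel_right' left_diff_distrib mult_1)
  qed
  have prod: "(\<Prod>p\<in>P. 1 - f p) * infsum f UNIV = infsum f (C P)" if "finite P" "\<forall>q\<in>P. prime q" for P
    using that
  proof (induction P rule: finite_induct)
    case empty
    then show ?case by (simp add: C_def)
  next
    case (insert p P)
    then show ?case using step[of P p] by (simp add: mult.assoc)
  qed
  have "(f has_sum (\<Sum>m. f m)) UNIV"
    by (rule norm_summable_imp_has_sum[OF sm summable_sums[OF summable_norm_cancel[OF sm]]])
  then have inf: "infsum f UNIV = (\<Sum>m. f m)" by (simp add: infsumI)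
  have est: "norm (infsum f (C {p. prime p \<and> p \<le> N}) - 1) \<le> (\<Sum>m. norm (f (m + Suc N)))" for N
  proof -
    define B where "B = C {p. prime p \<and> p \<le> N} - {1}"
    have "C {p. prime p \<and> p \<le> N} = insert 1 B"
      by (auto simp: B_def C_def)
    then have "infsum f (C {p. prime p \<and> p \<le> N}) = infsum f {1} + infsum f B"
      using infsum_Un_disjoint[OF so[of "{1}"] so[of B]] by (simp add: B_def)
    then have eq: "infsum f (C {p. prime p \<and> p \<le> N}) - 1 = infsum f B"
      using f1 by simp
    have "norm (infsum f B) \<le> infsum (\<lambda>m. norm (f m)) B"
      by (rule norm_infsum_bound[OF abs])
    also have "\<dots> \<le> infsum (\<lambda>m. norm (f m)) ({0} \<union> {Suc N..})"
    proof (rule infsum_mono_neutral[OF abs abs])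
      fix m assume "m \<in> B - ({0} \<union> {Suc N..})"
      then have m: "m > 0" "m \<le> N" "m \<noteq> 1" "\<forall>p. prime p \<and> p \<le> N \<longrightarrow> \<not> p dvd m" by (auto simp: B_def C_def)
      then obtain p where "prime p" "p dvd m" using prime_factor_nat by blast
      then show "norm (f m) \<le> 0" using m dvd_imp_le[of p m] by auto
    qed auto
    also have "\<dots> = infsum (\<lambda>m. norm (f m)) {Suc N..}"
      by (rule infsum_cong_neutral) (auto simp: f0)
    also have "{Suc N..} = (\<lambda>m. m + Suc N) ` UNIV"
      by (auto simp: image_iff) (metis add.commute le_Suc_ex add_Suc_right)
    also have "infsum (\<lambda>m. norm (f m)) ((\<lambda>m. m + Suc N) ` UNIV) = infsum (\<lambda>m. norm (f (m + Suc N))) UNIV"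
      by (subst infsum_reindex) (auto simp: inj_on_def o_def)
    also have "\<dots> = (\<Sum>m. norm (f (m + Suc N)))"
    proof -
      have "summable (\<lambda>m. norm (f (m + Suc N)))" using sm summable_iff_shift[of "\<lambda>m. norm (f m)" "Suc N"] by simp
      then have "((\<lambda>m. norm (f (m + Suc N))) has_sum (\<Sum>m. norm (f (m + Suc N)))) UNIV"
        by (intro norm_summable_imp_has_sum) (auto intro: summable_sums)
      then show ?thesis by (rule infsumI)
    qed
    finally show ?thesis unfolding eq .
  qed
  have lim: "(\<lambda>N. \<Sum>m. norm (f (m + Suc N))) \<longlonglongrightarrow> 0"
    using suminf_exist_split2[OF sm] by (rule LIMSEQ_Suc)
  have "(\<lambda>N. infsum f (C {p. prime p \<and> p \<le> N})) \<longlonglongrightarrow> 1"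
  proof (rule LIM_zero_cancel, rule Lim_null_comparison[OF _ lim])
    show "\<forall>\<^sub>F N in sequentially. norm (infsum f (C {p. prime p \<and> p \<le> N}) - 1) \<le> (\<Sum>m. norm (f (m + Suc N)))"
      using est by simp
  qed
  moreover have "(\<Prod>p | prime p \<and> p \<le> N. 1 - f p) * (\<Sum>m. f m) = infsum f (C {p. prime p \<and> p \<le> N})" for N
    unfolding inf[symmetric] by (rule prod) (auto intro: finite_subset[of _ "{..N}"])
  ultimately show ?thesis by simp
qed

section \<open>Dirichlet series at 1 + e\<close>

lemma powr_diff_bounds:
  fixes x e :: real
  assumes "x > 0" "e > 0"
  shows "e * (x + 1) powr (- 1 - e) \<le> x powr (- e) - (x + 1) powr (- e)"
    and "x powr (- e) - (x + 1) powr (- e) \<le> e * x powr (- 1 - e)"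
proof -
  have "\<exists>z>x. z < x + 1 \<and> (x + 1) powr (- e) - x powr (- e) = ((x + 1) - x) * (- e * z powr (- 1 - e))"
  proof (rule MVT2)
    fix y assume "x \<le> y"
    then have "((\<lambda>y. y powr (- e)) has_real_derivative - e * y powr (- e - 1)) (at y)"
      using assms by (intro DERIV_powr has_real_derivative_powr) auto
    moreover have "- e - 1 = - 1 - e" by simp
    ultimately show "((\<lambda>y. y powr (- e)) has_real_derivative - e * y powr (- 1 - e)) (at y)" by metis
  qed simp
  then obtain z where z: "x < z" "z < x + 1" and eq: "(x + 1) powr (- e) - x powr (- e) = - (e * z powr (- 1 - e))" by auto
  have "e * (x + 1) powr (- 1 - e) \<le> e * z powr (- 1 - e)" "e * z powr (- 1 - e) \<le> e * x powr (- 1 - e)"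
    using z assms by (auto intro!: mult_left_mono powr_mono2')
  then show "e * (x + 1) powr (- 1 - e) \<le> x powr (- e) - (x + 1) powr (- e)"
    and "x powr (- e) - (x + 1) powr (- e) \<le> e * x powr (- 1 - e)"
    using eq by linarith+
qed

text \<open>The sum is compared with a telescoping one: each term is at most a decrement of
  \<open>x powr (- e) / e\<close>. The term at 0 is 0 because \<open>0 powr y = 0\<close>.\<close>

lemma suminf_powr_le:
  fixes e :: real
  assumes e: "e > 0"
  shows "(\<Sum>m. of_nat m powr (- 1 - e)) \<le> 1 + 1 / e"
proof (rule suminf_le_const)
  show "summable (\<lambda>m. of_nat m powr (- 1 - e))" using e by (simp add: summable_real_powr_iff)
  fix M
  \<comment> \<open>With \<open>M + 2\<close> terms the base case consists of the indices 0 and 1,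
    and the decrements start at \<open>x = 1\<close>.\<close>
  have "(\<Sum>m<M + 2. of_nat m powr (- 1 - e)) \<le> 1 + (1 - of_nat (M + 1) powr (- e)) / e"
  proof (induction M)
    case (Suc M)
    have "e * (of_nat (M + 1) + 1) powr (- 1 - e) \<le> of_nat (M + 1) powr (- e) - (of_nat (M + 1) + 1) powr (- e)"
      by (rule powr_diff_bounds) (use e in auto)
    then have "of_nat (M + 2) powr (- 1 - e) \<le> (of_nat (M + 1) powr (- e) - of_nat (M + 2) powr (- e)) / e"
      using e by (simp add: field_simps)
    then show ?case using Suc by (simp add: diff_divide_distrib)
  qed (simp add: numeral_2_eq_2)
  also have "\<dots> \<le> 1 + 1 / e" using e by (simp add: divide_right_mono)
  finally have "(\<Sum>m<M + 2. of_nat m powr (- 1 - e)) \<le> 1 + 1 / e" .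
  moreover have "(\<Sum>m<M. of_nat m powr (- 1 - e)) \<le> (\<Sum>m<M + 2. of_nat m powr (- 1 - e))"
    by (intro sum_mono2) auto
  ultimately show "(\<Sum>m<M. of_nat m powr (- 1 - e)) \<le> 1 + 1 / e" by linarith
qed

lemma powr_decseq:
  assumes "(0::real) < s"
  shows "decseq (\<lambda>m. real (Suc m) powr (- s))"
  by (rule decseq_SucI) (use assms in \<open>auto intro!: powr_mono2'\<close>)

text \<open>The bound does not depend on \<open>s\<close>, which will tend to 1: the weights
  \<open>m powr (- s)\<close> decrease from 1 for every positive \<open>s\<close>.\<close>

lemma norm_dirichlet_series_le:
  fixes g :: "nat \<Rightarrow> complex" and s :: real
  assumes A: "\<And>k. norm (\<Sum>m<k. g (Suc m)) \<le> A" and s: "s > 0"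
    and sm: "summable (\<lambda>m. g m * of_real (of_nat m powr (- s)))"
  shows "norm (\<Sum>m. g m * of_real (of_nat m powr (- s))) \<le> 2 * A"
proof -
  have "(\<lambda>m. g m * of_real (of_nat m powr (- s))) sums (\<Sum>m. g m * of_real (of_nat m powr (- s)))"
    using sm by (rule summable_sums)
  then have "(\<lambda>m. g (Suc m) * of_real (of_nat (Suc m) powr (- s))) sums (\<Sum>m. g m * of_real (of_nat m powr (- s)))"
    by (subst sums_Suc_iff) simp
  from norm_suminf_tail_decseq_le[OF A powr_decseq[OF s] _ this, of 0] show ?thesis
    by simp
qed

text \<open>A zero at 1 forces size O(e) at 1 + e. The partial sums at 1 are minus the tails, hence
  O(1/N). A second summation by parts, now against \<open>m powr (- e)\<close> with decrements at
  most e/m, leaves e times a multiple of the sum of 1/m^2.\<close>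

lemma norm_dirichlet_series_near_zero_le:
  fixes g :: "nat \<Rightarrow> complex" and e :: real
  assumes A: "\<And>k. norm (\<Sum>m<k. g (Suc m)) \<le> A" and L: "(\<lambda>m. g m / of_nat m) sums 0" and e: "e > 0"
    and sm: "summable (\<lambda>m. g m * of_real (of_nat m powr (- 1 - e)))"
  shows "norm (\<Sum>m. g m * of_real (of_nat m powr (- 1 - e))) \<le> 2 * A * (\<Sum>m. 1 / (of_nat (Suc m))\<^sup>2) * e"
proof -
  define T where "T N = (\<Sum>m<N. g (Suc m) / of_nat (Suc m))" for N
  define c where "c m = real (Suc m) powr (- e)" for m
  have A0: "0 \<le> A" using A[of 0] by simp
  have "(\<lambda>m. g (Suc m) / of_nat (Suc m)) sums 0"
    using L by (subst sums_Suc_iff) simp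
  then have "(\<lambda>m. g (Suc m) * of_real (1 / real (Suc m))) sums 0" by simp
  from norm_suminf_tail_decseq_le[OF A _ _ this] have T: "norm (T N) \<le> 2 * A / of_nat (Suc N)" for N
    by (simp add: T_def decseq_Suc_iff field_simps)
  have eq: "(\<Sum>m<M. g (Suc m) / of_nat (Suc m) * of_real (c m)) = T M * of_real (c M) + (\<Sum>m<M. T (Suc m) * of_real (c m - c (Suc m)))" for M
    by (induction M) (simp_all add: T_def algebra_simps diff_divide_distrib)
  have c: "0 \<le> c m" "c m \<le> 1" "c (Suc m) \<le> c m" "c m - c (Suc m) \<le> e / of_nat (Suc m)" for m
  proof -
    show "0 \<le> c m" by (simp add: c_def)
    have "real (Suc m) powr (- e) \<le> real (Suc m) powr 0" using e by (intro powr_mono) auto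
    then show "c m \<le> 1" by (simp add: c_def)
    show "c (Suc m) \<le> c m" using powr_decseq[OF e] unfolding c_def decseq_Suc_iff by blast
    have "c m - c (Suc m) \<le> e * real (Suc m) powr (- 1 - e)"
      using powr_diff_bounds(2)[of "real (Suc m)" e] e by (simp add: c_def add.commute)
    also have "\<dots> \<le> e * real (Suc m) powr (- 1)"
      using e by (intro mult_left_mono powr_mono) auto
    finally show "c m - c (Suc m) \<le> e / of_nat (Suc m)"
      by (simp add: powr_minus field_simps)
  qed
  have sq: "summable (\<lambda>m. 1 / (of_nat (Suc m))\<^sup>2 :: real)"
    using inverse_squares_sums by (simp add: sums_iff add.commute)
  have bound: "norm (\<Sum>m<M. g (Suc m) / of_nat (Suc m) * of_real (c m)) \<le> 2 * A / of_nat (Suc M) + 2 * A * (\<Sum>m. 1 / (of_nat (Suc m))\<^sup>2) * e" for M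
  proof -
    have "norm (T M * of_real (c M)) \<le> 2 * A / of_nat (Suc M) * 1"
      unfolding norm_mult using T[of M] c[of M] A0 by (intro mult_mono) auto
    moreover have "norm (\<Sum>m<M. T (Suc m) * of_real (c m - c (Suc m))) \<le> (\<Sum>m<M. 2 * A * e * (1 / (of_nat (Suc m))\<^sup>2))"
    proof (rule sum_norm_le)
      fix m
      have "norm (T (Suc m) * of_real (c m - c (Suc m))) \<le> (2 * A / of_nat (Suc (Suc m))) * (e / of_nat (Suc m))"
        unfolding norm_mult norm_of_real using T[of "Suc m"] c[of m] A0 by (intro mult_mono) (auto simp del: of_nat_Suc)
      also have "\<dots> \<le> (2 * A / of_nat (Suc m)) * (e / of_nat (Suc m))"
        using A0 e by (intro mult_right_mono divide_left_mono) auto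
      finally show "norm (T (Suc m) * of_real (c m - c (Suc m))) \<le> 2 * A * e * (1 / (of_nat (Suc m))\<^sup>2)"
        by (simp add: power2_eq_square)
    qed
    moreover have "(\<Sum>m<M. 2 * A * e * (1 / (of_nat (Suc m))\<^sup>2)) \<le> 2 * A * e * (\<Sum>m. 1 / (of_nat (Suc m))\<^sup>2)"
      unfolding sum_distrib_left[symmetric]
      using sum_le_suminf[OF sq, of "{..<M}"] A0 e by (intro mult_left_mono) auto
    ultimately show ?thesis
      unfolding eq using norm_triangle_ineq[of "T M * of_real (c M)" "\<Sum>m<M. T (Suc m) * of_real (c m - c (Suc m))"]
      by (simp add: algebra_simps)
  qed
  have "(\<lambda>m. g m * of_real (of_nat m powr (- 1 - e))) sums (\<Sum>m. g m * of_real (of_nat m powr (- 1 - e)))"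
    using sm by (rule summable_sums)
  then have "(\<lambda>m. g (Suc m) * of_real (of_nat (Suc m) powr (- 1 - e))) sums (\<Sum>m. g m * of_real (of_nat m powr (- 1 - e)))"
    by (subst sums_Suc_iff) simp
  moreover have "g (Suc m) * of_real (of_nat (Suc m) powr (- 1 - e)) = g (Suc m) / of_nat (Suc m) * of_real (c m)" for m
  proof -
    have "real (Suc m) powr (- 1 - e) = c m / real (Suc m)"
      using powr_add[of "real (Suc m)" "- 1" "- e"] by (simp add: c_def powr_minus_divide)
    then show ?thesis by simp
  qed
  ultimately have "(\<lambda>m. g (Suc m) / of_nat (Suc m) * of_real (c m)) sums (\<Sum>m. g m * of_real (of_nat m powr (- 1 - e)))"
    by simp
  then have "(\<lambda>M. norm (\<Sum>m<M. g (Suc m) / of_nat (Suc m) * of_real (c m))) \<longlonglongrightarrow> norm (\<Sum>m. g m * of_real (of_nat m powr (- 1 - e)))"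
    unfolding sums_def by (rule tendsto_norm)
  moreover have "(\<lambda>M. 2 * A / of_nat (Suc M) + 2 * A * (\<Sum>m. 1 / (of_nat (Suc m))\<^sup>2) * e) \<longlonglongrightarrow> 0 + 2 * A * (\<Sum>m. 1 / (of_nat (Suc m))\<^sup>2) * e"
    by (intro tendsto_add tendsto_const LIMSEQ_Suc[OF lim_const_over_n])
  ultimately show ?thesis
    using LIMSEQ_le[OF _ _ exI[of _ 0]] bound by (metis (no_types, lifting) add_0)
qed

text \<open>\<open>norm_341_le\<close> is multiplied over the primes up to \<open>N\<close>, with
  \<open>x = p powr (- s)\<close>. The finite Euler factors times the three series tend to 1, while
  their 3-4-1 combination never exceeds that of the series alone.\<close>

lemma zeta_341_ge_1:
  fixes \<psi> :: "nat \<Rightarrow> complex"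
  assumes one: "\<psi> 1 = 1" and mult: "\<And>a b. \<psi> (a * b) = \<psi> a * \<psi> b" and le: "\<And>m. norm (\<psi> m) \<le> 1" and s: "s > 1"
  shows "1 \<le> (\<Sum>m. of_nat m powr (- s)) ^ 3 * norm (\<Sum>m. \<psi> m * of_real (of_nat m powr (- s))) ^ 4
      * norm (\<Sum>m. (\<psi> m)\<^sup>2 * of_real (of_nat m powr (- s)))"
proof -
  define x where "x p = real p powr (- s)" for p
  define P where "P N = {p. prime p \<and> p \<le> N}" for N :: nat
  have sx: "summable x" unfolding x_def using s by (simp add: summable_real_powr_iff)
  have sm: "summable (\<lambda>m. norm (h m * complex_of_real (x m)))" if "\<And>m. norm (h m) \<le> 1" for h :: "nat \<Rightarrow> complex"
  proof (rule summable_comparison_test'[OF sx, of 0])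
    fix m
    show "norm (norm (h m * complex_of_real (x m))) \<le> x m"
      using that[of m] by (simp add: norm_mult x_def mult_left_le_one_le)
  qed
  have E: "(\<lambda>N. (\<Prod>p\<in>P N. 1 - h p * of_real (x p)) * (\<Sum>m. h m * of_real (x m))) \<longlonglongrightarrow> 1"
    if "h 1 = 1" "\<And>a b. h (a * b) = h a * h b" "\<And>m. norm (h m) \<le> 1" for h :: "nat \<Rightarrow> complex"
    unfolding P_def by (rule euler_product_tendsto[OF _ _ _ sm]) (use that in \<open>auto simp: x_def powr_mult\<close>)
  have sq_le: "norm ((\<psi> m)\<^sup>2) \<le> 1" for m using le[of m] by (simp add: norm_power power_le_one)
  have E1: "(\<lambda>N. (\<Prod>p\<in>P N. 1 - of_real (x p) :: complex) * (\<Sum>m. of_real (x m))) \<longlonglongrightarrow> 1"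
    using E[of "\<lambda>_. 1"] by simp
  have E2: "(\<lambda>N. (\<Prod>p\<in>P N. 1 - \<psi> p * of_real (x p)) * (\<Sum>m. \<psi> m * of_real (x m))) \<longlonglongrightarrow> 1"
    by (rule E) (use one mult le in auto)
  have E3: "(\<lambda>N. (\<Prod>p\<in>P N. 1 - (\<psi> p)\<^sup>2 * of_real (x p)) * (\<Sum>m. (\<psi> m)\<^sup>2 * of_real (x m))) \<longlonglongrightarrow> 1"
    by (rule E) (use one mult sq_le in \<open>auto simp: power_mult_distrib\<close>)
  define Z where "Z = norm (\<Sum>m. complex_of_real (x m)) ^ 3 * norm (\<Sum>m. \<psi> m * of_real (x m)) ^ 4 * norm (\<Sum>m. (\<psi> m)\<^sup>2 * of_real (x m))"
  have "(\<lambda>N. norm ((\<Prod>p\<in>P N. 1 - of_real (x p) :: complex) * (\<Sum>m. of_real (x m))) ^ 3 *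
      norm ((\<Prod>p\<in>P N. 1 - \<psi> p * of_real (x p)) * (\<Sum>m. \<psi> m * of_real (x m))) ^ 4 *
      norm ((\<Prod>p\<in>P N. 1 - (\<psi> p)\<^sup>2 * of_real (x p)) * (\<Sum>m. (\<psi> m)\<^sup>2 * of_real (x m)))) \<longlonglongrightarrow> norm (1::complex) ^ 3 * norm (1::complex) ^ 4 * norm (1::complex)"
    by (intro tendsto_intros E1 E2 E3)
  moreover have "norm ((\<Prod>p\<in>P N. 1 - of_real (x p) :: complex) * (\<Sum>m. of_real (x m))) ^ 3 *
      norm ((\<Prod>p\<in>P N. 1 - \<psi> p * of_real (x p)) * (\<Sum>m. \<psi> m * of_real (x m))) ^ 4 *
      norm ((\<Prod>p\<in>P N. 1 - (\<psi> p)\<^sup>2 * of_real (x p)) * (\<Sum>m. (\<psi> m)\<^sup>2 * of_real (x m))) \<le> Z" for N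
  proof -
    have "norm ((\<Prod>p\<in>P N. 1 - of_real (x p) :: complex) * (\<Sum>m. of_real (x m))) ^ 3 *
      norm ((\<Prod>p\<in>P N. 1 - \<psi> p * of_real (x p)) * (\<Sum>m. \<psi> m * of_real (x m))) ^ 4 *
      norm ((\<Prod>p\<in>P N. 1 - (\<psi> p)\<^sup>2 * of_real (x p)) * (\<Sum>m. (\<psi> m)\<^sup>2 * of_real (x m)))
      = (\<Prod>p\<in>P N. norm (1 - of_real (x p) :: complex) ^ 3 * norm (1 - \<psi> p * of_real (x p)) ^ 4 * norm (1 - (\<psi> p)\<^sup>2 * of_real (x p))) * Z"
      by (simp add: Z_def norm_mult prod_norm[symmetric] power_mult_distrib prod.distrib prod_power_distrib mult_ac)
    also have "\<dots> \<le> 1 * Z"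
    proof (rule mult_right_mono)
      show "(\<Prod>p\<in>P N. norm (1 - of_real (x p) :: complex) ^ 3 * norm (1 - \<psi> p * of_real (x p)) ^ 4 * norm (1 - (\<psi> p)\<^sup>2 * of_real (x p))) \<le> 1"
      proof (rule prod_le_1)
        fix p assume "p \<in> P N"
        then have "1 < p" using prime_gt_1_nat[of p] by (simp add: P_def)
        then have "x p < 1" using s powr_less_mono[of "- s" 0 "real p"] by (simp add: x_def)
        then show "0 \<le> norm (1 - of_real (x p) :: complex) ^ 3 * norm (1 - \<psi> p * of_real (x p)) ^ 4 * norm (1 - (\<psi> p)\<^sup>2 * of_real (x p)) \<and>
           norm (1 - of_real (x p) :: complex) ^ 3 * norm (1 - \<psi> p * of_real (x p)) ^ 4 * norm (1 - (\<psi> p)\<^sup>2 * of_real (x p)) \<le> 1"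
          using norm_341_le[OF le, of "x p" p] by (simp add: x_def)
      qed
      show "0 \<le> Z" by (simp add: Z_def)
    qed
    finally show ?thesis by simp
  qed
  ultimately have "1 \<le> Z" using LIMSEQ_le_const2 by (metis (no_types, lifting) norm_one power_one mult_1)
  moreover have "norm (\<Sum>m. complex_of_real (x m)) = (\<Sum>m. x m)"
  proof -
    have "0 \<le> (\<Sum>m. x m)" by (rule suminf_nonneg[OF sx]) (simp add: x_def)
    then show ?thesis using suminf_of_real[OF sx, where 'a = complex, symmetric] by simp
  qed
  ultimately show ?thesis unfolding Z_def x_def by simp
qed

text \<open>With the three factors bounded by \<open>1 + 1 / e\<close>, \<open>C * e\<close> and
  \<open>2 * B\<close>, the 3-4-1 product is O(e), contrary to its lower bound 1.\<close>

lemma L_one_nonzero_if_square_nonprincipal: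
  fixes \<psi> :: "nat \<Rightarrow> complex"
  assumes one: "\<psi> 1 = 1" and mult: "\<And>a b. \<psi> (a * b) = \<psi> a * \<psi> b" and le: "\<And>m. norm (\<psi> m) \<le> 1"
    and per: "\<And>m. \<psi> (m + n) = \<psi> m" and n: "n > 0"
    and mean: "(\<Sum>m<n. \<psi> m) = 0" and mean2: "(\<Sum>m<n. (\<psi> m)\<^sup>2) = 0"
  shows "\<not> (\<lambda>m. \<psi> m / of_nat m) sums 0"
proof
  assume L: "(\<lambda>m. \<psi> m / of_nat m) sums 0"
  obtain A where A: "\<And>k. norm (\<Sum>m<k. \<psi> (m + 1)) \<le> A"
    using periodic_partial_sums_bounded[OF per n mean] by blast
  obtain B where B: "\<And>k. norm (\<Sum>m<k. (\<psi> (m + 1))\<^sup>2) \<le> B"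
    using periodic_partial_sums_bounded[of "\<lambda>m. (\<psi> m)\<^sup>2" n 1] per n mean2 by auto
  define C where "C = 2 * A * (\<Sum>m. 1 / (of_nat (Suc m))\<^sup>2)"
  have ineq: "1 \<le> (1 + 1 / e) ^ 3 * (C * e) ^ 4 * (2 * B)" if e: "e > 0" for e
  proof -
    have s: "1 + e > 1" using e by simp
    have ex: "- (1 + e) = - 1 - e" by simp
    have sx: "summable (\<lambda>m. real m powr (- 1 - e))" using e by (simp add: summable_real_powr_iff)
    have sm: "summable (\<lambda>m. h m * complex_of_real (real m powr (- 1 - e)))" if "\<And>m. norm (h m) \<le> 1" for h :: "nat \<Rightarrow> complex"
    proof (rule summable_comparison_test'[OF sx, of 0])
      fix m
      show "norm (h m * complex_of_real (real m powr (- 1 - e))) \<le> real m powr (- 1 - e)"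
        using that[of m] by (simp add: norm_mult mult_left_le_one_le)
    qed
    have 1: "(\<Sum>m. of_nat m powr (- 1 - e)) \<le> 1 + 1 / e" by (rule suminf_powr_le[OF e])
    have 0: "0 \<le> (\<Sum>m. of_nat m powr (- 1 - e) :: real)" by (rule suminf_nonneg[OF sx]) simp
    have 2: "norm (\<Sum>m. \<psi> m * of_real (of_nat m powr (- 1 - e))) \<le> C * e"
      unfolding C_def using norm_dirichlet_series_near_zero_le[OF _ L e sm[OF le]] A by simp
    have "norm ((\<psi> m)\<^sup>2) \<le> 1" for m using le[of m] by (simp add: norm_power power_le_one)
    from norm_dirichlet_series_le[of "\<lambda>m. (\<psi> m)\<^sup>2" B "1 + e", unfolded ex, OF _ _ sm[OF this]]
    have 3: "norm (\<Sum>m. (\<psi> m)\<^sup>2 * of_real (of_nat m powr (- 1 - e))) \<le> 2 * B" using B e by simp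
    have "1 \<le> (\<Sum>m. of_nat m powr (- 1 - e)) ^ 3 * norm (\<Sum>m. \<psi> m * of_real (of_nat m powr (- 1 - e))) ^ 4
      * norm (\<Sum>m. (\<psi> m)\<^sup>2 * of_real (of_nat m powr (- 1 - e)))"
      using zeta_341_ge_1[OF one mult le s] unfolding ex .
    also have "\<dots> \<le> (1 + 1 / e) ^ 3 * (C * e) ^ 4 * (2 * B)"
      using 0 1 2 3 e order_trans[OF norm_ge_zero 2] by (intro mult_mono power_mono mult_nonneg_nonneg) auto
    finally show ?thesis .
  qed
  have lim: "((\<lambda>e::real. e * (1 + e) ^ 3 * C ^ 4 * (2 * B)) \<longlongrightarrow> 0 * (1 + 0) ^ 3 * C ^ 4 * (2 * B)) (at_right 0)"
    by (intro tendsto_intros)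
  have "eventually (\<lambda>e::real. 1 \<le> e * (1 + e) ^ 3 * C ^ 4 * (2 * B)) (at_right 0)"
  proof (rule eventually_at_rightI[of 0 1])
    fix e :: real assume "e \<in> {0<..<1}"
    then have e: "e > 0" by simp
    \<comment> \<open>Three of the four powers of e absorb the pole of zeta; the fourth is left over
      and tends to 0.\<close>
    have "(1 + 1 / e) ^ 3 * (C * e) ^ 4 = ((1 + 1 / e) * e) ^ 3 * e * C ^ 4"
      by (simp add: power_mult_distrib power3_eq_cube power4_eq_xxxx mult_ac)
    also have "(1 + 1 / e) * e = 1 + e" using e by (simp add: field_simps)
    finally show "1 \<le> e * (1 + e) ^ 3 * C ^ 4 * (2 * B)" using ineq[OF e] by (simp add: mult_ac)
  qed simp
  from tendsto_lowerbound[OF lim this] show False by simp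
qed

section \<open>Real characters and Lambert series\<close>

lemma divisor_sum_coprime_mult:
  fixes r :: "nat \<Rightarrow> real"
  assumes mult: "\<And>a b. r (a * b) = r a * r b" and cop: "coprime a b" and pos: "a > 0" "b > 0"
  shows "(\<Sum>d | d dvd a * b. r d) = (\<Sum>d | d dvd a. r d) * (\<Sum>d | d dvd b. r d)"
proof -
  have g: "gcd a (x * y) = x" "gcd b (x * y) = y" if "x dvd a" "y dvd b" for x y
  proof -
    have "coprime a y" using cop that(2) coprime_divisors dvd_refl by blast
    then show "gcd a (x * y) = x" using that(1) by (simp add: gcd_mult_right_right_cancel gcd_nat.absorb2)
    have "coprime b x" using cop that(1) coprime_divisors dvd_refl coprime_commute by blast
    then show "gcd b (x * y) = y" using that(2) by (simp add: gcd_mult_right_left_cancel gcd_nat.absorb2)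
  qed
  have bij: "bij_betw (\<lambda>(x, y). x * y) ({d. d dvd a} \<times> {d. d dvd b}) {d. d dvd a * b}"
    unfolding bij_betw_def
  proof
    show "inj_on (\<lambda>(x, y). x * y) ({d. d dvd a} \<times> {d. d dvd b})"
      \<comment> \<open>Coprimality lets both factors of a divisor be read off by gcds.\<close>
      by (rule inj_on_inverseI[of _ "\<lambda>d. (gcd a d, gcd b d)"]) (auto simp: g)
    show "(\<lambda>(x, y). x * y) ` ({d. d dvd a} \<times> {d. d dvd b}) = {d. d dvd a * b}"
      by (force intro: mult_dvd_mono dest: division_decomp)
  qed
  have "(\<Sum>d | d dvd a. r d) * (\<Sum>d | d dvd b. r d) = (\<Sum>(x, y)\<in>{d. d dvd a} \<times> {d. d dvd b}. r (x * y))"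
    by (simp add: sum_product sum.cartesian_product mult)
  also have "\<dots> = (\<Sum>d | d dvd a * b. r d)"
    using sum.reindex_bij_betw[OF bij, of r] by (simp add: case_prod_unfold)
  finally show ?thesis by simp
qed

text \<open>At \<open>p ^ j\<close> the sum is geometric in \<open>r p\<close>: it equals j + 1 for
  \<open>r p = 1\<close>, is 1 for \<open>r p = 0\<close>, and alternates between 1 and 0 for
  \<open>r p = -1\<close>. So it is never negative, and at least 1 for even exponents; the induction
  splits off the full power of one prime.\<close>

lemma divisor_sum_real_character:
  fixes r :: "nat \<Rightarrow> real"
  assumes one: "r 1 = 1" and mult: "\<And>a b. r (a * b) = r a * r b" and vals: "\<And>m. r m \<in> {-1, 0, 1}"
    and m: "m > 0"
  shows "0 \<le> (\<Sum>d | d dvd m. r d) \<and> 1 \<le> (\<Sum>d | d dvd m\<^sup>2. r d)"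
  using m
proof (induction m rule: less_induct)
  case (less m)
  show ?case
  proof (cases "m = 1")
    case True
    then show ?thesis using one by simp
  next
    case False
    then obtain p where p: "prime p" "p dvd m" using prime_factor_nat by blast
    define k where "k = multiplicity p m"
    obtain m' where m': "m = p ^ k * m'" "\<not> p dvd m'"
      using multiplicity_decompose'[of m p] less.prems p unfolding k_def by (metis not_prime_unit not_gr_zero)
    have "m' > 0" using m'(1) less.prems by (cases m') auto
    have "k > 0" using p less.prems unfolding k_def by (simp add: prime_multiplicity_gt_zero_iff)
    then have "p ^ k > 1" using one_less_power[of p k] prime_gt_1_nat[OF p(1)] by simp
    then have "m' < m" using m'(1) \<open>m' > 0\<close> by simp
    from less.IH[OF this \<open>m' > 0\<close>] have IH: "0 \<le> (\<Sum>d | d dvd m'. r d)" "1 \<le> (\<Sum>d | d dvd m'\<^sup>2. r d)" by auto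
    have rpow: "r (p ^ i) = r p ^ i" for i using one mult by (induction i) auto
    have pp: "(\<Sum>d | d dvd p ^ j. r d) = (\<Sum>i\<le>j. r p ^ i)" for j
    proof -
      have "{d. d dvd p ^ j} = (\<lambda>i. p ^ i) ` {..j}"
        using divides_primepow_nat[OF p(1)] by auto
      moreover have "inj_on (\<lambda>i. p ^ i) {..j}" using p prime_gt_1_nat[of p] by (auto simp: inj_on_def power_inject_exp)
      ultimately show ?thesis by (simp add: sum.reindex rpow)
    qed
    have alt: "(\<Sum>i\<le>j. (-1::real) ^ i) = (if even j then 1 else 0)" for j by (induction j) auto
    have zero: "(\<Sum>i\<le>j. (0::real) ^ i) = 1" for j by (induction j) auto
    have 1: "0 \<le> (\<Sum>d | d dvd p ^ j. r d)" for j
      unfolding pp using vals[of p] by (auto simp: alt zero)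
    have 2: "1 \<le> (\<Sum>d | d dvd p ^ (2 * j). r d)" for j
      unfolding pp using vals[of p] by (auto simp: alt zero)
    have c: "coprime (p ^ j) (m' ^ i)" for i j
      using p m'(2) by (simp add: prime_imp_coprime)
    have "p > 0" using p prime_gt_0_nat by blast
    have "(\<Sum>d | d dvd m. r d) = (\<Sum>d | d dvd p ^ k. r d) * (\<Sum>d | d dvd m'. r d)"
      unfolding m'(1) using divisor_sum_coprime_mult[OF mult, of "p ^ k" m'] c[of k 1] \<open>p > 0\<close> \<open>m' > 0\<close> by simp
    moreover have "m\<^sup>2 = p ^ (2 * k) * m'\<^sup>2"
      unfolding m'(1) by (simp add: power_mult_distrib power_mult mult.commute)
    then have "(\<Sum>d | d dvd m\<^sup>2. r d) = (\<Sum>d | d dvd p ^ (2 * k). r d) * (\<Sum>d | d dvd m'\<^sup>2. r d)"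
      using divisor_sum_coprime_mult[OF mult, of "p ^ (2 * k)" "m'\<^sup>2"] c[of "2 * k" 2] \<open>p > 0\<close> \<open>m' > 0\<close> by simp
    moreover have "1 * 1 \<le> (\<Sum>d | d dvd p ^ (2 * k). r d) * (\<Sum>d | d dvd m'\<^sup>2. r d)"
      using 2[of k] IH by (intro mult_mono) auto
    ultimately show ?thesis using 1[of k] IH by simp
  qed
qed

text \<open>Arithmetic-geometric mean for the terms i and m - 1 - i. With x = sqrt t it controls 1 +
  t + ... + t^(m-1) and so the monotonicity of the weights in Monsky's argument.\<close>

lemma geometric_sum_ge:
  fixes x :: real
  assumes "0 \<le> x"
  shows "real m * x ^ (m - 1) \<le> (\<Sum>i<m. (x\<^sup>2) ^ i)"
proof -
  have "2 * (\<Sum>i<m. (x\<^sup>2) ^ i) = (\<Sum>i<m. (x\<^sup>2) ^ i) + (\<Sum>i<m. (x\<^sup>2) ^ (m - Suc i))"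
    using sum.nat_diff_reindex[of "\<lambda>i. (x\<^sup>2) ^ i" m] by simp
  also have "\<dots> = (\<Sum>i<m. (x\<^sup>2) ^ i + (x\<^sup>2) ^ (m - Suc i))"
    by (simp add: sum.distrib)
  also have "\<dots> \<ge> (\<Sum>i<m. 2 * x ^ (m - 1))"
  proof (rule sum_mono)
    fix i assume "i \<in> {..<m}"
    then have "x ^ (m - 1) = x ^ i * x ^ (m - Suc i)" by (simp flip: power_add)
    then show "2 * x ^ (m - 1) \<le> (x\<^sup>2) ^ i + (x\<^sup>2) ^ (m - Suc i)"
      using sum_squares_bound[of "x ^ i" "x ^ (m - Suc i)"] by (simp add: mult_ac flip: power_mult)
  qed
  finally show ?thesis by simp
qed

text \<open>Monsky's argument: if \<open>L(1, r) = 0\<close> then the Lambert series of \<open>r\<close> stays bounded as \<open>t\<close> tends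
  to 1, but it dominates the theta series \<open>\<Sum>t ^ j\<^sup>2\<close>.\<close>

lemma L_one_nonzero_real:
  fixes r :: "nat \<Rightarrow> real"
  assumes one: "r 1 = 1" and mult: "\<And>a b. r (a * b) = r a * r b" and vals: "\<And>m. r m \<in> {-1, 0, 1}"
    and per: "\<And>m. r (m + n) = r m" and n: "n > 0" and mean: "(\<Sum>m<n. r m) = 0"
  shows "\<not> (\<lambda>m. r m / of_nat m) sums 0"
proof
  assume L: "(\<lambda>m. r m / of_nat m) sums 0"
  obtain A where A: "\<And>k. norm (\<Sum>m<k. r (m + 1)) \<le> A"
    using periodic_partial_sums_bounded[OF per n mean] by blast
  have A0: "0 \<le> A" using A[of 0] by simp
  define T where "T N = (\<Sum>m<N. r (Suc m) / of_nat (Suc m))" for N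
  have "(\<lambda>m. r (Suc m) / of_nat (Suc m)) sums 0"
    using L by (subst sums_Suc_iff) simp
  then have "(\<lambda>m. r (m + 1) * of_real (1 / real (Suc m))) sums 0" by simp
  from norm_suminf_tail_decseq_le[OF A _ _ this] have T: "norm (T N) \<le> 2 * A / of_nat (Suc N)" for N
    by (simp add: T_def decseq_Suc_iff field_simps)
  define c where "c m = (\<Sum>d | d dvd m. r d)" for m
  have c: "0 \<le> c m" "1 \<le> c (m\<^sup>2)" if "m > 0" for m
    using divisor_sum_real_character[OF one mult vals that] by (auto simp: c_def)
  \<comment> \<open>For fixed \<open>t\<close> the two terms containing \<open>M\<close> tend to 0,
    so the power series of the divisor sums is bounded by \<open>A\<close>, uniformly in
    \<open>t\<close>.\<close>
  have upper: "(\<Sum>m=1..M. c m * t ^ m) \<le> A + 2 * A / (1 - t) / of_nat (Suc M) + of_nat M * t ^ M / (1 - t)"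
    if t: "0 < t" "t < 1" for t M
  proof -
    have tk: "t ^ k < 1" if "k > 0" for k using t that by (simp add: power_less_one_iff)
    have "(\<Sum>m=1..M. c m * t ^ m) = (\<Sum>m=1..M. \<Sum>d=1..M. if d dvd m then r d * t ^ m else 0)"
    proof (rule sum.cong[OF refl])
      fix m assume m: "m \<in> {1..M}"
      have "(\<Sum>d=1..M. if d dvd m then r d * t ^ m else 0) = (\<Sum>d | d \<in> {1..M} \<and> d dvd m. r d * t ^ m)"
        by (rule sum.inter_filter[symmetric]) simp
      also have "{d. d \<in> {1..M} \<and> d dvd m} = {d. d dvd m}"
        using m by (auto dest: dvd_imp_le intro: Suc_leI)
      finally show "c m * t ^ m = (\<Sum>d=1..M. if d dvd m then r d * t ^ m else 0)"
        by (simp add: c_def sum_distrib_right)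
    qed
    also have "\<dots> = (\<Sum>d=1..M. \<Sum>m=1..M. if d dvd m then r d * t ^ m else 0)"
      by (rule sum.swap)
    \<comment> \<open>For each \<open>d\<close> the multiples of \<open>d\<close> up to
      \<open>M\<close> give a truncated geometric series; the subtracted term is its missing
      tail.\<close>
    also have "\<dots> = (\<Sum>d=1..M. r d * (t ^ d / (1 - t ^ d)) - r d * (t ^ (d * Suc (M div d)) / (1 - t ^ d)))"
    proof (rule sum.cong[OF refl])
      fix d assume d: "d \<in> {1..M}"
      have "(\<Sum>m=1..M. if d dvd m then r d * t ^ m else 0) = (\<Sum>m | m \<in> {1..M} \<and> d dvd m. r d * t ^ m)"
        by (rule sum.inter_filter[symmetric]) simp
      also have "{m. m \<in> {1..M} \<and> d dvd m} = (*) d ` {1..M div d}"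
      proof (intro equalityI subsetI)
        fix m assume "m \<in> {m. m \<in> {1..M} \<and> d dvd m}"
        then obtain k where "m = d * k" "1 \<le> d * k" "d * k \<le> M" by auto
        then show "m \<in> (*) d ` {1..M div d}"
          using d by (intro image_eqI[of _ _ k]) (auto simp: less_eq_div_iff_mult_less_eq mult.commute Suc_le_eq)
      next
        fix m assume "m \<in> (*) d ` {1..M div d}"
        then show "m \<in> {m. m \<in> {1..M} \<and> d dvd m}"
          using d by (auto simp: less_eq_div_iff_mult_less_eq mult.commute Suc_le_eq)
      qed
      also have "(\<Sum>m\<in>(*) d ` {1..M div d}. r d * t ^ m) = (\<Sum>k=1..M div d. r d * t ^ (d * k))"
        by (subst sum.reindex) (use d in \<open>auto simp: inj_on_def\<close>)
      also have "\<dots> = r d * (\<Sum>k=1..M div d. (t ^ d) ^ k)"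
        by (simp add: sum_distrib_left power_mult)
      also have "(\<Sum>k=1..M div d. (t ^ d) ^ k) = (t ^ d - t ^ (d * Suc (M div d))) / (1 - t ^ d)"
        using sum_gp[of "t ^ d" 1 "M div d"] tk[of d] d by (auto simp: power_mult power_add)
      finally show "(\<Sum>m=1..M. if d dvd m then r d * t ^ m else 0) = r d * (t ^ d / (1 - t ^ d)) - r d * (t ^ (d * Suc (M div d)) / (1 - t ^ d))"
        by (simp add: diff_divide_distrib algebra_simps)
    qed
    also have "\<dots> = (\<Sum>d=1..M. r d * (t ^ d / (1 - t ^ d))) - (\<Sum>d=1..M. r d * (t ^ (d * Suc (M div d)) / (1 - t ^ d)))"
      by (rule sum_subtractf)
    finally have eq: "(\<Sum>m=1..M. c m * t ^ m) = (\<Sum>d=1..M. r d * (t ^ d / (1 - t ^ d))) - (\<Sum>d=1..M. r d * (t ^ (d * Suc (M div d)) / (1 - t ^ d)))" .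
    have err: "\<bar>\<Sum>d=1..M. r d * (t ^ (d * Suc (M div d)) / (1 - t ^ d))\<bar> \<le> (\<Sum>d=1..M. t ^ M / (1 - t))"
    proof (rule sum_norm_le[where 'a = real, unfolded real_norm_def])
      fix d assume d: "d \<in> {1..M}"
      have "M < d * Suc (M div d)" using d dividend_less_times_div[of d M] by simp
      then have 1: "t ^ (d * Suc (M div d)) \<le> t ^ M" using t by (intro power_decreasing) auto
      have 2: "t ^ d \<le> t ^ 1" using t d by (intro power_decreasing) auto
      have "\<bar>r d\<bar> \<le> 1" using vals[of d] by auto
      then have "\<bar>r d * (t ^ (d * Suc (M div d)) / (1 - t ^ d))\<bar> \<le> 1 * (t ^ (d * Suc (M div d)) / (1 - t ^ d))"
        using tk[of d] d t unfolding abs_mult by (intro mult_mono) auto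
      also have "\<dots> \<le> t ^ M / (1 - t)"
        unfolding mult_1 by (rule frac_le) (use 1 2 t in auto)
      finally show "\<bar>r d * (t ^ (d * Suc (M div d)) / (1 - t ^ d))\<bar> \<le> t ^ M / (1 - t)" .
    qed
    \<comment> \<open>The Lambert weight is compared with 1 / (d (1 - t)), its leading term as t
      tends to 1, where d = m + 1. That part sums to \<open>T M / (1 - t)\<close>, which is small
      because L(1, r) = 0; the difference \<open>b\<close> decreases from \<open>b 0 = 1\<close>, so
      it contributes at most \<open>A\<close>.\<close>
    define b where "b m = 1 / (real (Suc m) * (1 - t)) - t ^ Suc m / (1 - t ^ Suc m)" for m
    define G where "G m = (\<Sum>i<m. t ^ i)" for m
    have G: "1 - t ^ m = (1 - t) * G m" for m
      unfolding G_def by (rule one_diff_power_eq)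
    define x where "x = sqrt t"
    have x: "0 < x" "x < 1" "x\<^sup>2 = t" using t by (auto simp: x_def)
    have G1: "real (Suc m) * x ^ m \<le> G (Suc m)" for m
      unfolding G_def using geometric_sum_ge[of x "Suc m"] x by simp
    have Gpos: "0 < G (Suc m)" for m
      using order_less_le_trans[OF _ G1[of m]] x by simp
    have b0: "0 \<le> b m" for m
    proof -
      have "real (Suc m) * t ^ Suc m \<le> real (Suc m) * x ^ m"
        using x by (intro mult_left_mono) (auto simp: x(3)[symmetric] power_decreasing simp flip: power_mult power_Suc)
      then have "real (Suc m) * t ^ Suc m \<le> G (Suc m)" using G1[of m] by linarith
      then have "t ^ Suc m / G (Suc m) \<le> 1 / real (Suc m)"
        using Gpos[of m] by (simp add: field_simps)
      then have "t ^ Suc m / G (Suc m) / (1 - t) \<le> 1 / real (Suc m) / (1 - t)"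
        using t by (intro divide_right_mono) auto
      then show ?thesis unfolding b_def G by (simp add: mult.commute)
    qed
    have bdec: "decseq b"
    proof (rule decseq_SucI)
      fix m
      \<comment> \<open>\<open>b\<close> decreases as soon as G(m+1) G(m+2) is at least (m+1)(m+2)
        t^(m+1). The bounds from \<open>G1\<close> have a factor \<open>x\<close> to spare, and
        giving it away turns the power of \<open>x\<close> into a power of \<open>t\<close>.\<close>
      have "(real (Suc m) * x ^ Suc m) * (real (Suc (Suc m)) * x ^ Suc m) \<le> G (Suc m) * G (Suc (Suc m))"
      proof (rule mult_mono)
        have "real (Suc m) * x ^ Suc m \<le> real (Suc m) * x ^ m"
          using x by (intro mult_left_mono power_decreasing) auto
        then show "real (Suc m) * x ^ Suc m \<le> G (Suc m)" using G1[of m] by linarith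
        show "real (Suc (Suc m)) * x ^ Suc m \<le> G (Suc (Suc m))" by (rule G1)
      qed (use x Gpos[of m] in auto)
      also have "(real (Suc m) * x ^ Suc m) * (real (Suc (Suc m)) * x ^ Suc m) = real (Suc m) * real (Suc (Suc m)) * t ^ Suc m"
        unfolding x(3)[symmetric] by (simp add: power2_eq_square power_mult_distrib mult_ac)
      finally have "t ^ Suc m / (G (Suc m) * G (Suc (Suc m))) \<le> 1 / (real (Suc m) * real (Suc (Suc m)))"
        using Gpos[of m] Gpos[of "Suc m"] by (simp add: divide_le_eq le_divide_eq pos_divide_le_eq mult_ac del: power_Suc of_nat_Suc)
      then have le: "t ^ Suc m / (G (Suc m) * G (Suc (Suc m))) / (1 - t) \<le> 1 / (real (Suc m) * real (Suc (Suc m))) / (1 - t)"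
        using t by (intro divide_right_mono) auto
      define u where "u = 1 - t ^ Suc m"
      define w where "w = 1 - t ^ Suc (Suc m)"
      have uw: "u > 0" "w > 0" using tk[of "Suc m"] tk[of "Suc (Suc m)"] by (auto simp: u_def w_def)
      have "t ^ Suc m / u - t ^ Suc (Suc m) / w = (t ^ Suc m * w - t ^ Suc (Suc m) * u) / (u * w)"
        using uw by (simp add: diff_frac_eq)
      also have "t ^ Suc m * w - t ^ Suc (Suc m) * u = t ^ Suc m * (1 - t)"
        by (simp add: u_def w_def algebra_simps)
      also have "u * w = (1 - t) * ((1 - t) * (G (Suc m) * G (Suc (Suc m))))"
        unfolding u_def w_def G by (simp add: mult_ac)
      also have "t ^ Suc m * (1 - t) / \<dots> = t ^ Suc m / (G (Suc m) * G (Suc (Suc m))) / (1 - t)"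
        using t by (simp add: mult_ac)
      finally have 1: "t ^ Suc m / u - t ^ Suc (Suc m) / w = t ^ Suc m / (G (Suc m) * G (Suc (Suc m))) / (1 - t)" .
      have "1 / real (Suc m) - 1 / real (Suc (Suc m)) = 1 / (real (Suc m) * real (Suc (Suc m)))"
        by (simp add: field_simps)
      then have 2: "1 / (real (Suc m) * (1 - t)) - 1 / (real (Suc (Suc m)) * (1 - t)) = 1 / (real (Suc m) * real (Suc (Suc m))) / (1 - t)"
        by (metis diff_divide_distrib divide_divide_eq_left)
      show "b (Suc m) \<le> b m" unfolding b_def u_def[symmetric] w_def[symmetric] using le 1 2 by linarith
    qed
    have "norm (\<Sum>m<M. r (m + 1) * of_real (b m)) \<le> A * b 0"
      by (rule norm_sum_mult_decseq_le[OF A bdec b0])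
    also have "b 0 = 1" using t unfolding b_def by (simp add: diff_divide_distrib[symmetric])
    finally have rb: "\<bar>\<Sum>m<M. r (Suc m) * b m\<bar> \<le> A" by simp
    have "(\<Sum>d=1..M. r d * (t ^ d / (1 - t ^ d))) = (\<Sum>m<M. r (Suc m) * (t ^ Suc m / (1 - t ^ Suc m)))"
      by (simp add: sum.shift_bounds_cl_Suc_ivl sum.atLeast1_atMost_eq del: power_Suc)
    also have "\<dots> = (\<Sum>m<M. (r (Suc m) / of_nat (Suc m)) / (1 - t) - r (Suc m) * b m)"
      by (rule sum.cong) (simp_all add: b_def right_diff_distrib del: power_Suc of_nat_Suc)
    also have "\<dots> = T M / (1 - t) - (\<Sum>m<M. r (Suc m) * b m)"
      unfolding T_def sum_subtractf sum_divide_distrib ..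
    also have "\<dots> \<le> 2 * A / of_nat (Suc M) / (1 - t) + A"
    proof -
      have "T M / (1 - t) \<le> 2 * A / of_nat (Suc M) / (1 - t)"
        using T[of M] t by (intro divide_right_mono) auto
      then show ?thesis using rb by linarith
    qed
    finally show ?thesis using err unfolding eq by (simp add: field_simps)
  qed
  have lower: "(\<Sum>j=1..J. t ^ (j\<^sup>2)) \<le> (\<Sum>m=1..M. c m * t ^ m)" if t: "0 < t" and "J\<^sup>2 \<le> M" for t J M
  proof -
    have "(\<Sum>j=1..J. t ^ (j\<^sup>2)) \<le> (\<Sum>j=1..J. c (j\<^sup>2) * t ^ (j\<^sup>2))"
      using c(2) t by (intro sum_mono) auto
    also have "\<dots> = (\<Sum>m\<in>power2 ` {1..J}. c m * t ^ m)"
      by (subst sum.reindex) (auto simp: inj_on_def)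
    also have "\<dots> \<le> (\<Sum>m=1..M. c m * t ^ m)"
    proof (rule sum_mono2)
      show "power2 ` {1..J} \<subseteq> {1..M}"
      proof clarify
        fix j assume "j \<in> {1..J}"
        then have "1 \<le> j\<^sup>2" "j\<^sup>2 \<le> J\<^sup>2" by (auto intro: power_mono)
        then show "j\<^sup>2 \<in> {1..M}" using that(2) unfolding atLeastAtMost_iff by linarith
      qed
    qed (use c(1) t in auto)
    finally show ?thesis .
  qed
  have bound: "(\<Sum>j=1..J. t ^ (j\<^sup>2)) \<le> A" if t: "0 < t" "t < 1" for t J
  proof -
    have "(\<lambda>M. A + 2 * A / (1 - t) / of_nat (Suc M) + of_nat M * t ^ M / (1 - t)) \<longlonglongrightarrow> A + 0 + 0 / (1 - t)"
      using t by (intro tendsto_intros LIMSEQ_Suc[OF lim_const_over_n] powser_times_n_limit_0) auto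
    then have lim: "(\<lambda>M. A + 2 * A / (1 - t) / of_nat (Suc M) + of_nat M * t ^ M / (1 - t)) \<longlonglongrightarrow> A" by simp
    have "(\<Sum>j=1..J. t ^ (j\<^sup>2)) \<le> A + 2 * A / (1 - t) / of_nat (Suc M) + of_nat M * t ^ M / (1 - t)" if "J\<^sup>2 \<le> M" for M
      using lower[OF t(1) that] upper[OF t, of M] by linarith
    then show ?thesis using LIMSEQ_le_const[OF lim] by blast
  qed
  \<comment> \<open>More than \<open>A\<close> terms of the theta series, each tending to 1 as
    \<open>t\<close> tends to 1.\<close>
  define J where "J = nat \<lceil>A\<rceil> + 1"
  have "((\<lambda>t::real. \<Sum>j=1..J. t ^ (j\<^sup>2)) \<longlongrightarrow> (\<Sum>j=1..J. 1 ^ (j\<^sup>2))) (at_left 1)"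
    by (intro tendsto_intros)
  moreover have "eventually (\<lambda>t. (\<Sum>j=1..J. t ^ (j\<^sup>2)) \<le> A) (at_left (1::real))"
    by (rule eventually_at_leftI[of 0]) (use bound in auto)
  ultimately have "(\<Sum>j=1..J. 1 ^ (j\<^sup>2)) \<le> A"
    by (intro tendsto_upperbound[of _ _ "at_left 1"]) auto
  then have "real J \<le> A" by simp
  then show False unfolding J_def by linarith
qed

section \<open>Dilations of periodic functions\<close>

text \<open>Mean zero and the vanishing of L(1) are imposed on all dilates at once, so that the set
  is a vector space stable under dilations and eigenvectors can be sought inside it.\<close>

definition null_dilations :: "nat \<Rightarrow> (nat \<Rightarrow> complex) set" where
  "null_dilations n = {g. (\<forall>m. g (m + n) = g m) \<and> (\<forall>k. (\<Sum>m<n. g (k * m)) = 0) \<and>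
     (\<forall>k. (\<lambda>m. g (k * m) / of_nat m) sums 0)}"

lemma null_dilations_lincomb:
  assumes "g \<in> null_dilations n" "h \<in> null_dilations n"
  shows "(\<lambda>x. a * g x + b * h x) \<in> null_dilations n"
proof -
  have "(\<lambda>m. (a * g (k * m) + b * h (k * m)) / of_nat m) sums (a * 0 + b * 0)" for k
    unfolding add_divide_distrib times_divide_eq_right[symmetric]
    using assms by (intro sums_add sums_mult) (auto simp: null_dilations_def)
  then show ?thesis using assms
    by (auto simp: null_dilations_def sum.distrib sum_distrib_left[symmetric])
qed

lemma null_dilations_dilate:
  assumes "g \<in> null_dilations n"
  shows "(\<lambda>x. g (j * x)) \<in> null_dilations n"
proof -
  have "g (j * (m + n)) = g (j * m)" for m
    using periodic_mult[of g n "j * m" j] assms by (simp add: null_dilations_def algebra_simps)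
  then show ?thesis using assms by (simp add: null_dilations_def flip: mult.assoc)
qed

text \<open>The polynomial \<open>p\<close> in the dilation operator \<open>g \<mapsto> (\<lambda>x. g (j * x))\<close>, applied to \<open>g\<close>.\<close>

definition dilate_poly :: "nat \<Rightarrow> complex poly \<Rightarrow> (nat \<Rightarrow> complex) \<Rightarrow> nat \<Rightarrow> complex" where
  "dilate_poly j p g = (\<lambda>x. \<Sum>i\<le>degree p. coeff p i * g (j ^ i * x))"

lemma dilate_poly_0: "dilate_poly j 0 g = (\<lambda>_. 0)"
  by (simp add: dilate_poly_def)

lemma dilate_poly_pCons: "dilate_poly j (pCons a p) g = (\<lambda>x. a * g x + dilate_poly j p g (j * x))"
  by (cases "p = 0") (auto simp: dilate_poly_def degree_pCons_eq sum.atMost_Suc_shift mult_ac simp del: sum.atMost_Suc)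

lemma dilate_poly_add: "dilate_poly j (p + q) g x = dilate_poly j p g x + dilate_poly j q g x"
  by (induction p q arbitrary: x rule: poly_induct2) (simp_all add: dilate_poly_0 dilate_poly_pCons algebra_simps)

lemma dilate_poly_smult: "dilate_poly j (smult a p) g x = a * dilate_poly j p g x"
  by (induction p arbitrary: x rule: pCons_induct) (simp_all add: dilate_poly_0 dilate_poly_pCons algebra_simps)

lemma dilate_poly_monom: "dilate_poly j (monom a i) g x = a * g (j ^ i * x)"
  by (induction i arbitrary: x) (simp_all add: monom_0 monom_Suc dilate_poly_0 dilate_poly_pCons mult_ac)

lemma dilate_poly_linear_factor:
  "dilate_poly j ([:- a, 1:] * q) g x = dilate_poly j q g (j * x) - a * dilate_poly j q g x"
proof -
  have "[:- a, 1:] * q = smult (- a) q + pCons 0 q" by (simp add: mult_pCons_left)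
  then show ?thesis by (simp only: dilate_poly_add dilate_poly_smult dilate_poly_pCons) simp
qed

lemma dilate_poly_null_dilations:
  assumes "g \<in> null_dilations n"
  shows "dilate_poly j p g \<in> null_dilations n"
proof (induction p rule: pCons_induct)
  case 0
  then show ?case using null_dilations_lincomb[OF assms assms, of 0 0] by (simp add: dilate_poly_0)
next
  case (pCons a p)
  then show ?case
    using null_dilations_lincomb[OF assms null_dilations_dilate[OF pCons.IH, of j], of a 1]
    by (simp add: dilate_poly_pCons)
qed

text \<open>Dilations commute, so a polynomial in one of them keeps the eigenvalues already obtained
  for others.\<close>

lemma dilate_poly_eigen:
  assumes "\<And>x. g (i * x) = \<mu> * g x"
  shows "dilate_poly j p g (i * x) = \<mu> * dilate_poly j p g x"
proof (induction p arbitrary: x rule: pCons_induct)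
  case (pCons a p)
  have "j * (i * x) = i * (j * x)" by simp
  then show ?case using assms pCons.IH[of "j * x"] by (simp only: dilate_poly_pCons) (simp add: algebra_simps)
qed (simp add: dilate_poly_0)

text \<open>Complex linear factors are split off an annihilating polynomial until the remaining
  factor no longer kills \<open>g\<close>. What that factor makes of \<open>g\<close> is nonzero and
  is killed by the dilation minus the last root \<open>a\<close>.\<close>

lemma dilate_poly_eigenvector_exists:
  assumes "p \<noteq> 0" "dilate_poly j p g = (\<lambda>_. 0)" "g \<noteq> (\<lambda>_. 0)"
  shows "\<exists>q \<mu>. dilate_poly j q g \<noteq> (\<lambda>_. 0) \<and> (\<forall>x. dilate_poly j q g (j * x) = \<mu> * dilate_poly j q g x)"
  using assms(1,2)
proof (induction "degree p" arbitrary: p rule: less_induct)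
  case less
  show ?case
  proof (cases "degree p = 0")
    case True
    then obtain a where "p = [:a:]" using degree_eq_zeroE by blast
    then have "a * g x = 0" "a \<noteq> 0" for x using less.prems by (auto simp: dilate_poly_pCons dilate_poly_0 fun_eq_iff)
    then show ?thesis using assms(3) by auto
  next
    case False
    then obtain a where "poly p a = 0"
      using fundamental_theorem_of_algebra constant_degree by metis
    then obtain q where q: "p = [:- a, 1:] * q" using poly_eq_0_iff_dvd dvdE by metis
    then have "q \<noteq> 0" using less.prems by auto
    then have deg: "degree q < degree p" unfolding q by (subst degree_mult_eq) auto
    have eig: "dilate_poly j q g (j * x) = a * dilate_poly j q g x" for x
      using dilate_poly_linear_factor[of j a q g x] less.prems(2) unfolding q[symmetric] by simp
    show ?thesis
      using less.hyps[OF deg \<open>q \<noteq> 0\<close>] eig by blast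
  qed
qed

section \<open>Common eigenvectors and multiplicativity\<close>

lemma power_mod_eventually_periodic:
  assumes "n > (0::nat)"
  obtains a b where "a < b" "j ^ a mod n = j ^ b mod n"
proof -
  have "\<not> inj (\<lambda>i. j ^ i mod n)"
  proof
    assume "inj (\<lambda>i. j ^ i mod n)"
    then have "infinite (range (\<lambda>i. j ^ i mod n))" by (simp add: range_inj_infinite)
    moreover have "range (\<lambda>i. j ^ i mod n) \<subseteq> {..<n}" using assms by auto
    ultimately show False using finite_subset by blast
  qed
  then obtain a b where "a \<noteq> b" "j ^ a mod n = j ^ b mod n" by (auto simp: inj_def)
  then show ?thesis using that by (metis linorder_neqE_nat)
qed

text \<open>Since the powers of \<open>J\<close> repeat modulo \<open>n\<close>, the polynomial X^b
  - X^a annihilates every \<open>n\<close>-periodic function under dilation by \<open>J\<close>. The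
  exponent \<open>a\<close> cannot be taken to be 0 in general, as \<open>J\<close> may share a
  factor with \<open>n\<close>.\<close>

lemma common_dilation_eigenvector_exists:
  assumes n: "n > 0" and "g \<in> null_dilations n" "g \<noteq> (\<lambda>_. 0)"
  shows "\<exists>h \<in> null_dilations n. h \<noteq> (\<lambda>_. 0) \<and> (\<forall>j<J. \<exists>\<mu>. \<forall>x. h (j * x) = \<mu> * h x)"
proof (induction J)
  case 0
  then show ?case using assms by blast
next
  case (Suc J)
  then obtain h where h: "h \<in> null_dilations n" "h \<noteq> (\<lambda>_. 0)" "\<forall>j<J. \<exists>\<mu>. \<forall>x. h (j * x) = \<mu> * h x" by blast
  obtain a b where ab: "a < b" "J ^ a mod n = J ^ b mod n" using power_mod_eventually_periodic[OF n] by blast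
  define p where "p = monom 1 b + monom (- 1 :: complex) a"
  have "coeff p b = 1" using ab by (simp add: p_def)
  then have "p \<noteq> 0" by auto
  moreover have "h (J ^ a * x) = h (J ^ b * x)" for x
    by (rule periodic_cong[of h n]) (use h(1) ab(2) in \<open>auto simp: null_dilations_def intro: mod_mult_cong\<close>)
  then have "dilate_poly J p h = (\<lambda>_. 0)"
    unfolding p_def by (intro ext) (simp only: dilate_poly_add dilate_poly_monom, simp)
  ultimately obtain q \<mu> where q: "dilate_poly J q h \<noteq> (\<lambda>_. 0)" "\<forall>x. dilate_poly J q h (J * x) = \<mu> * dilate_poly J q h x"
    using dilate_poly_eigenvector_exists[OF _ _ h(2)] by blast
  have "\<exists>\<mu>. \<forall>x. dilate_poly J q h (j * x) = \<mu> * dilate_poly J q h x" if "j < Suc J" for j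
    using that q(2) h(3) dilate_poly_eigen[of h j] by (metis less_SucE)
  then show ?case using q(1) dilate_poly_null_dilations[OF h(1)] by blast
qed

text \<open>Evaluated at 1, the eigenvalue equation shows that dilation by \<open>j\<close> has
  eigenvalue \<open>h j / h 1\<close>; hence \<open>h / h 1\<close> is multiplicative. Eigenvalues
  for \<open>j < n\<close> suffice by periodicity.\<close>

lemma multiplicative_null_dilation_exists:
  assumes n: "n > 0" and "g \<in> null_dilations n" "g \<noteq> (\<lambda>_. 0)"
  obtains \<psi> where "\<psi> \<in> null_dilations n" "\<psi> 1 = 1" "\<And>a b. \<psi> (a * b) = \<psi> a * \<psi> b"
proof -
  obtain h where h: "h \<in> null_dilations n" "h \<noteq> (\<lambda>_. 0)" and ev: "\<forall>j<n. \<exists>\<mu>. \<forall>x. h (j * x) = \<mu> * h x"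
    using common_dilation_eigenvector_exists[OF assms, of n] by blast
  have ev': "\<exists>\<mu>. \<forall>x. h (j * x) = \<mu> * h x" for j
  proof -
    obtain \<mu> where "\<And>x. h (j mod n * x) = \<mu> * h x" using ev n by (meson mod_less_divisor)
    moreover have "h (j * x) = h (j mod n * x)" for x
      by (rule periodic_cong[of h n]) (use h(1) in \<open>auto simp: null_dilations_def mod_mult_left_eq\<close>)
    ultimately show ?thesis by metis
  qed
  have "h 1 \<noteq> 0"
  proof
    assume "h 1 = 0"
    then have "h x = 0" for x using ev'[of x] by (metis mult.right_neutral mult_zero_right)
    then show False using h(2) by auto
  qed
  have mul: "h (a * b) * h 1 = h a * h b" for a b
    using ev'[of a] by (metis mult.right_neutral mult.assoc mult.commute)
  show ?thesis
  proof (rule that)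
    show "(\<lambda>x. (1 / h 1) * h x + 0 * h x) \<in> null_dilations n"
      by (rule null_dilations_lincomb[OF h(1) h(1)])
    show "(1 / h 1) * h 1 + 0 * h 1 = 1" using \<open>h 1 \<noteq> 0\<close> by simp
    show "(1 / h 1) * h (a * b) + 0 * h (a * b) = ((1 / h 1) * h a + 0 * h a) * ((1 / h 1) * h b + 0 * h b)" for a b
      using mul[of a b] \<open>h 1 \<noteq> 0\<close> by (simp add: field_simps)
  qed
qed

lemma no_multiplicative_null_dilation:
  fixes \<psi> :: "nat \<Rightarrow> complex"
  assumes one: "\<psi> 1 = 1" and mult: "\<And>a b. \<psi> (a * b) = \<psi> a * \<psi> b"
    and per0: "\<And>m. \<psi> (m + n0) = \<psi> m" and n0: "n0 > 0" and mean0: "(\<Sum>m<n0. \<psi> m) = 0"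
  shows "\<not> (\<lambda>m. \<psi> m / of_nat m) sums 0"
proof
  assume L: "(\<lambda>m. \<psi> m / of_nat m) sums 0"
  \<comment> \<open>Minimality is demanded among positive periods with vanishing sum, so that both
    properties are available for the chosen \<open>n\<close> and for the smaller candidate
    below.\<close>
  define Q where "Q n \<longleftrightarrow> n > 0 \<and> (\<forall>m. \<psi> (m + n) = \<psi> m) \<and> (\<Sum>m<n. \<psi> m) = 0" for n
  define n where "n = (LEAST n. Q n)"
  have "Q n0" using n0 per0 mean0 by (simp add: Q_def)
  then have "Q n" unfolding n_def by (rule LeastI)
  then have n: "n > 0" and per: "\<And>m. \<psi> (m + n) = \<psi> m" and mean: "(\<Sum>m<n. \<psi> m) = 0" by (auto simp: Q_def)
  have pow: "\<psi> (m ^ i) = \<psi> m ^ i" for m i using one mult by (induction i) auto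
  have le: "norm (\<psi> m) \<le> 1" for m
  proof (rule ccontr)
    \<comment> \<open>A value outside the unit disc would have unbounded powers, which are again
      values of the bounded function \<open>\<psi>\<close>.\<close>
    define B where "B = Max ((\<lambda>m. norm (\<psi> m)) ` {..<n})"
    have B: "norm (\<psi> m) \<le> B" for m
      unfolding B_def periodic_mod[of \<psi> n m, OF per, symmetric] using n by (intro Max_ge) auto
    assume "\<not> norm (\<psi> m) \<le> 1"
    then obtain i where "B < norm (\<psi> m) ^ i" using real_arch_pow[of "norm (\<psi> m)" B] by auto
    then show False using B[of "m ^ i"] by (simp add: pow norm_power)
  qed
  have zero: "\<psi> p = 0" if p: "prime p" "p dvd n" for p
  proof (rule ccontr)
    assume nz: "\<psi> p \<noteq> 0"
    \<comment> \<open>Cancelling \<open>\<psi> p\<close> shows that \<open>k = n / p\<close> is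
      already a period. The sum over \<open>n\<close> is \<open>p\<close> times the sum over
      \<open>k\<close>, so that vanishes too, against minimality.\<close>
    obtain k where k: "n = p * k" using p(2) by blast
    have per': "\<psi> (m + k) = \<psi> m" for m
    proof -
      have "\<psi> p * \<psi> (m + k) = \<psi> p * \<psi> m"
        using per[of "p * m"] by (simp add: k algebra_simps flip: mult)
      then show ?thesis using nz by simp
    qed
    have "(\<Sum>m<i * k. \<psi> m) = of_nat i * (\<Sum>m<k. \<psi> m)" for i
    proof (induction i)
      case (Suc i)
      have "(\<Sum>m<Suc i * k. \<psi> m) = (\<Sum>m<i * k. \<psi> m) + (\<Sum>m<k. \<psi> (m + i * k))"
        by (simp add: sum.nat_group[symmetric] algebra_simps sum_up_index_split lessThan_atLeast0
             sum.atLeastLessThan_concat[of 0 "i * k" "k + i * k", symmetric] sum.shift_bounds_nat_ivl[of _ 0 "i * k" k, simplified])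
      then show ?case using Suc periodic_sum_block[of \<psi> k "i * k", OF per'] by (simp add: algebra_simps)
    qed simp
    from this[of p] have "(\<Sum>m<k. \<psi> m) = 0" using mean p prime_gt_0_nat[of p] by (simp add: k)
    then have "Q k" using per' n by (auto simp: Q_def k)
    then have "n \<le> k" unfolding n_def by (rule Least_le)
    then show False using k n prime_gt_1_nat[OF p(1)] by simp
  qed
  show False
  proof (cases "(\<Sum>m<n. (\<psi> m)\<^sup>2) = 0")
    case True
    then show False using L_one_nonzero_if_square_nonprincipal[OF one mult le per n mean] L by blast
  next
    case False
    \<comment> \<open>Multiplication by a unit permutes the residues, so
      \<open>(\<psi> u)\<^sup>2\<close> fixes the nonzero sum of squares. Hence
      \<open>\<psi>\<close> is real on units, and it vanishes elsewhere by
      \<open>zero\<close>.\<close>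
    have unit: "(\<psi> u)\<^sup>2 = 1" if u: "coprime u n" for u
    proof -
      have inj: "inj_on (\<lambda>m. u * m mod n) {..<n}"
      proof (rule inj_onI)
        fix x y assume *: "x \<in> {..<n}" "y \<in> {..<n}" "u * x mod n = u * y mod n"
        then have "[u * x = u * y] (mod n)" by (simp add: cong_def)
        then have "[x = y] (mod n)" using u cong_mult_lcancel_nat by blast
        then show "x = y" using * by (simp add: cong_def)
      qed
      moreover have "(\<lambda>m. u * m mod n) ` {..<n} = {..<n}"
        by (rule endo_inj_surj[OF _ _ inj]) (use n in auto)
      ultimately have "bij_betw (\<lambda>m. u * m mod n) {..<n} {..<n}" by (simp add: bij_betw_def)
      from sum.reindex_bij_betw[OF this, of "\<lambda>m. (\<psi> m)\<^sup>2"]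
      have "(\<Sum>m<n. (\<psi> (u * m mod n))\<^sup>2) = (\<Sum>m<n. (\<psi> m)\<^sup>2)" by simp
      then have "(\<psi> u)\<^sup>2 * (\<Sum>m<n. (\<psi> m)\<^sup>2) = (\<Sum>m<n. (\<psi> m)\<^sup>2)"
        using periodic_mod[of \<psi> n, OF per] by (simp add: mult power_mult_distrib sum_distrib_left)
      then show ?thesis using False by simp
    qed
    have vals: "\<psi> m \<in> {-1, 0, 1}" for m
    proof (cases "coprime m n")
      case True
      then show ?thesis using unit[of m] by (auto simp: power2_eq_1_iff)
    next
      case False
      then obtain p where p: "prime p" "p dvd gcd m n"
        using prime_factor_nat[of "gcd m n"] by (auto simp: coprime_iff_gcd_eq_1)
      then obtain k where "m = p * k" by auto
      then show ?thesis using zero[of p] p by (simp add: mult)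
    qed
    define r where "r m = Re (\<psi> m)" for m
    have r: "\<psi> m = of_real (r m)" "r m \<in> {-1, 0, 1}" for m using vals[of m] by (auto simp: r_def)
    have "r (a * b) = r a * r b" for a b
      using mult[of a b] unfolding r(1) by (simp flip: of_real_mult)
    moreover have "r 1 = 1" "\<And>m. r (m + n) = r m"
      using one per by (simp_all add: r_def)
    moreover have "(\<Sum>m<n. r m) = 0" using mean by (simp add: r_def flip: Re_sum)
    ultimately have "\<not> (\<lambda>m. r m / of_nat m) sums 0"
      using r(2) n by (intro L_one_nonzero_real)
    moreover have "(\<lambda>m. r m / of_nat m) sums 0"
      using sums_Re[OF L] by (simp add: r(1))
    ultimately show False by blast
  qed
qed

theorem null_dilations_eq_zero:
  assumes "n > 0" "g \<in> null_dilations n"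
  shows "g = (\<lambda>_. 0)"
proof (rule ccontr)
  assume "g \<noteq> (\<lambda>_. 0)"
  then obtain \<psi> where \<psi>: "\<psi> \<in> null_dilations n" "\<psi> 1 = 1" "\<And>a b. \<psi> (a * b) = \<psi> a * \<psi> b"
    using multiplicative_null_dilation_exists assms by blast
  have "(\<Sum>m<n. \<psi> (1 * m)) = 0" "(\<lambda>m. \<psi> (1 * m) / of_nat m) sums 0"
    using \<psi>(1) unfolding null_dilations_def by blast+
  then show False
    using no_multiplicative_null_dilation[of \<psi> n] \<psi> assms(1) by (simp add: null_dilations_def)
qed

section \<open>Balanced residues\<close>

lemma Ln_one_minus_cis:
  assumes "0 < \<theta>" "\<theta> < 2 * pi"
  shows "Im (Ln (1 - cis \<theta>)) = (\<theta> - pi) / 2" and "1 - cis \<theta> \<notin> \<real>\<^sub>\<le>\<^sub>0"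
proof -
  define s where "s = sin (\<theta> / 2)"
  have s: "s > 0" unfolding s_def using assms by (intro sin_gt_zero) auto
  have a: "(\<theta> - pi) / 2 = \<theta> / 2 - pi / 2" by (simp add: field_simps)
  \<comment> \<open>Polar form: 1 - cis x = 2 sin (x/2) cis ((x - pi)/2). This angle lies strictly
    between -pi/2 and pi/2, hence belongs to the principal branch.\<close>
  have "exp (of_real (ln (2 * s)) + \<i> * of_real ((\<theta> - pi) / 2)) = of_real (2 * s) * cis ((\<theta> - pi) / 2)"
    using s by (simp only: exp_add cis_conv_exp exp_of_real) simp
  also have "\<dots> = 1 - cis \<theta>"
  proof (rule complex_eqI)
    have c: "cos \<theta> = 1 - 2 * s\<^sup>2" "sin \<theta> = 2 * s * cos (\<theta> / 2)"
      using cos_double_sin[of "\<theta> / 2"] sin_double[of "\<theta> / 2"] by (simp_all add: s_def)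
    show "Re (of_real (2 * s) * cis ((\<theta> - pi) / 2)) = Re (1 - cis \<theta>)"
      unfolding a by (simp add: c cos_diff power2_eq_square) (simp add: s_def)
    show "Im (of_real (2 * s) * cis ((\<theta> - pi) / 2)) = Im (1 - cis \<theta>)"
      unfolding a by (simp add: c sin_diff)
  qed
  finally have e: "exp (of_real (ln (2 * s)) + \<i> * of_real ((\<theta> - pi) / 2)) = 1 - cis \<theta>" .
  have "Ln (1 - cis \<theta>) = of_real (ln (2 * s)) + \<i> * of_real ((\<theta> - pi) / 2)"
    by (rule Ln_unique[OF e]) (use assms in auto)
  then show "Im (Ln (1 - cis \<theta>)) = (\<theta> - pi) / 2" by simp
  have "Re (1 - cis \<theta>) > 0"
  proof -
    have "cos \<theta> = 1 - 2 * s\<^sup>2" using cos_double_sin[of "\<theta> / 2"] by (simp add: s_def)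
    then show ?thesis using s by simp
  qed
  then show "1 - cis \<theta> \<notin> \<real>\<^sub>\<le>\<^sub>0" by (auto simp: complex_nonpos_Reals_iff)
qed

text \<open>Abel's limit argument with an explicit error: the geometric sums in \<open>z\<close> are
  bounded by 2 / |1 - z|, so inside the disc the tail after \<open>N\<close> terms is O(1/N)
  uniformly in the radius. The radius tends to 1 for fixed \<open>N\<close>, and only then
  \<open>N\<close> to infinity.\<close>

lemma log_series_on_unit_circle:
  fixes z :: complex
  assumes z: "norm z = 1" and nonpos: "1 - z \<notin> \<real>\<^sub>\<le>\<^sub>0"
  shows "(\<lambda>m. z ^ Suc m / of_nat (Suc m)) sums (- Ln (1 - z))"
proof -
  have z1: "z \<noteq> 1" using nonpos by auto
  define A where "A = 2 / norm (1 - z)"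
  have A: "norm (\<Sum>m<k. z ^ Suc m) \<le> A" for k
  proof -
    have "(\<Sum>m<k. z ^ Suc m) = z * ((1 - z ^ k) / (1 - z))"
      using z1 by (simp add: sum_gp_strict flip: sum_distrib_left)
    then have "norm (\<Sum>m<k. z ^ Suc m) = norm (1 - z ^ k) / norm (1 - z)"
      using z by (simp add: norm_mult norm_divide)
    also have "\<dots> \<le> A"
      unfolding A_def using norm_triangle_ineq4[of 1 "z ^ k"] z by (intro divide_right_mono) (auto simp: norm_power)
    finally show ?thesis .
  qed
  have A0: "0 \<le> A" by (simp add: A_def)
  define S where "S N t = (\<Sum>m<N. z ^ Suc m * of_real (t ^ Suc m / real (Suc m)))" for N and t :: real
  have est: "norm (- Ln (1 - of_real t * z) - S N t) \<le> 2 * A / of_nat (Suc N)" if t: "0 < t" "t < 1" for t N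
  proof -
    have tz: "norm (of_real t * z) < 1" using t z by (simp add: norm_mult)
    have "(\<lambda>m. - ((of_real t * z) ^ m) / of_nat m) sums Ln (1 - of_real t * z)"
      using Ln_series'[of "- (of_real t * z)"] tz by simp
    then have "(\<lambda>m. (of_real t * z) ^ m / of_nat m) sums (- Ln (1 - of_real t * z))"
      using sums_minus by fastforce
    then have "(\<lambda>m. (of_real t * z) ^ Suc m / of_nat (Suc m)) sums (- Ln (1 - of_real t * z))"
      by (subst sums_Suc_iff) simp
    moreover have "(of_real t * z) ^ Suc m / of_nat (Suc m) = z ^ Suc m * of_real (t ^ Suc m / real (Suc m))" for m
      unfolding power_mult_distrib by (simp del: power_Suc)
    ultimately have s: "(\<lambda>m. z ^ Suc m * of_real (t ^ Suc m / real (Suc m))) sums (- Ln (1 - of_real t * z))"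
      by (simp only:)
    have dec: "decseq (\<lambda>m. t ^ Suc m / real (Suc m))"
      by (rule decseq_SucI, rule frac_le) (use t in \<open>auto intro!: power_decreasing simp del: power_Suc\<close>)
    have "norm (- Ln (1 - of_real t * z) - S N t) \<le> 2 * A * (t ^ Suc N / real (Suc N))"
      unfolding S_def by (rule norm_suminf_tail_decseq_le[OF A dec _ s]) (use t in auto)
    also have "\<dots> \<le> 2 * A * (1 / real (Suc N))"
      using t A0 by (intro mult_left_mono divide_right_mono power_le_one) auto
    finally show ?thesis by simp
  qed
  have est1: "norm (- Ln (1 - z) - S N 1) \<le> 2 * A / of_nat (Suc N)" for N
  proof (rule tendsto_upperbound)
    have "((\<lambda>t. norm (- Ln (1 - of_real t * z) - S N t)) \<longlongrightarrow> norm (- Ln (1 - of_real 1 * z) - S N 1)) (at_left 1)"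
      unfolding S_def by (intro tendsto_intros) (use nonpos in auto)
    then show "((\<lambda>t. norm (- Ln (1 - of_real t * z) - S N t)) \<longlongrightarrow> norm (- Ln (1 - z) - S N 1)) (at_left 1)" by simp
    show "eventually (\<lambda>t. norm (- Ln (1 - of_real t * z) - S N t) \<le> 2 * A / of_nat (Suc N)) (at_left 1)"
      by (rule eventually_at_leftI[of 0]) (use est in auto)
  qed simp
  have "(\<lambda>N. - Ln (1 - z) - S N 1) \<longlonglongrightarrow> 0"
    by (rule Lim_null_comparison[OF _ LIMSEQ_Suc[OF lim_const_over_n[of "2 * A"]]]) (use est1 in auto)
  then have "(\<lambda>N. - Ln (1 - z) - (- Ln (1 - z) - S N 1)) \<longlonglongrightarrow> - Ln (1 - z) - 0"
    by (intro tendsto_diff tendsto_const)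
  then have "(\<lambda>N. S N 1) \<longlonglongrightarrow> - Ln (1 - z)" by simp
  then show ?thesis unfolding sums_def S_def by simp
qed

text \<open>Imaginary part of the series of -log (1 - z) at the unit circle; \<open>x\<close> may be
  replaced by \<open>frac x\<close> because the sines have period 1 in \<open>x\<close>.\<close>

lemma sawtooth_sums:
  assumes "x \<notin> \<int>"
  shows "(\<lambda>m. sin (2 * pi * (real m * x)) / real m) sums (pi * (1 / 2 - frac x))"
proof -
  define \<theta> where "\<theta> = 2 * pi * frac x"
  have "frac x > 0" "frac x < 1" using assms by (auto simp: frac_gt_0_iff frac_lt_1)
  then have \<theta>: "0 < \<theta>" "\<theta> < 2 * pi" by (auto simp: \<theta>_def)
  have "(\<lambda>m. cis \<theta> ^ Suc m / of_nat (Suc m)) sums (- Ln (1 - cis \<theta>))"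
    by (rule log_series_on_unit_circle[OF _ Ln_one_minus_cis(2)[OF \<theta>]]) simp
  from sums_Im[OF this] have "(\<lambda>m. Im (cis \<theta> ^ Suc m) / real (Suc m)) sums (- Im (Ln (1 - cis \<theta>)))"
    by (simp only: Im_divide_of_nat uminus_complex.sel)
  then have "(\<lambda>m. Im (cis \<theta> ^ m) / real m) sums (- Im (Ln (1 - cis \<theta>)))"
    by (subst (asm) sums_Suc_iff) simp
  also have "- Im (Ln (1 - cis \<theta>)) = pi * (1 / 2 - frac x)"
    unfolding Ln_one_minus_cis(1)[OF \<theta>] by (simp add: \<theta>_def field_simps)
  also have "(\<lambda>m. Im (cis \<theta> ^ m) / real m) = (\<lambda>m. sin (2 * pi * (real m * x)) / real m)"
  proof
    fix m :: nat
    have "2 * pi * (real m * x) = real m * \<theta> + (2 * pi) * of_int (int m * \<lfloor>x\<rfloor>)"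
      by (simp add: \<theta>_def frac_def algebra_simps)
    then have "sin (2 * pi * (real m * x)) = sin (real m * \<theta>)"
      by (simp only: sin_add cos_int_2pin sin_int_2pin)
    then show "Im (cis \<theta> ^ m) / real m = sin (2 * pi * (real m * x)) / real m"
      by (simp only: Complex.DeMoivre cis.sel)
  qed
  finally show ?thesis .
qed

lemma sum_cos_roots_of_unity:
  fixes a :: int
  assumes n: "n > 0"
  shows "(\<Sum>m<n. cos (2 * pi * (real m * (of_int a / real n)))) = (if int n dvd a then real n else 0)"
proof -
  define \<theta> where "\<theta> = 2 * pi * (of_int a / real n)"
  have e: "cos (2 * pi * (real m * (of_int a / real n))) = Re (cis \<theta> ^ m)" for m
    by (simp add: Complex.DeMoivre \<theta>_def mult_ac)
  have "real n * \<theta> = (2 * pi) * of_int a" using n by (simp add: \<theta>_def)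
  then have "cis \<theta> ^ n = 1"
    by (simp only: Complex.DeMoivre) (simp add: complex_eq_iff cos_int_2pin sin_int_2pin)
  moreover have "cis \<theta> = 1 \<longleftrightarrow> int n dvd a"
  proof
    assume "cis \<theta> = 1"
    then have "cos \<theta> = 1" by (metis cis.sel(1) one_complex.sel(1))
    then obtain k :: int where "\<theta> = of_int k * 2 * pi" using cos_one_2pi_int by auto
    then have "(2 * pi) * (of_int a / real n) = (2 * pi) * of_int k" by (simp only: \<theta>_def mult_ac)
    then have "of_int a / real n = of_int k" by (simp only: mult_cancel_left) auto
    then have "(of_int a :: real) = of_int (k * int n)" using n by (simp add: field_simps)
    then have "a = k * int n" by linarith
    then show "int n dvd a" by simp
  next
    assume "int n dvd a"
    then obtain k where "a = int n * k" by blast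
    then have "\<theta> = (2 * pi) * of_int k" using n by (simp add: \<theta>_def)
    then show "cis \<theta> = 1" by (simp only:) (simp add: complex_eq_iff cos_int_2pin sin_int_2pin)
  qed
  ultimately have "(\<Sum>m<n. cis \<theta> ^ m) = (if int n dvd a then of_nat n else 0)"
    by (auto simp: sum_gp_strict)
  then have "Re (\<Sum>m<n. cis \<theta> ^ m) = (if int n dvd a then real n else 0)" by simp
  then show ?thesis unfolding e by (simp only: Re_sum)
qed

text \<open>Once the sine sum \<open>g\<close> vanishes identically, it is correlated with sin (2 pi
  m u / n) over a period. A product of sines is a difference of cosines, and the cosine sums detect
  whether \<open>b i\<close> is congruent to \<open>u\<close> or to \<open>- u\<close>.\<close>

theorem balanced_residues:
  fixes b :: "'i \<Rightarrow> int" and n :: nat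
  assumes n: "n > 0" and fin: "finite I" and cop: "\<And>i. i \<in> I \<Longrightarrow> coprime (b i) (int n)"
    and bal: "\<And>k::nat. \<not> n dvd k \<Longrightarrow> (\<Sum>i\<in>I. frac (of_int (int k * b i) / real n)) = real (card I) / 2"
  shows "card {i \<in> I. int n dvd b i - u} = card {i \<in> I. int n dvd b i + u}"
proof -
  define s where "s i m = sin (2 * pi * (real m * (of_int (b i) / real n)))" for i m
  define g where "g m = complex_of_real (\<Sum>i\<in>I. s i m)" for m
  have per: "s i (m + n) = s i m" for i m
  proof -
    have "2 * pi * (real (m + n) * (of_int (b i) / real n)) = 2 * pi * (real m * (of_int (b i) / real n)) + (2 * pi) * of_int (b i)"
      using n by (simp add: field_simps)
    then show ?thesis unfolding s_def by (simp only: sin_add cos_int_2pin sin_int_2pin)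
  qed
  \<comment> \<open>Reflection negates \<open>s\<close>; combined with the shift by one, it makes
    the sum over a period equal to its own negative.\<close>
  have refl: "s i (k * (n - m)) = - s i (k * m)" if "m \<le> n" for i k m
  proof -
    have e: "real (k * (n - m)) = real k * (real n - real m)" using that by (simp add: of_nat_diff)
    have "2 * pi * (real (k * (n - m)) * (of_int (b i) / real n)) = - (2 * pi * (real (k * m) * (of_int (b i) / real n))) + (2 * pi) * of_int (int k * b i)"
      unfolding e using n by (simp add: field_simps)
    then show ?thesis unfolding s_def by (simp only: sin_add cos_int_2pin sin_int_2pin) simp
  qed
  have mean: "(\<Sum>m<n. s i (k * m)) = 0" for i k
  proof -
    have "s i (k * (m + n)) = s i (k * m)" for m
      using periodic_mult[of "s i" n "k * m" k] per by (simp add: algebra_simps)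
    then have "(\<Sum>m<n. s i (k * (m + 1))) = (\<Sum>m<n. s i (k * m))"
      using periodic_sum_block[of "\<lambda>m. s i (k * m)" n 1] by simp
    moreover have "(\<Sum>m<n. s i (k * m)) = (\<Sum>m<n. s i (k * (n - Suc m)))"
      using sum.nat_diff_reindex[of "\<lambda>m. s i (k * m)" n] by simp
    moreover have "\<dots> = (\<Sum>m<n. - s i (k * (m + 1)))"
      by (rule sum.cong) (use refl in auto)
    ultimately show ?thesis by (simp add: sum_negf)
  qed
  have sums: "(\<lambda>m. (\<Sum>i\<in>I. s i (k * m)) / real m) sums 0" for k
  proof (cases "n dvd k")
    case True
    then obtain q where q: "k = n * q" by blast
    have "s i (k * m) = 0" for i m
    proof -
      have "2 * pi * (real (k * m) * (of_int (b i) / real n)) = (2 * pi) * of_int (int (q * m) * b i)"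
        using n by (simp add: q)
      then show ?thesis unfolding s_def by (simp only: sin_int_2pin)
    qed
    then show ?thesis by simp
  next
    case False
    have "(\<lambda>m. s i (k * m) / real m) sums (pi * (1 / 2 - frac (of_int (int k * b i) / real n)))" if i: "i \<in> I" for i
    proof -
      \<comment> \<open>The sawtooth formula fails at integers, where the series is 0 but
        \<open>frac\<close> gives pi/2; coprimality keeps \<open>k * b i / n\<close> away from
        them.\<close>
      have "of_int (int k * b i) / real n \<notin> \<int>"
      proof
        assume "of_int (int k * b i) / real n \<in> \<int>"
        then obtain q :: int where "of_int (int k * b i) / real n = of_int q" by (auto elim: Ints_cases)
        then have "(of_int (int k * b i) :: real) = of_int (int n * q)" using n by (simp add: field_simps)
        then have "int k * b i = int n * q" by linarith
        then have "int n dvd int k * b i" by simp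
        then have "int n dvd int k" using cop[OF i] by (simp add: coprime_dvd_mult_left_iff coprime_commute)
        then show False using False by simp
      qed
      from sawtooth_sums[OF this] show ?thesis unfolding s_def by (simp add: mult_ac)
    qed
    then have "(\<lambda>m. \<Sum>i\<in>I. s i (k * m) / real m) sums (\<Sum>i\<in>I. pi * (1 / 2 - frac (of_int (int k * b i) / real n)))"
      by (intro sums_sum)
    also have "(\<Sum>i\<in>I. pi * (1 / 2 - frac (of_int (int k * b i) / real n))) = pi * (real (card I) / 2 - (\<Sum>i\<in>I. frac (of_int (int k * b i) / real n)))"
      by (simp add: sum_subtractf flip: sum_distrib_left)
    also have "\<dots> = 0" using bal[OF False] by simp
    finally show ?thesis by (simp add: sum_divide_distrib)
  qed
  have "g \<in> null_dilations n"
    unfolding null_dilations_def mem_Collect_eq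
  proof (intro conjI allI)
    show "g (m + n) = g m" for m by (simp add: g_def per)
    show "(\<Sum>m<n. g (k * m)) = 0" for k
    proof -
      have "(\<Sum>m<n. g (k * m)) = of_real (\<Sum>i\<in>I. \<Sum>m<n. s i (k * m))"
        unfolding g_def of_real_sum by (rule sum.swap)
      then show ?thesis by (simp only: mean) simp
    qed
    show "(\<lambda>m. g (k * m) / of_nat m) sums 0" for k
      using sums_of_real[OF sums[of k], where 'a = complex] by (simp add: g_def)
  qed
  then have "g = (\<lambda>_. 0)" by (rule null_dilations_eq_zero[OF n])
  then have "g m = 0" for m by simp
  then have zero: "(\<Sum>i\<in>I. s i m) = 0" for m by (simp add: g_def flip: of_real_sum)
  define t where "t m = sin (2 * pi * (real m * (of_int u / real n)))" for m
  have orth: "(\<Sum>m<n. 2 * (s i m * t m)) = (if int n dvd b i - u then real n else 0) - (if int n dvd b i + u then real n else 0)" for i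
  proof -
    have "2 * (s i m * t m) = cos (2 * pi * (real m * (of_int (b i - u) / real n))) - cos (2 * pi * (real m * (of_int (b i + u) / real n)))" for m
      unfolding s_def t_def sin_times_sin by (simp add: diff_divide_distrib add_divide_distrib algebra_simps)
    then have "(\<Sum>m<n. 2 * (s i m * t m)) = (\<Sum>m<n. cos (2 * pi * (real m * (of_int (b i - u) / real n)))) - (\<Sum>m<n. cos (2 * pi * (real m * (of_int (b i + u) / real n))))"
      by (simp only: sum_subtractf)
    then show ?thesis by (simp only: sum_cos_roots_of_unity[OF n])
  qed
  have "0 = (\<Sum>m<n. 2 * ((\<Sum>i\<in>I. s i m) * t m))" by (simp add: zero)
  also have "\<dots> = (\<Sum>m<n. \<Sum>i\<in>I. 2 * (s i m * t m))" by (simp add: sum_distrib_left sum_distrib_right)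
  also have "\<dots> = (\<Sum>i\<in>I. \<Sum>m<n. 2 * (s i m * t m))" by (rule sum.swap)
  also have "\<dots> = (\<Sum>i\<in>I. if int n dvd b i - u then real n else 0) - (\<Sum>i\<in>I. if int n dvd b i + u then real n else 0)"
    unfolding orth by (rule sum_subtractf)
  also have "\<dots> = real n * real (card {i \<in> I. int n dvd b i - u}) - real n * real (card {i \<in> I. int n dvd b i + u})"
    using fin by (simp add: sum.inter_filter[symmetric])
  finally show ?thesis using n by simp
qed

section \<open>Lattice simplices with basic facets\<close>

lemma int_vecs_0: "0 \<in> int_vecs"
  by (simp add: int_vecs_def)

lemma int_vecs_add: "x \<in> int_vecs \<Longrightarrow> y \<in> int_vecs \<Longrightarrow> x + y \<in> int_vecs"
  by (simp add: int_vecs_def)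

lemma int_vecs_diff: "x \<in> int_vecs \<Longrightarrow> y \<in> int_vecs \<Longrightarrow> x - y \<in> int_vecs"
  by (simp add: int_vecs_def)

lemma int_vecs_scaleR: "c \<in> \<int> \<Longrightarrow> x \<in> int_vecs \<Longrightarrow> c *\<^sub>R x \<in> int_vecs"
  by (simp add: int_vecs_def)

lemma int_vecs_sum: "(\<And>i. i \<in> A \<Longrightarrow> f i \<in> int_vecs) \<Longrightarrow> sum f A \<in> int_vecs"
  by (induction A rule: infinite_finite_induct) (auto intro: int_vecs_0 int_vecs_add)

lemma finite_bounded_int_vecs:
  fixes X :: "(real ^ 'm) set"
  assumes "X \<subseteq> int_vecs" "\<And>x i. x \<in> X \<Longrightarrow> \<bar>x $ i\<bar> \<le> R"
  shows "finite X"
proof -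
  define F where "F = (\<lambda>x i. \<lfloor>x $ i\<rfloor>) ` X"
  have "F \<subseteq> PiE UNIV (\<lambda>_. {- \<lceil>R\<rceil>..\<lceil>R\<rceil>})"
  proof
    fix g assume "g \<in> F"
    then obtain x where x: "x \<in> X" "g = (\<lambda>i. \<lfloor>x $ i\<rfloor>)" by (auto simp: F_def)
    have "g i \<in> {- \<lceil>R\<rceil>..\<lceil>R\<rceil>}" for i
      using assms(2)[OF x(1), of i] unfolding x(2) atLeastAtMost_iff by linarith
    then show "g \<in> PiE UNIV (\<lambda>_. {- \<lceil>R\<rceil>..\<lceil>R\<rceil>})" by auto
  qed
  then have "finite F" by (rule finite_subset) (auto intro: finite_PiE)
  moreover have "inj_on (\<lambda>x i. \<lfloor>x $ i\<rfloor>) X"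
  proof (rule inj_onI)
    fix x y assume xy: "x \<in> X" "y \<in> X" "(\<lambda>i. \<lfloor>x $ i\<rfloor>) = (\<lambda>i. \<lfloor>y $ i\<rfloor>)"
    have "x $ i = y $ i" for i
    proof -
      have "x $ i = of_int \<lfloor>x $ i\<rfloor>" "y $ i = of_int \<lfloor>y $ i\<rfloor>"
        using xy(1,2) assms(1) by (auto simp: int_vecs_def of_int_floor)
      then show ?thesis using fun_cong[OF xy(3), of i] by simp
    qed
    then show "x = y" by (simp add: vec_eq_iff)
  qed
  ultimately show ?thesis unfolding F_def using finite_imageD by blast
qed

section \<open>Integral coordinates on basic simplices\<close>

lemma convex_hull_eq_imp_subset:
  fixes C :: "'a::euclidean_space set"
  assumes "\<not> affine_dependent C" "convex hull C = convex hull A"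
  shows "C \<subseteq> A"
proof
  fix x assume "x \<in> C"
  then have "x extreme_point_of (convex hull C)"
    using extreme_point_of_convex_hull_affine_independent[OF assms(1)] by blast
  then show "x \<in> A" unfolding assms(2) by (rule extreme_point_of_convex_hull)
qed

text \<open>Relative to one vertex \<open>a\<close>, the other vertices become members of a lattice
  basis \<open>B\<close>. The coefficient sum being an integer, subtracting that multiple of
  \<open>a\<close> leaves a lattice point, and its coefficients in \<open>B\<close> are unique,
  hence integral.\<close>

lemma basic_simplex_integral_coordinates:
  fixes C :: "(real ^ 'm) set"
  assumes bs: "basic_simplex (convex hull C)" and C: "\<not> affine_dependent C"
    and x: "(\<Sum>y\<in>C. u y *\<^sub>R y) \<in> int_vecs" and s: "sum u C \<in> \<int>" and y: "y \<in> C"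
  shows "u y \<in> \<int>"
proof -
  obtain k :: nat and w B where w: "\<forall>i\<in>{1..k + 1}. w i \<in> int_vecs" "convex hull C = convex hull (w ` {1..k + 1})"
    and inj: "inj_on (\<lambda>i. w i - w (k + 1)) {1..k}" and B: "lattice_basis B" "(\<lambda>i. w i - w (k + 1)) ` {1..k} \<subseteq> B"
    using bs unfolding basic_simplex_def by blast
  define a where "a = w (k + 1)"
  have finB: "finite B" and indB: "independent B" using B(1) by (auto simp: lattice_basis_def)
  have sub: "(\<lambda>x. - a + x) ` (w ` {1..k + 1} - {a}) \<subseteq> B"
  proof
    fix y assume "y \<in> (\<lambda>x. - a + x) ` (w ` {1..k + 1} - {a})"
    then obtain i where i: "i \<in> {1..k + 1}" "w i \<noteq> a" and y: "y = - a + w i" by blast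
    then have "i \<in> {1..k}" by (cases "i = k + 1") (auto simp: a_def)
    then have "w i - w (k + 1) \<in> B" using B(2) by blast
    then show "y \<in> B" by (simp add: a_def y)
  qed
  have "\<not> affine_dependent (w ` {1..k + 1})"
    using affine_dependent_iff_dependent2[of a "w ` {1..k + 1}"] independent_mono[OF indB sub] by (auto simp: a_def)
  \<comment> \<open>Both generating sets are affinely independent, so each consists of the extreme
    points of the common hull.\<close>
  then have CW: "C = w ` {1..k + 1}"
    using convex_hull_eq_imp_subset[OF C w(2)] convex_hull_eq_imp_subset[of "w ` {1..k + 1}" C] w(2) by blast
  have finC: "finite C" by (simp add: CW)
  have aC: "a \<in> C" and aI: "a \<in> int_vecs" using w(1) by (auto simp: CW a_def)
  define D where "D = (\<lambda>x. - a + x) ` (C - {a})"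
  have D: "D \<subseteq> B" using sub by (simp add: D_def CW)
  have "(\<Sum>y\<in>C. u y *\<^sub>R y) - sum u C *\<^sub>R a = (\<Sum>y\<in>C. u y *\<^sub>R (- a + y))"
    by (simp add: scaleR_diff_right sum_subtractf scaleR_sum_left)
  also have "\<dots> = (\<Sum>y\<in>C - {a}. u y *\<^sub>R (- a + y))"
    using finC aC by (simp add: sum.remove)
  also have "\<dots> = (\<Sum>d\<in>D. u (a + d) *\<^sub>R d)"
    unfolding D_def by (subst sum.reindex) (auto simp: inj_on_def)
  also have "\<dots> = (\<Sum>b\<in>B. (if b \<in> D then u (a + b) else 0) *\<^sub>R b)"
    using D finB by (intro sum.mono_neutral_cong_left) auto
  finally have e1: "(\<Sum>y\<in>C. u y *\<^sub>R y) - sum u C *\<^sub>R a = (\<Sum>b\<in>B. (if b \<in> D then u (a + b) else 0) *\<^sub>R b)" .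
  have "(\<Sum>y\<in>C. u y *\<^sub>R y) - sum u C *\<^sub>R a \<in> int_vecs"
    using x s aI by (intro int_vecs_diff int_vecs_scaleR)
  then obtain c :: "real ^ 'm \<Rightarrow> int" where "(\<Sum>y\<in>C. u y *\<^sub>R y) - sum u C *\<^sub>R a = (\<Sum>b\<in>B. of_int (c b) *\<^sub>R b)"
    using B(1) unfolding lattice_basis_def by blast
  then have z: "(\<Sum>b\<in>B. ((if b \<in> D then u (a + b) else 0) - of_int (c b)) *\<^sub>R b) = 0"
    unfolding e1 by (simp add: scaleR_diff_left sum_subtractf)
  have uD: "u y \<in> \<int>" if "y \<in> C - {a}" for y
  proof -
    have "- a + y \<in> D" using that by (auto simp: D_def)
    then have "u (a + (- a + y)) - of_int (c (- a + y)) = 0"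
      using independentD[OF indB finB order_refl z, of "- a + y"] D by auto
    then have "u y = of_int (c (- a + y))" by simp
    then show ?thesis by simp
  qed
  show ?thesis
  proof (cases "y = a")
    case True
    have "sum u C = u a + sum u (C - {a})" using finC aC by (simp add: sum.remove)
    moreover have "sum u (C - {a}) \<in> \<int>" by (rule Ints_sum) (use uD in blast)
    ultimately show ?thesis using s True by (metis Ints_diff add_diff_cancel_right')
  qed (use uD y in auto)
qed

locale basic_facet_simplex =
  fixes v :: "'i \<Rightarrow> real ^ 'm" and Ix :: "'i set" and d :: nat
  assumes fin: "finite Ix" and card: "card Ix = 2 * d" and dim: "CARD('m) = 2 * d - 1" and d: "d > 0"
    and inj: "inj_on v Ix" and indep: "\<not> affine_dependent (v ` Ix)"
    and vint: "\<And>j. j \<in> Ix \<Longrightarrow> v j \<in> int_vecs"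
    and facets: "\<And>F. F facet_of (convex hull (v ` Ix)) \<Longrightarrow> basic_simplex F"
begin

text \<open>The point with coordinates \<open>c\<close> with respect to the vectors
  \<open>(v j, 1)\<close> is integral; only the values of \<open>c\<close> on \<open>Ix\<close>
  matter.\<close>

definition lat :: "('i \<Rightarrow> real) \<Rightarrow> bool" where
  "lat c \<longleftrightarrow> (\<Sum>j\<in>Ix. c j) \<in> \<int> \<and> (\<Sum>j\<in>Ix. c j *\<^sub>R v j) \<in> int_vecs"

lemma lat_add: "lat c \<Longrightarrow> lat c' \<Longrightarrow> lat (\<lambda>j. c j + c' j)"
  by (simp add: lat_def sum.distrib scaleR_add_left int_vecs_add)

lemma lat_diff: "lat c \<Longrightarrow> lat c' \<Longrightarrow> lat (\<lambda>j. c j - c' j)"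
  by (simp add: lat_def sum_subtractf scaleR_diff_left int_vecs_diff)

lemma lat_scale: "lat c \<Longrightarrow> a \<in> \<int> \<Longrightarrow> lat (\<lambda>j. a * c j)"
proof -
  assume c: "lat c" and a: "a \<in> \<int>"
  have "(\<Sum>j\<in>Ix. (a * c j) *\<^sub>R v j) = a *\<^sub>R (\<Sum>j\<in>Ix. c j *\<^sub>R v j)"
    by (simp add: scaleR_sum_right)
  moreover have "(\<Sum>j\<in>Ix. a * c j) = a * (\<Sum>j\<in>Ix. c j)"
    by (simp add: sum_distrib_left)
  ultimately show ?thesis using c a by (simp add: lat_def int_vecs_scaleR)
qed

lemma lat_Ints: "(\<And>j. j \<in> Ix \<Longrightarrow> c j \<in> \<int>) \<Longrightarrow> lat c"
  unfolding lat_def by (auto intro!: Ints_sum int_vecs_sum int_vecs_scaleR vint)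

lemma lat_frac: "lat c \<Longrightarrow> lat (\<lambda>j. frac (c j))"
  using lat_diff[of c "\<lambda>j. of_int \<lfloor>c j\<rfloor>"] lat_Ints[of "\<lambda>j. of_int \<lfloor>c j\<rfloor>"] by (simp add: frac_def)

text \<open>Subtracting the lattice vector \<open>c i *\<^sub>R v i\<close> leaves a lattice point
  combined from the vertices of the facet opposite \<open>v i\<close>, which is basic.\<close>

lemma lat_integral:
  assumes c: "lat c" and i: "i \<in> Ix" "c i \<in> \<int>" and j: "j \<in> Ix"
  shows "c j \<in> \<int>"
proof (cases "j = i")
  case False
  define C where "C = v ` Ix - {v i}"
  have C: "C = v ` (Ix - {i})" using inj i by (auto simp: C_def inj_on_def)
  define u where "u y = c (inv_into Ix v y)" for y
  have u: "u (v k) = c k" if "k \<in> Ix" for k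
    using inj that by (simp add: u_def inv_into_f_f)
  have fac: "(convex hull C) facet_of (convex hull (v ` Ix))"
  proof -
    have "v j \<in> C" unfolding C using j False by blast
    then have "convex hull C \<noteq> {}" using hull_inc by fastforce
    then show ?thesis unfolding facet_of_convex_hull_affine_independent[OF indep] C_def using i by blast
  qed
  have injC: "inj_on v (Ix - {i})" using inj by (rule inj_on_subset) auto
  have s1: "(\<Sum>y\<in>C. u y *\<^sub>R y) = (\<Sum>j\<in>Ix - {i}. c j *\<^sub>R v j)"
    unfolding C by (subst sum.reindex[OF injC]) (auto intro!: sum.cong simp: u)
  have s2: "sum u C = (\<Sum>j\<in>Ix - {i}. c j)"
    unfolding C by (subst sum.reindex[OF injC]) (auto intro!: sum.cong simp: u)
  have "(\<Sum>j\<in>Ix. c j) = c i + (\<Sum>j\<in>Ix - {i}. c j)"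
    using i fin by (intro sum.remove) auto
  then have "sum u C \<in> \<int>" unfolding s2 using c i(2) unfolding lat_def by (metis Ints_diff add_diff_cancel_left')
  moreover have "(\<Sum>j\<in>Ix. c j *\<^sub>R v j) = c i *\<^sub>R v i + (\<Sum>j\<in>Ix - {i}. c j *\<^sub>R v j)"
    using i fin by (intro sum.remove) auto
  then have "(\<Sum>y\<in>C. u y *\<^sub>R y) \<in> int_vecs" unfolding s1 using c i vint[OF i(1)] unfolding lat_def
    by (metis add_diff_cancel_left' int_vecs_diff int_vecs_scaleR)
  moreover have "\<not> affine_dependent C" unfolding C_def using indep affine_independent_Diff by blast
  ultimately have "u (v j) \<in> \<int>"
    using basic_simplex_integral_coordinates[OF facets[OF fac], of u "v j"] j False by (auto simp: C)
  then show ?thesis using u j by simp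
qed (use i in simp)

lemma coordinates_unique:
  assumes "(\<Sum>j\<in>Ix. c j) = (\<Sum>j\<in>Ix. c' j)" "(\<Sum>j\<in>Ix. c j *\<^sub>R v j) = (\<Sum>j\<in>Ix. c' j *\<^sub>R v j)"
    and j: "j \<in> Ix"
  shows "c j = c' j"
proof (rule ccontr)
  assume ne: "c j \<noteq> c' j"
  define u where "u y = c (inv_into Ix v y) - c' (inv_into Ix v y)" for y
  have u: "u (v k) = c k - c' k" if "k \<in> Ix" for k
    using inj that by (simp add: u_def inv_into_f_f)
  have "sum u (v ` Ix) = 0"
    using assms(1) by (subst sum.reindex[OF inj]) (simp add: u sum_subtractf)
  moreover have "(\<Sum>y\<in>v ` Ix. u y *\<^sub>R y) = 0"
    using assms(2) by (subst sum.reindex[OF inj]) (simp add: u sum_subtractf scaleR_diff_left)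
  moreover have "u (v j) \<noteq> 0" "v j \<in> v ` Ix" using ne u j by auto
  ultimately have "affine_dependent (v ` Ix)"
    unfolding affine_dependent_explicit_finite[OF finite_imageI[OF fin]] by blast
  then show False using indep by blast
qed

lemma card_vertices: "card (v ` Ix) = Suc (CARD('m))"
  using d by (simp add: card_image[OF inj] dim card)

lemma coordinates_exist: "\<exists>c. (\<Sum>j\<in>Ix. c j) = 1 \<and> (\<Sum>j\<in>Ix. c j *\<^sub>R v j) = x"
proof -
  have "affine hull (v ` Ix) = UNIV"
    by (rule affine_independent_span_eq[OF indep]) (simp only: card_vertices DIM_cart DIM_real mult_1_right)
  then obtain u where "sum u (v ` Ix) = 1" "(\<Sum>y\<in>v ` Ix. u y *\<^sub>R y) = x"
    unfolding affine_hull_finite[OF finite_imageI[OF fin]] by blast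
  then show ?thesis by (intro exI[of _ "u \<circ> v"]) (simp add: sum.reindex[OF inj])
qed

lemma convex_hull_vertices:
  "convex hull (v ` Ix) = {\<Sum>j\<in>Ix. c j *\<^sub>R v j | c. (\<forall>j\<in>Ix. 0 \<le> c j) \<and> (\<Sum>j\<in>Ix. c j) = 1}"
proof (intro equalityI subsetI)
  fix x assume "x \<in> convex hull (v ` Ix)"
  then obtain u where "\<forall>y\<in>v ` Ix. 0 \<le> u y" "sum u (v ` Ix) = 1" "(\<Sum>y\<in>v ` Ix. u y *\<^sub>R y) = x"
    unfolding convex_hull_finite[OF finite_imageI[OF fin]] by blast
  then show "x \<in> {\<Sum>j\<in>Ix. c j *\<^sub>R v j | c. (\<forall>j\<in>Ix. 0 \<le> c j) \<and> (\<Sum>j\<in>Ix. c j) = 1}"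
    by (intro CollectI exI[of _ "u \<circ> v"]) (simp add: sum.reindex[OF inj])
next
  fix x assume "x \<in> {\<Sum>j\<in>Ix. c j *\<^sub>R v j | c. (\<forall>j\<in>Ix. 0 \<le> c j) \<and> (\<Sum>j\<in>Ix. c j) = 1}"
  then obtain c where x: "x = (\<Sum>j\<in>Ix. c j *\<^sub>R v j)" and "\<forall>j\<in>Ix. 0 \<le> c j" "(\<Sum>j\<in>Ix. c j) = 1" by blast
  then show "x \<in> convex hull (v ` Ix)"
    unfolding x by (intro convex_sum[OF fin convex_convex_hull] hull_inc) auto
qed

text \<open>The simplex is full dimensional, so its interior consists of the points with all
  barycentric coordinates positive; dilation by \<open>k\<close> multiplies the coordinates by
  \<open>k\<close>.\<close>

lemma interior_scaled:
  assumes k: "k > (0::real)"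
  shows "interior ((\<lambda>y. k *\<^sub>R y) ` (convex hull (v ` Ix))) =
    {\<Sum>j\<in>Ix. c j *\<^sub>R v j | c. (\<forall>j\<in>Ix. 0 < c j) \<and> (\<Sum>j\<in>Ix. c j) = k}"
proof -
  have "interior ((\<lambda>y. k *\<^sub>R y) ` (convex hull (v ` Ix))) = (\<lambda>y. k *\<^sub>R y) ` interior (convex hull (v ` Ix))"
    by (rule interior_injective_linear_image) (use k in \<open>auto simp: linear_iff scaleR_add_right inj_def\<close>)
  also have "interior (convex hull (v ` Ix)) =
      {y. \<exists>u. (\<forall>x\<in>v ` Ix. 0 < u x) \<and> sum u (v ` Ix) = 1 \<and> (\<Sum>x\<in>v ` Ix. u x *\<^sub>R x) = y}"
    unfolding interior_convex_hull_explicit_minimal[OF indep] card_vertices by simp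
  also have "\<dots> = {\<Sum>j\<in>Ix. c j *\<^sub>R v j | c. (\<forall>j\<in>Ix. 0 < c j) \<and> (\<Sum>j\<in>Ix. c j) = 1}"
  proof (intro equalityI subsetI)
    fix y assume "y \<in> {y. \<exists>u. (\<forall>x\<in>v ` Ix. 0 < u x) \<and> sum u (v ` Ix) = 1 \<and> (\<Sum>x\<in>v ` Ix. u x *\<^sub>R x) = y}"
    then obtain u where "\<forall>x\<in>v ` Ix. 0 < u x" "sum u (v ` Ix) = 1" "(\<Sum>x\<in>v ` Ix. u x *\<^sub>R x) = y" by blast
    then show "y \<in> {\<Sum>j\<in>Ix. c j *\<^sub>R v j | c. (\<forall>j\<in>Ix. 0 < c j) \<and> (\<Sum>j\<in>Ix. c j) = 1}"
      by (intro CollectI exI[of _ "u \<circ> v"]) (simp add: sum.reindex[OF inj])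
  next
    fix y assume "y \<in> {\<Sum>j\<in>Ix. c j *\<^sub>R v j | c. (\<forall>j\<in>Ix. 0 < c j) \<and> (\<Sum>j\<in>Ix. c j) = 1}"
    then obtain c where c: "y = (\<Sum>j\<in>Ix. c j *\<^sub>R v j)" "\<forall>j\<in>Ix. 0 < c j" "(\<Sum>j\<in>Ix. c j) = 1" by blast
    define u where "u x = c (inv_into Ix v x)" for x
    have u: "u (v j) = c j" if "j \<in> Ix" for j using inj that by (simp add: u_def inv_into_f_f)
    show "y \<in> {y. \<exists>u. (\<forall>x\<in>v ` Ix. 0 < u x) \<and> sum u (v ` Ix) = 1 \<and> (\<Sum>x\<in>v ` Ix. u x *\<^sub>R x) = y}"
      by (intro CollectI exI[of _ u]) (use c u in \<open>simp add: sum.reindex[OF inj]\<close>)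
  qed
  also have "(\<lambda>y. k *\<^sub>R y) ` \<dots> = {\<Sum>j\<in>Ix. c j *\<^sub>R v j | c. (\<forall>j\<in>Ix. 0 < c j) \<and> (\<Sum>j\<in>Ix. c j) = k}"
  proof (intro equalityI subsetI)
    fix x assume "x \<in> (\<lambda>y. k *\<^sub>R y) ` {\<Sum>j\<in>Ix. c j *\<^sub>R v j | c. (\<forall>j\<in>Ix. 0 < c j) \<and> (\<Sum>j\<in>Ix. c j) = 1}"
    then obtain c where "x = k *\<^sub>R (\<Sum>j\<in>Ix. c j *\<^sub>R v j)" "\<forall>j\<in>Ix. 0 < c j" "(\<Sum>j\<in>Ix. c j) = 1" by blast
    then show "x \<in> {\<Sum>j\<in>Ix. c j *\<^sub>R v j | c. (\<forall>j\<in>Ix. 0 < c j) \<and> (\<Sum>j\<in>Ix. c j) = k}"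
      using k by (intro CollectI exI[of _ "\<lambda>j. k * c j"]) (simp add: scaleR_sum_right flip: sum_distrib_left)
  next
    fix x assume "x \<in> {\<Sum>j\<in>Ix. c j *\<^sub>R v j | c. (\<forall>j\<in>Ix. 0 < c j) \<and> (\<Sum>j\<in>Ix. c j) = k}"
    then obtain c where c: "x = (\<Sum>j\<in>Ix. c j *\<^sub>R v j)" "\<forall>j\<in>Ix. 0 < c j" "(\<Sum>j\<in>Ix. c j) = k" by blast
    have "x = k *\<^sub>R (\<Sum>j\<in>Ix. (c j / k) *\<^sub>R v j)" using k by (simp add: c(1) scaleR_sum_right)
    moreover have "(\<Sum>j\<in>Ix. c j / k) = 1" using k c(3) by (simp flip: sum_divide_distrib)
    moreover have "\<forall>j\<in>Ix. 0 < c j / k" using c(2) k by auto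
    ultimately show "x \<in> (\<lambda>y. k *\<^sub>R y) ` {\<Sum>j\<in>Ix. c j *\<^sub>R v j | c. (\<forall>j\<in>Ix. 0 < c j) \<and> (\<Sum>j\<in>Ix. c j) = 1}"
      by (intro image_eqI[of _ _ "\<Sum>j\<in>Ix. (c j / k) *\<^sub>R v j"]) auto
  qed
  finally show ?thesis .
qed

end

section \<open>Statements (1), (2), (3) and (5) against the central condition\<close>

context basic_facet_simplex
begin

text \<open>Each of the five statements of the theorem is shown to be equivalent to this condition.\<close>

definition central :: bool where
  "central \<longleftrightarrow> (\<forall>c. lat c \<and> (\<forall>j\<in>Ix. 0 < c j \<and> c j < 1) \<longrightarrow> (\<Sum>j\<in>Ix. c j) = real d)"

lemma lat_complement:
  assumes "lat c" "\<forall>j\<in>Ix. 0 < c j \<and> c j < 1"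
  shows "lat (\<lambda>j. 1 - c j)" "\<forall>j\<in>Ix. 0 < 1 - c j \<and> 1 - c j < 1"
    "(\<Sum>j\<in>Ix. 1 - c j) = 2 * real d - (\<Sum>j\<in>Ix. c j)"
proof -
  show "lat (\<lambda>j. 1 - c j)" using lat_diff[OF lat_Ints[of "\<lambda>_. 1"] assms(1)] by simp
qed (use assms in \<open>auto simp: sum_subtractf card\<close>)

text \<open>A lower bound suffices, since the sums of \<open>c\<close> and \<open>1 - c\<close> add
  up to 2d.\<close>

lemma centralI_ge:
  assumes "\<And>c. lat c \<Longrightarrow> \<forall>j\<in>Ix. 0 < c j \<and> c j < 1 \<Longrightarrow> real d \<le> (\<Sum>j\<in>Ix. c j)"
  shows central
  unfolding central_def
proof (intro allI impI, elim conjE)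
  fix c assume c: "lat c" "\<forall>j\<in>Ix. 0 < c j \<and> c j < 1"
  show "(\<Sum>j\<in>Ix. c j) = real d"
    using assms[OF c] assms[OF lat_complement(1,2)[OF c]] lat_complement(3)[OF c] by linarith
qed

text \<open>The coordinate sum is a positive integer, so a sum below \<open>d\<close> is one of the
  heights 1, ..., d - 1 occurring in (1) and (2).\<close>

lemma centralI:
  assumes "\<And>c k. lat c \<Longrightarrow> \<forall>j\<in>Ix. 0 < c j \<and> c j < 1 \<Longrightarrow> k \<in> {1..d - 1} \<Longrightarrow> (\<Sum>j\<in>Ix. c j) = real k \<Longrightarrow> False"
  shows central
proof (rule centralI_ge, rule ccontr)
  fix c assume c: "lat c" "\<forall>j\<in>Ix. 0 < c j \<and> c j < 1" and lt: "\<not> real d \<le> (\<Sum>j\<in>Ix. c j)"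
  have "Ix \<noteq> {}" using card d by auto
  then have pos: "0 < (\<Sum>j\<in>Ix. c j)" using c(2) fin by (intro sum_pos) auto
  obtain z where z: "(\<Sum>j\<in>Ix. c j) = of_int z" using c(1) by (auto simp: lat_def elim: Ints_cases)
  then have "(\<Sum>j\<in>Ix. c j) = real (nat z)" "nat z \<in> {1..d - 1}" using pos lt by auto
  then show False using assms[OF c] by blast
qed

lemma lat_nonint:
  assumes c: "lat c" and i: "i \<in> Ix" "c i \<notin> \<int>"
  shows "lat (\<lambda>j. frac (c j))" "\<forall>j\<in>Ix. 0 < frac (c j) \<and> frac (c j) < 1"
proof -
  show "lat (\<lambda>j. frac (c j))" by (rule lat_frac[OF c])
  have "c j \<notin> \<int>" if "j \<in> Ix" for j using lat_integral[OF c that _ i(1)] i(2) by blast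
  then show "\<forall>j\<in>Ix. 0 < frac (c j) \<and> frac (c j) < 1" by (simp add: frac_gt_0_iff frac_lt_1)
qed

text \<open>Taking fractional parts of nonnegative coordinates can only lower their sum, whereas a
  nonintegral lattice point would have fractional parts summing to \<open>d\<close>.\<close>

lemma central_imp_integral:
  assumes central and c: "lat c" "\<And>j. j \<in> Ix \<Longrightarrow> 0 \<le> c j" "(\<Sum>j\<in>Ix. c j) < real d" and i: "i \<in> Ix"
  shows "c i \<in> \<int>"
proof (rule ccontr)
  assume ni: "c i \<notin> \<int>"
  have "(\<Sum>j\<in>Ix. frac (c j)) = real d"
    using \<open>central\<close> lat_nonint[OF c(1) i ni] unfolding central_def by blast
  moreover have "(\<Sum>j\<in>Ix. frac (c j)) \<le> (\<Sum>j\<in>Ix. c j)"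
  proof (rule sum_mono)
    fix j assume "j \<in> Ix"
    then have "0 \<le> \<lfloor>c j\<rfloor>" using c(2) by simp
    then show "frac (c j) \<le> c j" by (simp add: frac_def)
  qed
  ultimately show False using c(3) by simp
qed

lemma central_iff_multiples_generated:
  "central \<longleftrightarrow> (\<forall>k\<in>{1..d - 1}. \<forall>x \<in> (\<lambda>y. real k *\<^sub>R y) ` (convex hull (v ` Ix)) \<inter> int_vecs. \<forall>c.
      (\<forall>i\<in>Ix. 0 \<le> c i) \<and> (\<Sum>i\<in>Ix. c i) = real k \<and> x = (\<Sum>i\<in>Ix. c i *\<^sub>R v i) \<longrightarrow> (\<forall>i\<in>Ix. c i \<in> \<int>))"
  (is "_ \<longleftrightarrow> ?R")
proof
  assume cen: central
  show ?R
  proof (intro ballI allI impI)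
    fix k x c i assume k: "k \<in> {1..d - 1}" and x: "x \<in> (\<lambda>y. real k *\<^sub>R y) ` (convex hull (v ` Ix)) \<inter> int_vecs"
      and c: "(\<forall>i\<in>Ix. 0 \<le> c i) \<and> (\<Sum>i\<in>Ix. c i) = real k \<and> x = (\<Sum>i\<in>Ix. c i *\<^sub>R v i)" and i: "i \<in> Ix"
    have "lat c" using x c by (auto simp: lat_def)
    then show "c i \<in> \<int>" using c k by (intro central_imp_integral[OF cen _ _ _ i]) auto
  qed
next
  assume R: ?R
  show central
  proof (rule centralI)
    fix c k assume c: "lat c" "\<forall>j\<in>Ix. 0 < c j \<and> c j < 1" and k: "k \<in> {1..d - 1}" "(\<Sum>j\<in>Ix. c j) = real k"
    define x where "x = (\<Sum>i\<in>Ix. c i *\<^sub>R v i)"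
    have k0: "real k > 0" using k by auto
    have "(\<Sum>i\<in>Ix. (c i / real k) *\<^sub>R v i) \<in> convex hull (v ` Ix)"
      using c(2) k0 k(2) by (intro convex_sum[OF fin convex_convex_hull] hull_inc) (auto simp: less_imp_le simp flip: sum_divide_distrib)
    moreover have "x = real k *\<^sub>R (\<Sum>i\<in>Ix. (c i / real k) *\<^sub>R v i)"
      using k0 by (simp add: x_def scaleR_sum_right)
    ultimately have "x \<in> (\<lambda>y. real k *\<^sub>R y) ` (convex hull (v ` Ix)) \<inter> int_vecs"
      using c(1) by (auto simp: lat_def x_def)
    moreover have "(\<forall>i\<in>Ix. 0 \<le> c i) \<and> (\<Sum>i\<in>Ix. c i) = real k \<and> x = (\<Sum>i\<in>Ix. c i *\<^sub>R v i)"
      using c(2) k(2) by (auto simp: x_def less_imp_le)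
    ultimately have int: "\<forall>i\<in>Ix. c i \<in> \<int>" using R k(1) by blast
    obtain i where i: "i \<in> Ix" using card d by fastforce
    then show False using int c(2) by (metis Ints_cases of_int_0_less_iff of_int_less_1_iff zless_imp_add1_zle add_0 not_less)
  qed
qed

lemma central_iff_no_interior_points:
  "central \<longleftrightarrow> (\<forall>k\<in>{1..d - 1}. interior ((\<lambda>y. real k *\<^sub>R y) ` (convex hull (v ` Ix))) \<inter> int_vecs = {})"
  (is "_ \<longleftrightarrow> ?R")
proof
  assume cen: central
  show ?R
  proof (intro ballI equals0I)
    fix k x assume k: "k \<in> {1..d - 1}" and "x \<in> interior ((\<lambda>y. real k *\<^sub>R y) ` (convex hull (v ` Ix))) \<inter> int_vecs"
    then obtain c where c: "\<forall>j\<in>Ix. 0 < c j" "(\<Sum>j\<in>Ix. c j) = real k" "(\<Sum>j\<in>Ix. c j *\<^sub>R v j) \<in> int_vecs"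
      using interior_scaled[of "real k"] by auto
    then have lat: "lat c" by (simp add: lat_def)
    \<comment> \<open>Positive integral coordinates force height at least 2d, far above
      \<open>k\<close>.\<close>
    have "1 \<le> c i" if i: "i \<in> Ix" for i
    proof -
      have "c i \<in> \<int>" by (rule central_imp_integral[OF cen lat _ _ i]) (use c k in \<open>auto simp: less_imp_le\<close>)
      then obtain z where z: "c i = of_int z" by (auto elim: Ints_cases)
      then have "0 < z" using c(1) i by fastforce
      then show ?thesis using z by simp
    qed
    then have "(\<Sum>j\<in>Ix. 1) \<le> (\<Sum>j\<in>Ix. c j)" by (rule sum_mono)
    moreover have "real k < real d" using k d by auto
    ultimately show False using c(2) card by simp
  qed
next
  assume R: ?R
  show central
  proof (rule centralI)
    fix c k assume c: "lat c" "\<forall>j\<in>Ix. 0 < c j \<and> c j < 1" and k: "k \<in> {1..d - 1}" "(\<Sum>j\<in>Ix. c j) = real k"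
    have "(\<Sum>j\<in>Ix. c j *\<^sub>R v j) \<in> interior ((\<lambda>y. real k *\<^sub>R y) ` (convex hull (v ` Ix)))"
    proof -
      have "real k > 0" using k(1) by simp
      then show ?thesis unfolding interior_scaled[OF \<open>real k > 0\<close>] using c(2) k(2) by blast
    qed
    then show False using R k(1) c(1) by (auto simp: lat_def)
  qed
qed

text \<open>Needed because \<open>card\<close> is 0 on infinite sets: only with finiteness does a
  zero coefficient mean that no point exists.\<close>

lemma finite_par_points:
  "finite {x \<in> {\<Sum>j\<in>Ix. c j *\<^sub>R (v j, 1::real) | c. \<forall>j\<in>Ix. 0 \<le> c j \<and> c j < 1}. fst x \<in> int_vecs \<and> snd x = real k}"
  (is "finite ?S")
proof -
  define R where "R = (\<Sum>j\<in>Ix. norm (v j))"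
  have "finite (fst ` ?S)"
  proof (rule finite_bounded_int_vecs[where R = R])
    show "fst ` ?S \<subseteq> int_vecs" by auto
    fix y i assume "y \<in> fst ` ?S"
    then obtain c where y: "y = (\<Sum>j\<in>Ix. c j *\<^sub>R v j)" and c: "\<forall>j\<in>Ix. 0 \<le> c j \<and> c j < 1" by (auto simp: fst_sum)
    have "\<bar>y $ i\<bar> \<le> norm y" by (rule component_le_norm_cart)
    also have "norm y \<le> R" unfolding y R_def
    proof (rule sum_norm_le)
      fix j assume "j \<in> Ix"
      then show "norm (c j *\<^sub>R v j) \<le> norm (v j)" using c by (auto simp: mult_left_le_one_le less_imp_le)
    qed
    finally show "\<bar>y $ i\<bar> \<le> R" .
  qed
  moreover have "inj_on fst ?S" by (auto simp: inj_on_def prod_eq_iff)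
  ultimately show ?thesis by (rule finite_imageD)
qed

text \<open>By \<open>lat_integral\<close> one vanishing coordinate makes all of them integral, and
  0 is the only integer in the half-open range.\<close>

lemma par_point_cases:
  assumes "lat c" "\<forall>j\<in>Ix. 0 \<le> c j \<and> c j < 1"
  obtains "\<forall>j\<in>Ix. c j = 0" | "\<forall>j\<in>Ix. 0 < c j \<and> c j < 1"
proof (cases "\<exists>i\<in>Ix. c i = 0")
  case True
  then obtain i where "i \<in> Ix" "c i = 0" by blast
  then have "c j \<in> \<int>" if "j \<in> Ix" for j using lat_integral[OF assms(1), of i j] that by simp
  then have "\<forall>j\<in>Ix. c j = 0" using assms(2) by (metis Ints_nonzero_abs_ge1 abs_of_nonneg not_less)
  then show ?thesis by (rule that(1))
next
  case False
  then show ?thesis using assms(2) that(2) by (metis order_le_less)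
qed

text \<open>The nonzero lattice points of the half-open parallelepiped are exactly those of the open
  one, so the central condition says that all of them lie at height \<open>d\<close>.\<close>

lemma central_iff_par_points:
  fixes S :: "nat \<Rightarrow> ((real ^ 'm) \<times> real) set"
  defines "S \<equiv> \<lambda>k. {x \<in> {\<Sum>j\<in>Ix. c j *\<^sub>R (v j, 1::real) | c. \<forall>j\<in>Ix. 0 \<le> c j \<and> c j < 1}. fst x \<in> int_vecs \<and> snd x = real k}"
  shows "card (S 0) = 1" "central \<longleftrightarrow> (\<forall>k\<le>2 * d. k \<noteq> 0 \<longrightarrow> k \<noteq> d \<longrightarrow> card (S k) = 0)"
proof -
  have S: "x \<in> S k \<longleftrightarrow> (\<exists>c. (\<forall>j\<in>Ix. 0 \<le> c j \<and> c j < 1) \<and> lat c \<and> (\<Sum>j\<in>Ix. c j) = real k \<and> x = (\<Sum>j\<in>Ix. c j *\<^sub>R v j, real k))" for x k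
  proof
    assume "x \<in> S k"
    then obtain c where c: "\<forall>j\<in>Ix. 0 \<le> c j \<and> c j < 1" "x = (\<Sum>j\<in>Ix. c j *\<^sub>R (v j, 1::real))" "fst x \<in> int_vecs" "snd x = real k"
      unfolding S_def by blast
    have "fst x = (\<Sum>j\<in>Ix. c j *\<^sub>R v j)" "snd x = (\<Sum>j\<in>Ix. c j)" unfolding c(2) by (simp_all add: fst_sum snd_sum)
    moreover from this have "(\<Sum>j\<in>Ix. c j) \<in> \<int>" using c(4) by (metis Ints_of_nat)
    ultimately show "\<exists>c. (\<forall>j\<in>Ix. 0 \<le> c j \<and> c j < 1) \<and> lat c \<and> (\<Sum>j\<in>Ix. c j) = real k \<and> x = (\<Sum>j\<in>Ix. c j *\<^sub>R v j, real k)"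
      using c(1,3,4) by (intro exI[of _ c]) (simp add: lat_def prod_eq_iff)
  next
    assume "\<exists>c. (\<forall>j\<in>Ix. 0 \<le> c j \<and> c j < 1) \<and> lat c \<and> (\<Sum>j\<in>Ix. c j) = real k \<and> x = (\<Sum>j\<in>Ix. c j *\<^sub>R v j, real k)"
    then obtain c where c: "\<forall>j\<in>Ix. 0 \<le> c j \<and> c j < 1" "lat c" "(\<Sum>j\<in>Ix. c j) = real k" "x = (\<Sum>j\<in>Ix. c j *\<^sub>R v j, real k)" by blast
    have "x = (\<Sum>j\<in>Ix. c j *\<^sub>R (v j, 1::real))" using c by (simp add: prod_eq_iff fst_sum snd_sum)
    moreover have "fst x \<in> int_vecs" "snd x = real k" using c(2,4) by (simp_all add: lat_def)
    ultimately show "x \<in> S k" using c(1) unfolding S_def by blast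
  qed
  have finS: "finite (S k)" for k unfolding S_def by (rule finite_par_points)
  have "S 0 = {(0, 0)}"
  proof (intro equalityI subsetI)
    fix x assume "x \<in> S 0"
    then obtain c where c: "\<forall>j\<in>Ix. 0 \<le> c j \<and> c j < 1" "(\<Sum>j\<in>Ix. c j) = 0" "x = (\<Sum>j\<in>Ix. c j *\<^sub>R v j, 0)" unfolding S by auto
    then have "\<forall>j\<in>Ix. c j = 0" using sum_nonneg_eq_0_iff[OF fin, of c] by auto
    then show "x \<in> {(0, 0)}" using c(3) by simp
  next
    fix x :: "(real ^ 'm) \<times> real" assume "x \<in> {(0, 0)}"
    then show "x \<in> S 0" unfolding S by (intro exI[of _ "\<lambda>_. 0"]) (auto intro: lat_Ints)
  qed
  then show "card (S 0) = 1" by simp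
  show "central \<longleftrightarrow> (\<forall>k\<le>2 * d. k \<noteq> 0 \<longrightarrow> k \<noteq> d \<longrightarrow> card (S k) = 0)"
  proof
    assume cen: central
    show "\<forall>k\<le>2 * d. k \<noteq> 0 \<longrightarrow> k \<noteq> d \<longrightarrow> card (S k) = 0"
    proof (intro allI impI)
      fix k assume k: "k \<le> 2 * d" "k \<noteq> 0" "k \<noteq> d"
      have "x \<notin> S k" for x
      proof
        assume "x \<in> S k"
        then obtain c where c: "\<forall>j\<in>Ix. 0 \<le> c j \<and> c j < 1" "lat c" "(\<Sum>j\<in>Ix. c j) = real k" unfolding S by blast
        show False using par_point_cases[OF c(2,1)]
        proof cases
          case 1
          then show ?thesis using c(3) k by simp
        next
          case 2
          then show ?thesis using cen c k unfolding central_def by auto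
        qed
      qed
      then have "S k = {}" by blast
      then show "card (S k) = 0" by simp
    qed
  next
    assume R: "\<forall>k\<le>2 * d. k \<noteq> 0 \<longrightarrow> k \<noteq> d \<longrightarrow> card (S k) = 0"
    show central
    proof (rule centralI)
      fix c k assume c: "lat c" "\<forall>j\<in>Ix. 0 < c j \<and> c j < 1" and k: "k \<in> {1..d - 1}" "(\<Sum>j\<in>Ix. c j) = real k"
      have "(\<Sum>j\<in>Ix. c j *\<^sub>R v j, real k) \<in> S k" unfolding S using c k(2) by (intro exI[of _ c]) (auto simp: less_imp_le)
      then have "card (S k) \<noteq> 0" using finS[of k] by auto
      moreover have "k \<le> 2 * d" "k \<noteq> 0" "k \<noteq> d" using k(1) d by auto
      ultimately show False using R[rule_format, of k] by simp
    qed
  qed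
qed

text \<open>Each vertex goes to an extreme point of the Cayley polytope and hence into a single
  piece over some \<open>axis i 1\<close>; this is what groups the vertices into fibres. No fibre is
  empty because every \<open>S i\<close> has a point.\<close>

lemma cayley_imp_central:
  fixes S :: "'r::finite \<Rightarrow> (real ^ 's) set"
  assumes r: "CARD('r) = d" and ne: "\<And>i. S i \<noteq> {}" and iso: "lattice_iso (convex hull (v ` Ix)) (cayley S)"
  shows central
proof -
  obtain \<phi> f and c0 :: "(real ^ 'r) \<times> (real ^ 's)" where f: "linear f" and \<phi>: "\<phi> = (\<lambda>x. c0 + f x)"
    and bij: "bij_betw \<phi> UNIV cayley_hyperplane"
    and int: "\<phi> ` int_vecs = cayley_hyperplane \<inter> (int_vecs \<times> int_vecs)" and im: "\<phi> ` (convex hull (v ` Ix)) = cayley S"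
    using iso unfolding lattice_iso_def by blast
  have inj\<phi>: "inj \<phi>" using bij by (simp add: bij_betw_def)
  have \<phi>_sum: "(\<Sum>j\<in>Ix. c j) *\<^sub>R c0 + f (\<Sum>j\<in>Ix. c j *\<^sub>R v j) = (\<Sum>j\<in>Ix. c j *\<^sub>R \<phi> (v j))" for c
    by (simp add: \<phi> linear_sum[OF f] linear_scale[OF f] scaleR_add_right sum.distrib scaleR_sum_left)
  have vert: "\<exists>i. fst (\<phi> (v j)) = axis i 1" if j: "j \<in> Ix" for j
  proof -
    have ex: "v j extreme_point_of (convex hull (v ` Ix))"
      using extreme_point_of_convex_hull_affine_independent[OF indep] j by blast
    have injf: "inj f" using inj\<phi> by (auto simp: \<phi> inj_def)
    have im': "\<phi> ` X = (\<lambda>y. c0 + y) ` (f ` X)" for X by (auto simp: \<phi>)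
    have "f (v j) extreme_point_of (f ` (convex hull (v ` Ix)))"
      unfolding extreme_point_of_def
    proof (intro conjI ballI)
      show "f (v j) \<in> f ` (convex hull (v ` Ix))" using ex by (auto simp: extreme_point_of_def)
      fix a b assume "a \<in> f ` (convex hull (v ` Ix))" "b \<in> f ` (convex hull (v ` Ix))"
      then obtain a' b' where ab: "a = f a'" "b = f b'" "a' \<in> convex hull (v ` Ix)" "b' \<in> convex hull (v ` Ix)" by blast
      have "v j \<notin> open_segment a' b'" using ex ab by (auto simp: extreme_point_of_def)
      then show "f (v j) \<notin> open_segment a b"
        unfolding ab using open_segment_linear_image[OF f injf, of a' b'] injf by (auto simp: inj_def)
    qed
    then have "\<phi> (v j) extreme_point_of (\<phi> ` (convex hull (v ` Ix)))"
      unfolding im' by (subst (1) \<phi>) (simp add: extreme_point_of_translation_eq)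
    then have "\<phi> (v j) \<in> (\<Union>i. {axis i 1} \<times> S i)"
      unfolding im cayley_def by (rule extreme_point_of_convex_hull)
    then show ?thesis by auto
  qed
  define \<iota> where "\<iota> j = (SOME i. fst (\<phi> (v j)) = axis i 1)" for j
  have \<iota>: "fst (\<phi> (v j)) = axis (\<iota> j) 1" if "j \<in> Ix" for j
    unfolding \<iota>_def using someI_ex[OF vert[OF that]] .
  have coord: "fst (\<Sum>j\<in>Ix. c j *\<^sub>R \<phi> (v j)) $ i = (\<Sum>j | j \<in> Ix \<and> \<iota> j = i. c j)" for c i
  proof -
    have "fst (\<Sum>j\<in>Ix. c j *\<^sub>R \<phi> (v j)) $ i = (\<Sum>j\<in>Ix. if \<iota> j = i then c j else 0)"
      by (simp add: fst_sum sum_component) (rule sum.cong, auto simp: \<iota> axis_def)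
    then show ?thesis using fin by (simp add: sum.inter_filter)
  qed
  have surj: "\<exists>j\<in>Ix. \<iota> j = i" for i
  proof (rule ccontr)
    assume "\<not> (\<exists>j\<in>Ix. \<iota> j = i)"
    then have empty: "{j. j \<in> Ix \<and> \<iota> j = i} = {}" by blast
    obtain y where "y \<in> S i" using ne by blast
    then have "(axis i 1, y) \<in> cayley S" unfolding cayley_def by (intro hull_inc) auto
    then obtain x where x: "x \<in> convex hull (v ` Ix)" "\<phi> x = (axis i 1, y)" using im by (metis imageE)
    obtain c where c: "(\<Sum>j\<in>Ix. c j) = 1" "x = (\<Sum>j\<in>Ix. c j *\<^sub>R v j)" using x(1) unfolding convex_hull_vertices by blast
    have "\<phi> x = (\<Sum>j\<in>Ix. c j *\<^sub>R \<phi> (v j))" using \<phi>_sum[of c] c by (simp add: \<phi>)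
    then have "fst (\<phi> x) $ i = 0" using coord[of c i] by (simp only: empty) simp
    then show False using x(2) by simp
  qed
  have \<phi>_int: "\<phi> x \<in> int_vecs \<times> int_vecs" if "x \<in> int_vecs" for x using int that by blast
  show central
  proof (rule centralI_ge)
    fix c assume c: "lat c" "\<forall>j\<in>Ix. 0 < c j \<and> c j < 1"
    define x where "x = (\<Sum>j\<in>Ix. c j *\<^sub>R v j)"
    have x: "x \<in> int_vecs" and s: "(\<Sum>j\<in>Ix. c j) \<in> \<int>" using c(1) by (auto simp: lat_def x_def)
    have c0: "c0 \<in> int_vecs \<times> int_vecs" using \<phi>_int[OF int_vecs_0] by (simp add: \<phi> linear_0[OF f])
    \<comment> \<open>The coordinates sum to an arbitrary integer, so the affine map needs a
      correction by a multiple of its value \<open>c0\<close> at 0, which is integral.\<close>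
    have "(\<Sum>j\<in>Ix. c j *\<^sub>R \<phi> (v j)) = \<phi> x + ((\<Sum>j\<in>Ix. c j) - 1) *\<^sub>R c0"
      unfolding \<phi>_sum[symmetric] x_def[symmetric] by (simp add: \<phi> algebra_simps)
    then have "fst (\<Sum>j\<in>Ix. c j *\<^sub>R \<phi> (v j)) \<in> int_vecs"
      using \<phi>_int[OF x] c0 s by (auto simp: mem_Times_iff intro!: int_vecs_add int_vecs_scaleR)
    then have mu: "(\<Sum>j | j \<in> Ix \<and> \<iota> j = i. c j) \<in> \<int>" for i unfolding coord[symmetric] by (simp add: int_vecs_def)
    have ge: "1 \<le> (\<Sum>j | j \<in> Ix \<and> \<iota> j = i. c j)" for i
    proof -
      have "0 < (\<Sum>j | j \<in> Ix \<and> \<iota> j = i. c j)" using surj[of i] c(2) fin by (intro sum_pos) auto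
      then show ?thesis using mu[of i] by (metis Ints_nonzero_abs_ge1 abs_of_pos less_irrefl)
    qed
    have "real d = (\<Sum>i\<in>(UNIV :: 'r set). 1)" using r by simp
    also have "\<dots> \<le> (\<Sum>i\<in>UNIV. \<Sum>j | j \<in> Ix \<and> \<iota> j = i. c j)" by (rule sum_mono) (rule ge)
    also have "\<dots> = (\<Sum>j\<in>Ix. c j)" by (rule sum.group) (use fin in auto)
    finally show "real d \<le> (\<Sum>j\<in>Ix. c j)" .
  qed
qed

end

section \<open>Cyclicity and the pairing of residues\<close>

context basic_facet_simplex
begin

text \<open>Discreteness of the \<open>i\<close>-th coordinate, which provides a least positive
  value. Values below 1 survive \<open>frac\<close> and so come from the finitely many points of the
  parallelepiped.\<close>

lemma finite_lat_coordinate: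
  assumes i: "i \<in> Ix"
  shows "finite {c i | c. lat c \<and> 0 < c i \<and> c i \<le> 1}"
proof -
  define S where "S k = {x \<in> {\<Sum>j\<in>Ix. c j *\<^sub>R (v j, 1::real) | c. \<forall>j\<in>Ix. 0 \<le> c j \<and> c j < 1}. fst x \<in> int_vecs \<and> snd x = real k}" for k
  \<comment> \<open>Some choice of coordinates of a point; on \<open>Ix\<close> it is forced by
    \<open>coordinates_unique\<close>.\<close>
  define \<kappa> where "\<kappa> x = (SOME c. fst x = (\<Sum>j\<in>Ix. c j *\<^sub>R v j) \<and> snd x = (\<Sum>j\<in>Ix. c j))" for x
  have "{c i | c. lat c \<and> 0 < c i \<and> c i \<le> 1} \<subseteq> insert 1 ((\<lambda>x. \<kappa> x i) ` (\<Union>k\<le>2 * d. S k))"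
  proof
    fix t assume "t \<in> {c i | c. lat c \<and> 0 < c i \<and> c i \<le> 1}"
    then obtain c where c: "lat c" "0 < c i" "c i \<le> 1" and t: "t = c i" by blast
    show "t \<in> insert 1 ((\<lambda>x. \<kappa> x i) ` (\<Union>k\<le>2 * d. S k))"
    proof (cases "c i = 1")
      case False
      define e where "e = (\<lambda>j. frac (c j))"
      have e: "lat e" "\<forall>j\<in>Ix. 0 \<le> e j \<and> e j < 1" "e i = c i"
        using lat_frac[OF c(1)] c False by (auto simp: e_def frac_lt_1 frac_eq)
      obtain z where z: "(\<Sum>j\<in>Ix. e j) = of_int z" using e(1) by (auto simp: lat_def elim: Ints_cases)
      have "0 \<le> (\<Sum>j\<in>Ix. e j)" by (rule sum_nonneg) (use e(2) in auto)
      moreover have "(\<Sum>j\<in>Ix. e j) \<le> (\<Sum>j\<in>Ix. 1)" by (rule sum_mono) (use e(2) in \<open>auto simp: less_imp_le\<close>)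
      ultimately have k: "(\<Sum>j\<in>Ix. e j) = real (nat z)" "nat z \<le> 2 * d" using z card by auto
      define x where "x = (\<Sum>j\<in>Ix. e j *\<^sub>R (v j, 1::real))"
      have x: "fst x = (\<Sum>j\<in>Ix. e j *\<^sub>R v j)" "snd x = (\<Sum>j\<in>Ix. e j)" by (simp_all add: x_def fst_sum snd_sum)
      have "x \<in> S (nat z)" unfolding S_def using e x k(1) by (auto simp: x_def lat_def)
      moreover have "\<kappa> x i = t"
      proof -
        have "\<exists>c. fst x = (\<Sum>j\<in>Ix. c j *\<^sub>R v j) \<and> snd x = (\<Sum>j\<in>Ix. c j)" using x by blast
        then have "fst x = (\<Sum>j\<in>Ix. \<kappa> x j *\<^sub>R v j) \<and> snd x = (\<Sum>j\<in>Ix. \<kappa> x j)" unfolding \<kappa>_def by (rule someI_ex)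
        then have "\<kappa> x i = e i" using x coordinates_unique[of "\<kappa> x" e, OF _ _ i] by simp
        then show ?thesis using e(3) t by simp
      qed
      ultimately show ?thesis using k(2) by blast
    qed (use t in simp)
  qed
  moreover have "finite (\<Union>k\<le>2 * d. S k)" unfolding S_def by (intro finite_UN_I finite_par_points) simp
  ultimately show ?thesis using finite_subset by blast
qed

text \<open>By \<open>lat_integral\<close> one coordinate \<open>c i\<close> determines
  \<open>c\<close> modulo integers. Its values form a discrete subgroup of the reals containing 1,
  hence are the multiples of some 1/n; \<open>g\<close> is a lattice point realizing 1/n.\<close>

lemma lat_cyclic:
  obtains n :: nat and g :: "'i \<Rightarrow> real" and b :: "'i \<Rightarrow> int" where "n > 0" "lat g"
    "\<And>j. j \<in> Ix \<Longrightarrow> g j = of_int (b j) / real n" "\<And>j. j \<in> Ix \<Longrightarrow> coprime (b j) (int n)"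
    "\<And>c. lat c \<Longrightarrow> \<exists>k::int. \<forall>j\<in>Ix. c j - of_int k * g j \<in> \<int>"
proof -
  obtain i where i: "i \<in> Ix" using card d by fastforce
  define T where "T = {c i | c. lat c \<and> 0 < c i \<and> c i \<le> 1}"
  have finT: "finite T" unfolding T_def by (rule finite_lat_coordinate[OF i])
  have "1 \<in> T" unfolding T_def by (intro CollectI exI[of _ "\<lambda>_. 1"]) (auto intro: lat_Ints)
  then have "Min T \<in> T" using finT by (intro Min_in) auto
  define t where "t = Min T"
  have "t \<in> T" using \<open>Min T \<in> T\<close> by (simp add: t_def)
  then obtain g where g: "lat g" "t = g i" "0 < t" "t \<le> 1" unfolding T_def by auto
  have multiple: "\<exists>k::int. c i = of_int k * t" if c: "lat c" for c
  proof -
    define k where "k = \<lfloor>c i / t\<rfloor>"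
    define e where "e = (\<lambda>j. c j - of_int k * g j)"
    have e: "lat e" unfolding e_def by (rule lat_diff[OF c lat_scale[OF g(1) Ints_of_int]])
    have "of_int k * t \<le> c i" "c i < (of_int k + 1) * t"
      using floor_divide_lower[OF g(3), of "c i"] floor_divide_upper[OF g(3), of "c i"] unfolding k_def by auto
    then have "0 \<le> e i" "e i < t" unfolding e_def g(2)[symmetric] by (auto simp: algebra_simps)
    moreover have "\<not> 0 < e i"
    proof
      assume "0 < e i"
      then have "e i \<in> T" unfolding T_def using e \<open>e i < t\<close> g(4) by auto
      then have "t \<le> e i" unfolding t_def using finT by simp
      then show False using \<open>e i < t\<close> by simp
    qed
    ultimately have "c i = of_int k * t" unfolding e_def g(2)[symmetric] by simp
    then show ?thesis by blast
  qed
  have "lat (\<lambda>_. 1)" by (rule lat_Ints) simp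
  \<comment> \<open>The constant vector 1 is a lattice point, so 1 is a multiple of the least value
    \<open>t\<close>.\<close>
  then obtain z :: int where z: "1 = of_int z * t" using multiple[of "\<lambda>_. 1"] by auto
  then have "z > 0" using g(3) by (metis of_int_0_less_iff zero_less_mult_pos2 zero_less_one)
  define n where "n = nat z"
  have n: "n > 0" "int n = z" using \<open>z > 0\<close> by (auto simp: n_def)
  have nt: "real n * t = 1" using z n by (metis of_int_of_nat_eq)
  define b where "b j = \<lfloor>real n * g j\<rfloor>" for j
  have "lat (\<lambda>j. real n * g j)" by (rule lat_scale[OF g(1) Ints_of_nat])
  then have "real n * g j \<in> \<int>" if "j \<in> Ix" for j
    using lat_integral[of "\<lambda>j. real n * g j" i j] i that nt g(2) by simp
  then have b: "real n * g j = of_int (b j)" if "j \<in> Ix" for j using that by (simp add: b_def of_int_floor)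
  show ?thesis
  proof (rule that[OF n(1) g(1)])
    fix j assume j: "j \<in> Ix"
    show gj: "g j = of_int (b j) / real n" using b[OF j] n(1) by (simp add: field_simps)
    show "coprime (b j) (int n)"
    proof (rule coprimeI)
      \<comment> \<open>A common divisor \<open>q\<close> makes the \<open>j\<close>-th coordinate
        of \<open>(n / q) * g\<close> integral, hence also the \<open>i\<close>-th, which is
        1/q.\<close>
      fix q assume q: "q dvd b j" "q dvd int n"
      obtain b' n' where b': "b j = q * b'" and n': "int n = q * n'" using q by (meson dvdE)
      have q0: "q \<noteq> 0" using n n' by auto
      have n'0: "n' \<noteq> 0" using n n' by auto
      have e: "lat (\<lambda>j. of_int n' * g j)" by (rule lat_scale[OF g(1) Ints_of_int])
      have rn: "real n = of_int q * of_int n'" using n' by (metis of_int_mult of_int_of_nat_eq)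
      have "of_int n' * g j = of_int b'" unfolding gj b' rn using q0 n'0 by simp
      then have "of_int n' * g i \<in> \<int>" using lat_integral[OF e j _ i] by simp
      then obtain w :: int where "of_int n' * t = of_int w" using g(2) by (auto elim: Ints_cases)
      then have "of_int q * of_int w = (1::real)" using nt unfolding rn by (simp add: mult.assoc)
      then have "q * w = 1" by (metis of_int_eq_1_iff of_int_mult)
      then show "is_unit q" by (metis dvd_triv_left)
    qed
  next
    fix c assume c: "lat c"
    obtain k :: int where k: "c i = of_int k * t" using multiple[OF c] by blast
    have "lat (\<lambda>j. c j - of_int k * g j)" by (rule lat_diff[OF c lat_scale[OF g(1) Ints_of_int]])
    then have "\<forall>j\<in>Ix. c j - of_int k * g j \<in> \<int>"
      using lat_integral[of "\<lambda>j. c j - of_int k * g j" i] i k g(2) by auto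
    then show "\<exists>k::int. \<forall>j\<in>Ix. c j - of_int k * g j \<in> \<int>" by blast
  qed
qed

end

text \<open>One pair with residues \<open>b x\<close> and \<open>- b x\<close> is removed at a time;
  it lowers both counts equally for every \<open>u\<close>. Only a residue equal to its own negative
  needs care.\<close>

lemma balanced_pairing:
  fixes b :: "'i \<Rightarrow> int"
  assumes "finite D" "finite I" "card I = 2 * card D" "\<And>i. i \<in> I \<Longrightarrow> coprime (b i) n"
    and "\<And>u. card {i \<in> I. n dvd b i - u} = card {i \<in> I. n dvd b i + u}"
  shows "\<exists>p q. inj_on p D \<and> inj_on q D \<and> p ` D \<inter> q ` D = {} \<and> p ` D \<union> q ` D = I \<and> (\<forall>i\<in>D. n dvd b (p i) + b (q i))"
  using assms
proof (induction D arbitrary: I rule: finite_induct)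
  case empty
  then show ?case by auto
next
  case (insert z D)
  note fin = \<open>finite I\<close>
  have card: "card I = 2 * card D + 2" using insert by simp
  then obtain x where x: "x \<in> I" by fastforce
  have "x \<in> {i \<in> I. n dvd b i - b x}" using x by simp
  then have "card {i \<in> I. n dvd b i - b x} \<noteq> 0" using fin by auto
  then have "card {i \<in> I. n dvd b i + b x} \<noteq> 0" using insert.prems(4)[of "b x"] by simp
  then obtain y0 where y0: "y0 \<in> I" "n dvd b y0 + b x" by (metis (no_types, lifting) card_eq_0_iff ex_in_conv mem_Collect_eq)
  obtain y where y: "y \<in> I" "y \<noteq> x" "n dvd b x + b y"
  proof (cases "y0 = x")
    case False
    then show ?thesis using that[of y0] y0 by (simp add: add.commute)
  next
    case True
    \<comment> \<open>If \<open>x\<close> is its own partner, coprimality gives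
      \<open>n dvd 2\<close>. Then either every sum is divisible by \<open>n\<close> or all residues
      are odd, so any other element can be the partner.\<close>
    then have "n dvd 2 * b x" using y0(2) by (simp flip: mult_2)
    moreover have "coprime n (b x)" using insert.prems(3)[OF x] by (simp add: coprime_commute)
    ultimately have n2: "n dvd 2" by (simp add: coprime_dvd_mult_left_iff)
    have "I - {x} \<noteq> {}" using card x fin by (metis card.empty card_Suc_Diff1 add_2_eq_Suc' nat.simps(3) Suc_inject)
    then obtain y where y: "y \<in> I" "y \<noteq> x" by blast
    have "n dvd b x + b y"
    proof (cases "is_unit n")
      case True
      then show ?thesis using dvd_trans one_dvd by blast
    next
      case False
      have "\<bar>n\<bar> \<le> 2" using n2 zdvd_imp_le[of "\<bar>n\<bar>" 2] by simp
      moreover have "n \<noteq> 0" using n2 by auto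
      ultimately have "\<bar>n\<bar> = 2" using False by (auto simp: zdvd1_eq abs_if split: if_splits)
      then have ev: "n dvd m \<longleftrightarrow> even m" for m by (metis abs_dvd_iff)
      have "odd (b j)" if "j \<in> I" for j
        using insert.prems(3)[OF that] False by (metis coprime_common_divisor dvd_refl ev n2)
      then show ?thesis unfolding ev using x y by simp
    qed
    then show ?thesis using that y by blast
  qed
  define I' where "I' = I - {x, y}"
  have I: "I = insert x (insert y I')" "x \<notin> I'" "y \<notin> I'" using x y by (auto simp: I'_def)
  have fin': "finite I'" using fin by (simp add: I'_def)
  have "card I' = 2 * card D" using card I fin' y(2) by simp
  moreover have "card {i \<in> I'. n dvd b i - u} = card {i \<in> I'. n dvd b i + u}" for u
  proof -
    have cnt: "card {i \<in> I. P i} = card {i \<in> I'. P i} + (if P x then 1 else 0) + (if P y then 1 else 0)" for P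
    proof -
      have "{i \<in> I. P i} = {i \<in> I'. P i} \<union> (if P x then {x} else {}) \<union> (if P y then {y} else {})" using I(1) by auto
      then show ?thesis using I y(2) fin' by (auto simp: card_insert_if)
    qed
    have sw: "n dvd b y - u \<longleftrightarrow> n dvd b x + u" "n dvd b y + u \<longleftrightarrow> n dvd b x - u"
    proof -
      have "b y - u = (b x + b y) - (b x + u)" by simp
      then show "n dvd b y - u \<longleftrightarrow> n dvd b x + u" using y(3) by (metis dvd_diff_right_iff dvd_diff_left_iff)
      have "b y + u = (b x + b y) - (b x - u)" by simp
      then show "n dvd b y + u \<longleftrightarrow> n dvd b x - u" using y(3) by (metis dvd_diff_right_iff dvd_diff_left_iff)
    qed
    show ?thesis using insert.prems(4)[of u] unfolding cnt sw by simp
  qed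
  ultimately obtain p q where pq: "inj_on p D" "inj_on q D" "p ` D \<inter> q ` D = {}" "p ` D \<union> q ` D = I'" "\<forall>i\<in>D. n dvd b (p i) + b (q i)"
    using insert.IH[of I'] fin' insert.prems(3) I(1) by auto
  define p' where "p' = p(z := x)"
  define q' where "q' = q(z := y)"
  have im: "p' ` insert z D = insert x (p ` D)" "q' ` insert z D = insert y (q ` D)"
    using insert.hyps by (auto simp: p'_def q'_def)
  have nin: "x \<notin> p ` D" "x \<notin> q ` D" "y \<notin> p ` D" "y \<notin> q ` D" using pq(4) I by auto
  have "inj_on p' (insert z D)" "inj_on q' (insert z D)"
    using pq(1,2) insert.hyps nin by (auto simp: p'_def q'_def inj_on_def)
  moreover have "p' ` insert z D \<inter> q' ` insert z D = {}" unfolding im using nin y(2) pq(3) by auto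
  moreover have "p' ` insert z D \<union> q' ` insert z D = I" unfolding im I(1) using pq(4) by auto
  moreover have "\<forall>i\<in>insert z D. n dvd b (p' i) + b (q' i)"
    using pq(5) y(3) insert.hyps by (auto simp: p'_def q'_def)
  ultimately show ?case by blast
qed

section \<open>Isomorphism with a Cayley polytope\<close>

lemma sum_two_ranges:
  fixes p q :: "'e::finite \<Rightarrow> 'i"
  assumes "inj p" "inj q" "range p \<inter> range q = {}"
  shows "sum F (range p \<union> range q) = (\<Sum>i\<in>UNIV. F (p i)) + (\<Sum>i\<in>UNIV. F (q i))"
  using assms by (simp add: sum.union_disjoint sum.reindex)

context basic_facet_simplex
begin

text \<open>The edge vectors from one vertex are independent, so the linear part can be prescribed
  on them; \<open>c0\<close> then adjusts the chosen vertex.\<close>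

lemma affine_map_exists:
  fixes y :: "'i \<Rightarrow> 'b::real_vector"
  obtains f c0 where "linear f" "\<And>j. j \<in> Ix \<Longrightarrow> c0 + f (v j) = y j"
proof -
  obtain i where i: "i \<in> Ix" using card d by fastforce
  define B where "B = (\<lambda>x. - v i + x) ` (v ` Ix - {v i})"
  have "independent B" unfolding B_def using affine_dependent_iff_dependent2[of "v i" "v ` Ix"] indep i by auto
  then obtain f where f: "linear f" "\<forall>x\<in>B. f x = y (inv_into Ix v (v i + x)) - y i"
    using linear_independent_extend[of B "\<lambda>x. y (inv_into Ix v (v i + x)) - y i"] by blast
  show ?thesis
  proof (rule that[OF f(1)])
    fix j assume j: "j \<in> Ix"
    show "(y i - f (v i)) + f (v j) = y j"
    proof (cases "j = i")
      case False
      then have "v j \<noteq> v i" using inj i j by (auto dest: inj_onD)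
      then have "- v i + v j \<in> B" using j by (auto simp: B_def)
      then have "f (- v i + v j) = y (inv_into Ix v (v i + (- v i + v j))) - y i" using f(2) by blast
      also have "v i + (- v i + v j) = v j" by simp
      also have "inv_into Ix v (v j) = j" using inj j by simp
      finally have "f (- v i + v j) = y j - y i" .
      moreover have "f (- v i + v j) = f (v j) - f (v i)" using linear_diff[OF f(1), of "v j" "v i"] by simp
      ultimately have "f (v j) - f (v i) = y j - y i" by simp
      then have "f (v j) = y j - y i + f (v i)" by (simp only: diff_eq_eq)
      then show ?thesis by simp
    qed simp
  qed
qed

text \<open>The vertices of pair \<open>i\<close> are sent to \<open>(axis i 1, 0)\<close> and
  \<open>(axis i 1, u i)\<close>. In coordinates this is the map \<open>\<Phi>\<close>, and the
  parameters \<open>a\<close> are chosen so that \<open>\<Phi>\<close> is integral exactly on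
  lattice points.\<close>

lemma central_imp_Delta_simplex:
  fixes l :: "'e::finite"
  assumes e: "CARD('e) = d" and cen: central
  shows "\<exists>(a :: 'e \<Rightarrow> int) (n :: int). n > 0 \<and> gcd (\<Prod>i\<in>UNIV - {l}. a i) n = 1 \<and>
      lattice_iso (convex hull (v ` Ix)) (Delta_simplex l a n)"
proof -
  obtain n g b where n: "n > 0" and g: "lat g" "\<And>j. j \<in> Ix \<Longrightarrow> g j = of_int (b j) / real n"
    and cop: "\<And>j. j \<in> Ix \<Longrightarrow> coprime (b j) (int n)"
    and gen: "\<And>c. lat c \<Longrightarrow> \<exists>k::int. \<forall>j\<in>Ix. c j - of_int k * g j \<in> \<int>"
    using lat_cyclic by blast
  have Ints_divide: "of_int z / real n \<in> \<int> \<longleftrightarrow> int n dvd z" for z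
  proof
    assume "of_int z / real n \<in> \<int>"
    then obtain w :: int where "of_int z / real n = of_int w" by (auto elim: Ints_cases)
    then have "(of_int z :: real) = of_int (int n * w)" using n by (simp add: field_simps)
    then have "z = int n * w" by linarith
    then show "int n dvd z" by simp
  next
    assume "int n dvd z"
    then obtain w where "z = int n * w" by blast
    then show "of_int z / real n \<in> \<int>" using n by simp
  qed
  have bal: "(\<Sum>j\<in>Ix. frac (of_int (int k * b j) / real n)) = real (card Ix) / 2" if k: "\<not> n dvd k" for k
  proof -
    define c where "c = (\<lambda>j. real k * g j)"
    have c: "lat c" unfolding c_def by (rule lat_scale[OF g(1) Ints_of_nat])
    have cj: "c j = of_int (int k * b j) / real n" if "j \<in> Ix" for j using g(2)[OF that] by (simp add: c_def)
    obtain i where i: "i \<in> Ix" using card d by fastforce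
    have "\<not> int n dvd int k * b i" using k cop[OF i] by (simp add: coprime_dvd_mult_left_iff coprime_commute)
    then have "c i \<notin> \<int>" unfolding cj[OF i] Ints_divide .
    then have "(\<Sum>j\<in>Ix. frac (c j)) = real d" using cen lat_nonint[OF c i] unfolding central_def by blast
    then show ?thesis using cj card by simp
  qed
  have "\<exists>p q. inj_on p (UNIV :: 'e set) \<and> inj_on q UNIV \<and> range p \<inter> range q = {} \<and> range p \<union> range q = Ix \<and> (\<forall>i\<in>UNIV. int n dvd b (p i) + b (q i))"
    by (rule balanced_pairing[OF finite fin _ cop balanced_residues[OF n fin cop bal]]) (use card e in auto)
  then obtain p q :: "'e \<Rightarrow> 'i" where p: "inj p" and q: "inj q" and disj: "range p \<inter> range q = {}"
    and un: "range p \<union> range q = Ix" and pq: "\<And>i. int n dvd b (p i) + b (q i)" by auto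
  have pI: "p i \<in> Ix" and qI: "q i \<in> Ix" and qp: "q i \<notin> range p" for i using un disj by auto
  note sumIx = sum_two_ranges[OF p q disj, unfolded un]
  \<comment> \<open>The inverse \<open>s\<close> rescales the generator so that its coordinate at
    \<open>q l\<close> becomes 1/n modulo integers.\<close>
  obtain s where "[b (q l) * s = 1] (mod int n)" using cong_solve_coprime_int[OF cop[OF qI]] by blast
  then have s: "int n dvd b (q l) * s - 1" by (simp add: cong_iff_dvd_diff)
  have cops: "coprime s (int n)"
    unfolding coprime_iff_invertible_int using \<open>[b (q l) * s = 1] (mod int n)\<close> by (metis mult.commute)
  \<comment> \<open>Forced by integrality of the second component on \<open>g\<close>:
    \<open>b (q i) + a i * b (q l)\<close> must be divisible by \<open>n\<close>. The first
    component is integral on \<open>g\<close> by the pairing.\<close>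
  define a where "a i = - (b (q i) * s)" for i
  have gcd: "gcd (\<Prod>i\<in>UNIV - {l}. a i) (int n) = 1"
    unfolding coprime_iff_gcd_eq_1[symmetric] by (rule prod_coprime_left) (use cop qI cops in \<open>simp add: a_def\<close>)
  define u :: "'e \<Rightarrow> real ^ 'e" where "u i = (if i = l then (\<chi> j. if j = l then of_int (int n) else of_int (a j)) else axis i 1)" for i
  define y :: "'i \<Rightarrow> (real ^ 'e) \<times> (real ^ 'e)" where
    "y j = (if j \<in> range p then (axis (inv p j) 1, 0) else (axis (inv q j) 1, u (inv q j)))" for j
  have yp: "y (p i) = (axis i 1, 0)" and yq: "y (q i) = (axis i 1, u i)" for i
    using p q qp by (auto simp: y_def)
  define \<Phi> where "\<Phi> c = (\<Sum>j\<in>Ix. c j *\<^sub>R y j)" for c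
  have sum_axis: "(\<Sum>i\<in>UNIV. c i *\<^sub>R axis i (1::real)) = (\<chi> i. c i)" for c :: "'e \<Rightarrow> real"
    by (simp add: vec_eq_iff sum_component axis_def if_distrib cong: if_cong)
  have \<Phi>1: "fst (\<Phi> c) $ i = c (p i) + c (q i)" for c i
    unfolding \<Phi>_def sumIx by (simp add: yp yq fst_sum sum_axis)
  have \<Phi>2: "snd (\<Phi> c) $ i = (if i = l then real n * c (q l) else c (q i) + of_int (a i) * c (q l))" for c i
  proof -
    have "snd (\<Phi> c) $ i = (\<Sum>k\<in>UNIV. c (q k) * u k $ i)"
      unfolding \<Phi>_def sumIx by (simp add: yp yq snd_sum sum_component)
    also have "\<dots> = c (q l) * u l $ i + (\<Sum>k\<in>UNIV - {l}. c (q k) * u k $ i)" by (rule sum.remove) auto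
    also have "(\<Sum>k\<in>UNIV - {l}. c (q k) * u k $ i) = (\<Sum>k\<in>UNIV - {l}. if k = i then c (q k) else 0)"
      by (rule sum.cong) (auto simp: u_def axis_def)
    also have "\<dots> = (if i = l then 0 else c (q i))" by (simp add: sum.delta)
    finally show ?thesis by (auto simp: u_def mult.commute)
  qed
  obtain f c0 where f: "linear f" and fy: "\<And>j. j \<in> Ix \<Longrightarrow> c0 + f (v j) = y j" using affine_map_exists[of y] by blast
  define \<phi> where "\<phi> = (\<lambda>x. c0 + f x)"
  have \<phi>_sum: "\<phi> (\<Sum>j\<in>Ix. c j *\<^sub>R v j) = \<Phi> c" if "(\<Sum>j\<in>Ix. c j) = 1" for c
  proof -
    have "\<Phi> c = (\<Sum>j\<in>Ix. c j *\<^sub>R (c0 + f (v j)))" unfolding \<Phi>_def by (simp add: fy)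
    also have "\<dots> = (\<Sum>j\<in>Ix. c j) *\<^sub>R c0 + f (\<Sum>j\<in>Ix. c j *\<^sub>R v j)"
      by (simp add: linear_sum[OF f] linear_scale[OF f] scaleR_add_right sum.distrib scaleR_sum_left)
    finally show ?thesis using that by (simp add: \<phi>_def)
  qed
  have \<Phi>_sum: "(\<Sum>i\<in>UNIV. fst (\<Phi> c) $ i) = (\<Sum>j\<in>Ix. c j)" for c
    unfolding \<Phi>1 sumIx by (simp add: sum.distrib)
  have lat_iff: "(\<Sum>j\<in>Ix. c j *\<^sub>R v j) \<in> int_vecs \<longleftrightarrow> \<Phi> c \<in> int_vecs \<times> int_vecs" if c1: "(\<Sum>j\<in>Ix. c j) = 1" for c
  proof
    assume "(\<Sum>j\<in>Ix. c j *\<^sub>R v j) \<in> int_vecs"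
    then have "lat c" using c1 by (simp add: lat_def)
    then obtain k :: int where k0: "\<forall>j\<in>Ix. c j - of_int k * g j \<in> \<int>" using gen by blast
    have k: "c j - of_int (k * b j) / real n \<in> \<int>" if "j \<in> Ix" for j
    proof -
      have "of_int k * g j = of_int (k * b j) / real n" using g(2)[OF that] by simp
      then show ?thesis using k0 that by metis
    qed
    have "c (p i) + c (q i) \<in> \<int>" for i
    proof -
      have "c (p i) + c (q i) = (c (p i) - of_int (k * b (p i)) / real n) + (c (q i) - of_int (k * b (q i)) / real n) + of_int (k * (b (p i) + b (q i))) / real n"
        by (simp add: algebra_simps add_divide_distrib)
      then show ?thesis using k[OF pI] k[OF qI] Ints_divide[of "k * (b (p i) + b (q i))"] pq[of i]
        by (metis Ints_add dvd_mult)
    qed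
    moreover have "real n * c (q l) \<in> \<int>"
    proof -
      have "real n * c (q l) = real n * (c (q l) - of_int (k * b (q l)) / real n) + of_int (k * b (q l))"
        using n by (simp add: algebra_simps)
      then show ?thesis using k[OF qI] by (metis Ints_add Ints_mult Ints_of_int Ints_of_nat)
    qed
    moreover have "c (q i) + of_int (a i) * c (q l) \<in> \<int>" for i
    proof -
      have "c (q i) + of_int (a i) * c (q l) = (c (q i) - of_int (k * b (q i)) / real n) + of_int (a i) * (c (q l) - of_int (k * b (q l)) / real n)
          + of_int (k * (b (q i) + a i * b (q l))) / real n"
        by (simp add: algebra_simps add_divide_distrib)
      moreover have "k * (b (q i) + a i * b (q l)) = - (k * b (q i)) * (b (q l) * s - 1)"
        by (simp add: a_def algebra_simps)
      then have "of_int (k * (b (q i) + a i * b (q l))) / real n \<in> \<int>"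
        using Ints_divide s by (metis dvd_mult)
      ultimately show ?thesis using k[OF qI, of i] k[OF qI, of l] by (metis Ints_add Ints_mult Ints_of_int)
    qed
    ultimately show "\<Phi> c \<in> int_vecs \<times> int_vecs" by (simp add: mem_Times_iff int_vecs_def \<Phi>1 \<Phi>2)
  next
    assume "\<Phi> c \<in> int_vecs \<times> int_vecs"
    then have F: "fst (\<Phi> c) $ i \<in> \<int>" "snd (\<Phi> c) $ i \<in> \<int>" for i by (auto simp: mem_Times_iff int_vecs_def)
    obtain t where t: "real n * c (q l) = of_int t" using F(2)[of l] unfolding \<Phi>2 by (auto elim: Ints_cases)
    then have ql: "c (q l) = of_int t / real n" using n by (simp add: field_simps)
    \<comment> \<open>The multiple of \<open>g\<close> to subtract from \<open>c\<close>: it matches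
      \<open>c\<close> at \<open>q l\<close> modulo integers, because \<open>b (q l) * s\<close> is
      congruent to 1.\<close>
    define k where "k = t * s"
    have cq: "c (q i) - of_int (k * b (q i)) / real n \<in> \<int>" for i
    proof (cases "i = l")
      case True
      have "c (q l) - of_int (k * b (q l)) / real n = of_int (- t * (b (q l) * s - 1)) / real n"
        unfolding ql k_def by (simp add: algebra_simps diff_divide_distrib)
      then show ?thesis using Ints_divide s True by (metis dvd_mult)
    next
      case False
      have eq: "c (q i) - of_int (k * b (q i)) / real n = c (q i) + of_int (a i) * c (q l)"
        unfolding ql k_def a_def by (simp add: algebra_simps)
      show ?thesis unfolding eq using F(2)[of i] False unfolding \<Phi>2 by simp
    qed
    have cp: "c (p i) - of_int (k * b (p i)) / real n \<in> \<int>" for i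
    proof -
      have "c (p i) - of_int (k * b (p i)) / real n = (c (p i) + c (q i)) - (c (q i) - of_int (k * b (q i)) / real n) - of_int (k * (b (p i) + b (q i))) / real n"
        by (simp add: algebra_simps add_divide_distrib)
      then show ?thesis using F(1)[of i] cq[of i] Ints_divide[of "k * (b (p i) + b (q i))"] pq[of i] unfolding \<Phi>1
        by (metis Ints_diff dvd_mult)
    qed
    have "c j - of_int k * g j \<in> \<int>" if j: "j \<in> Ix" for j
      using j cp cq g(2) unfolding un[symmetric] by auto
    then have "lat (\<lambda>j. c j - of_int k * g j)" by (rule lat_Ints)
    from lat_add[OF this lat_scale[OF g(1) Ints_of_int, of k]] have "lat c" by simp
    then show "(\<Sum>j\<in>Ix. c j *\<^sub>R v j) \<in> int_vecs" by (simp add: lat_def)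
  qed
  have onto: "\<exists>c. (\<Sum>j\<in>Ix. c j) = 1 \<and> \<Phi> c = h" if h: "h \<in> cayley_hyperplane" for h
  proof -
    \<comment> \<open>Inverts \<open>\<Phi>\<close>: the equation at \<open>l\<close> gives the
      coordinate at \<open>q l\<close>, then those at the other \<open>q i\<close> follow, and the
      first component yields the \<open>p i\<close>.\<close>
    define w where "w i = (if i = l then snd h $ l / real n else snd h $ i - of_int (a i) * (snd h $ l / real n))" for i
    define c where "c j = (if j \<in> range p then fst h $ (inv p j) - w (inv p j) else w (inv q j))" for j
    have cp: "c (p i) = fst h $ i - w i" and cq: "c (q i) = w i" for i using p q qp by (auto simp: c_def)
    have "fst (\<Phi> c) = fst h" unfolding vec_eq_iff \<Phi>1 cp cq by simp
    moreover have "snd (\<Phi> c) = snd h" unfolding vec_eq_iff \<Phi>2 cq using n by (simp add: w_def)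
    ultimately have "\<Phi> c = h" by (simp add: prod_eq_iff)
    moreover have "(\<Sum>j\<in>Ix. c j) = 1" using \<Phi>_sum[of c] h unfolding \<open>\<Phi> c = h\<close> by (simp add: cayley_hyperplane_def)
    ultimately show ?thesis by blast
  qed
  have bij: "bij_betw \<phi> UNIV cayley_hyperplane"
    unfolding bij_betw_def
  proof
    show "inj \<phi>"
    proof (rule injI)
      fix x x' assume eq: "\<phi> x = \<phi> x'"
      obtain c where c: "(\<Sum>j\<in>Ix. c j) = 1" "(\<Sum>j\<in>Ix. c j *\<^sub>R v j) = x" using coordinates_exist by blast
      obtain c' where c': "(\<Sum>j\<in>Ix. c' j) = 1" "(\<Sum>j\<in>Ix. c' j *\<^sub>R v j) = x'" using coordinates_exist by blast
      have \<Phi>eq: "\<Phi> c = \<Phi> c'" using eq \<phi>_sum[OF c(1)] \<phi>_sum[OF c'(1)] c c' by simp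
      have "c (q l) = c' (q l)" using \<Phi>2[of c l] \<Phi>2[of c' l] n unfolding \<Phi>eq by simp
      then have q': "c (q i) = c' (q i)" for i using \<Phi>2[of c i] \<Phi>2[of c' i] unfolding \<Phi>eq by (cases "i = l") auto
      then have "c (p i) = c' (p i)" for i using \<Phi>1[of c i] \<Phi>1[of c' i] unfolding \<Phi>eq by simp
      then have "c j = c' j" if "j \<in> Ix" for j using that q' unfolding un[symmetric] by auto
      then show "x = x'" using c(2) c'(2) by simp
    qed
    show "range \<phi> = cayley_hyperplane"
    proof (intro equalityI subsetI)
      fix h assume "h \<in> range \<phi>"
      then obtain x where x: "h = \<phi> x" by blast
      obtain c where c: "(\<Sum>j\<in>Ix. c j) = 1" "(\<Sum>j\<in>Ix. c j *\<^sub>R v j) = x" using coordinates_exist by blast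
      then show "h \<in> cayley_hyperplane" using \<Phi>_sum[of c] \<phi>_sum[OF c(1)] by (simp add: x cayley_hyperplane_def)
    next
      fix h assume "h \<in> (cayley_hyperplane :: ((real ^ 'e) \<times> (real ^ 'e)) set)"
      then show "h \<in> range \<phi>" using onto \<phi>_sum by (metis rangeI)
    qed
  qed
  have img: "\<phi> ` int_vecs = cayley_hyperplane \<inter> (int_vecs \<times> int_vecs)"
  proof (intro equalityI subsetI)
    fix h assume "h \<in> \<phi> ` int_vecs"
    then obtain x where x: "h = \<phi> x" "x \<in> int_vecs" by blast
    obtain c where c: "(\<Sum>j\<in>Ix. c j) = 1" "(\<Sum>j\<in>Ix. c j *\<^sub>R v j) = x" using coordinates_exist by blast
    have "h = \<Phi> c" using x(1) \<phi>_sum[OF c(1)] c(2) by simp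
    then show "h \<in> cayley_hyperplane \<inter> (int_vecs \<times> int_vecs)"
      using lat_iff[OF c(1)] c(2) x \<Phi>_sum[of c] c(1) by (simp add: cayley_hyperplane_def)
  next
    fix h assume h: "h \<in> cayley_hyperplane \<inter> (int_vecs \<times> int_vecs :: ((real ^ 'e) \<times> (real ^ 'e)) set)"
    then obtain c where c: "(\<Sum>j\<in>Ix. c j) = 1" "\<Phi> c = h" using onto by blast
    then have "(\<Sum>j\<in>Ix. c j *\<^sub>R v j) \<in> int_vecs" using lat_iff[OF c(1)] h by simp
    then show "h \<in> \<phi> ` int_vecs" using \<phi>_sum[OF c(1)] c(2) by (metis imageI)
  qed
  have yIx: "y ` Ix = (\<Union>i. {axis i 1} \<times> {0, u i})"
    unfolding un[symmetric] image_Un by (auto simp: yp yq image_iff)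
  have "\<phi> ` (convex hull (v ` Ix)) = (\<lambda>x. c0 + x) ` (f ` (convex hull (v ` Ix)))" by (auto simp: \<phi>_def)
  also have "\<dots> = convex hull ((\<lambda>x. c0 + x) ` f ` v ` Ix)"
    unfolding convex_hull_linear_image[OF f] convex_hull_translation ..
  also have "(\<lambda>x. c0 + x) ` f ` v ` Ix = y ` Ix" using fy by (force simp: image_iff)
  also have "convex hull (y ` Ix) = cayley (\<lambda>i. convex hull {0, u i})"
    unfolding cayley_def
  proof (rule antisym)
    show "convex hull (y ` Ix) \<subseteq> convex hull (\<Union>i. {axis i 1} \<times> (convex hull {0, u i}))"
      unfolding yIx by (rule hull_mono) (use hull_subset[of _ convex] in fastforce)
    have "{axis i 1} \<times> (convex hull {0, u i}) \<subseteq> convex hull (y ` Ix)" for i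
    proof -
      have "{axis i 1} \<times> (convex hull {0, u i}) = convex hull ({axis i 1} \<times> {0, u i})" unfolding convex_hull_Times by simp
      also have "\<dots> \<subseteq> convex hull (y ` Ix)" unfolding yIx by (rule hull_mono) blast
      finally show ?thesis .
    qed
    then show "convex hull (\<Union>i. {axis i 1} \<times> (convex hull {0, u i})) \<subseteq> convex hull (y ` Ix)"
      by (intro hull_minimal) auto
  qed
  also have "\<dots> = Delta_simplex l a (int n)" unfolding Delta_simplex_def u_def ..
  finally have "\<phi> ` (convex hull (v ` Ix)) = Delta_simplex l a (int n)" .
  then have "lattice_iso (convex hull (v ` Ix)) (Delta_simplex l a (int n))"
    unfolding lattice_iso_def using f bij img \<phi>_def by blast
  then show ?thesis using gcd n by (intro exI[of _ a] exI[of _ "int n"]) simp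
qed

end

section \<open>Assembling the equivalences\<close>

lemma Delta_simplex_cayley_segments:
  fixes a :: "'d::finite \<Rightarrow> int"
  assumes "n > 0"
  shows "\<exists>S :: 'd \<Rightarrow> (real ^ 'd) set. (\<forall>i. lattice_simplex 1 (S i)) \<and> Delta_simplex l a n = cayley S"
proof -
  define u :: "'d \<Rightarrow> real ^ 'd" where "u i = (if i = l then (\<chi> j. if j = l then of_int n else of_int (a j)) else axis i 1)" for i
  have "lattice_simplex 1 (convex hull {0, u i})" for i
    unfolding lattice_simplex_def
  proof (intro exI[of _ "{0, u i}"] conjI)
    show "{0, u i} \<subseteq> int_vecs" by (auto simp: int_vecs_def u_def axis_def)
    have "u i $ i \<noteq> 0" using assms by (simp add: u_def axis_def)
    then have "u i \<noteq> 0" by auto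
    then show "int (card {0, u i}) = 1 + 1" by simp
  qed auto
  then show ?thesis
    by (intro exI[of _ "\<lambda>i. convex hull {0, u i}"]) (simp add: Delta_simplex_def u_def)
qed

lemma simplex_vertices:
  fixes v :: "'i \<Rightarrow> real ^ 'm"
  assumes "finite I" and "lattice_simplex (int (card I) - 1) (convex hull (v ` I))"
  shows "inj_on v I" "\<not> affine_dependent (v ` I)" "v ` I \<subseteq> int_vecs"
proof -
  obtain C where C: "C \<subseteq> int_vecs" "\<not> affine_dependent C" "int (card C) = int (card I) - 1 + 1" "convex hull (v ` I) = convex hull C"
    using assms(2) unfolding lattice_simplex_def by blast
  have sub: "C \<subseteq> v ` I" by (rule convex_hull_eq_imp_subset[OF C(2) C(4)[symmetric]])
  have cc: "card C = card I" using C(3) by simp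
  have "card (v ` I) \<le> card I" using assms(1) by (rule card_image_le)
  then have eq: "C = v ` I" using sub assms(1) cc by (intro card_seteq) auto
  then show "inj_on v I" using cc assms(1) by (intro eq_card_imp_inj_on) auto
  show "\<not> affine_dependent (v ` I)" "v ` I \<subseteq> int_vecs" using C eq by auto
qed

theorem theorem2p5:
  fixes v :: "nat \<Rightarrow> real ^ 'm" and \<Delta> :: "(real ^ 'm) set" and l :: "'d::finite"
  assumes "CARD('m) = 2 * CARD('d) - 1"
    and "\<Delta> = convex hull (v ` {1..2 * CARD('d)})"
    and "lattice_simplex (2 * int CARD('d) - 1) \<Delta>"
    and "\<And>F. F facet_of \<Delta> \<Longrightarrow> basic_simplex F"
  shows "tfae [
    \<forall>k\<in>{1..CARD('d) - 1}. \<forall>x \<in> (\<lambda>y. real k *\<^sub>R y) ` \<Delta> \<inter> int_vecs. \<forall>c :: nat \<Rightarrow> real.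
      (\<forall>i\<in>{1..2 * CARD('d)}. 0 \<le> c i) \<and> (\<Sum>i=1..2 * CARD('d). c i) = real k \<and>
      x = (\<Sum>i=1..2 * CARD('d). c i *\<^sub>R v i) \<longrightarrow> (\<forall>i\<in>{1..2 * CARD('d)}. c i \<in> \<int>),
    \<forall>k\<in>{1..CARD('d) - 1}. interior ((\<lambda>y. real k *\<^sub>R y) ` \<Delta>) \<inter> int_vecs = {},
    \<exists>n::int. n \<ge> 1 \<and> h_star (2 * CARD('d)) v = 1 + monom (n - 1) CARD('d),
    \<exists>(a :: 'd \<Rightarrow> int) (n :: int). n > 0 \<and> gcd (\<Prod>i\<in>UNIV - {l}. a i) n = 1 \<and>
      lattice_iso \<Delta> (Delta_simplex l a n),
    \<exists>S :: 'd \<Rightarrow> (real ^ 'd) set. (\<forall>i. lattice_simplex 1 (S i)) \<and> lattice_iso \<Delta> (cayley S)]"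
    (is "tfae [?one, ?two, ?three, ?four, ?five]")
proof -
  have d: "CARD('d) > 0" by simp
  have ls: "lattice_simplex (int (card {1..2 * CARD('d)}) - 1) (convex hull (v ` {1..2 * CARD('d)}))"
    using assms(2,3) by simp
  interpret basic_facet_simplex v "{1..2 * CARD('d)}" "CARD('d)"
  proof
    show "inj_on v {1..2 * CARD('d)}" "\<not> affine_dependent (v ` {1..2 * CARD('d)})"
      using simplex_vertices[OF finite_atLeastAtMost ls] by blast+
    show "v j \<in> int_vecs" if "j \<in> {1..2 * CARD('d)}" for j
      using simplex_vertices(3)[OF finite_atLeastAtMost ls] that by blast
    show "basic_simplex F" if "F facet_of (convex hull (v ` {1..2 * CARD('d)}))" for F
      using assms(2,4) that by blast
  qed (use assms(1) d in simp_all)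
  have one: "?one \<longleftrightarrow> central" unfolding assms(2) central_iff_multiples_generated ..
  have two: "?two \<longleftrightarrow> central" unfolding assms(2) central_iff_no_interior_points ..
  have three: "?three \<longleftrightarrow> central"
  proof -
    have hs: "h_star_coeff (2 * CARD('d)) v k = card {x \<in> {\<Sum>j=1..2 * CARD('d). c j *\<^sub>R (v j, 1::real) | c.
        \<forall>j\<in>{1..2 * CARD('d)}. 0 \<le> c j \<and> c j < 1}. fst x \<in> int_vecs \<and> snd x = real k}" for k
      unfolding h_star_coeff_def half_open_par_def ..
    note par = central_iff_par_points[folded hs]
    have coeff: "coeff (h_star (2 * CARD('d)) v) k = (if k \<le> 2 * CARD('d) then int (h_star_coeff (2 * CARD('d)) v k) else 0)" for k
      unfolding h_star_def by (simp add: coeff_sum)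
    show ?thesis
    proof
      assume ?three
      then obtain n :: int where n: "h_star (2 * CARD('d)) v = 1 + monom (n - 1) CARD('d)" by blast
      have "h_star_coeff (2 * CARD('d)) v k = 0" if "k \<le> 2 * CARD('d)" "k \<noteq> 0" "k \<noteq> CARD('d)" for k
        using coeff[of k] that unfolding n by (simp add: coeff_1)
      then show central unfolding par(2) by blast
    next
      assume central
      then have z: "h_star_coeff (2 * CARD('d)) v k = 0" if "k \<le> 2 * CARD('d)" "k \<noteq> 0" "k \<noteq> CARD('d)" for k
        using that unfolding par(2) by blast
      \<comment> \<open>The constant coefficient counts only the origin; \<open>d > 0\<close> keeps
        the degrees 0 and \<open>d\<close> apart.\<close>
      have "h_star (2 * CARD('d)) v = 1 + monom (int (h_star_coeff (2 * CARD('d)) v CARD('d))) CARD('d)"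
        by (rule poly_eqI) (use par(1) z d in \<open>auto simp: coeff coeff_1\<close>)
      \<comment> \<open>The witness \<open>n\<close> is the coefficient at \<open>d\<close> plus 1,
        so \<open>n \<ge> 1\<close> holds because a count is nonnegative.\<close>
      then show ?three by (intro exI[of _ "int (h_star_coeff (2 * CARD('d)) v CARD('d)) + 1"]) simp
    qed
  qed
  have i: "central \<Longrightarrow> ?four" unfolding assms(2) by (rule central_imp_Delta_simplex) simp
  have ii: "?four \<Longrightarrow> ?five" using Delta_simplex_cayley_segments by metis
  have iii: "?five \<Longrightarrow> central"
  proof -
    assume ?five
    then obtain S :: "'d \<Rightarrow> (real ^ 'd) set" where S: "\<And>i. lattice_simplex 1 (S i)" and iso: "lattice_iso \<Delta> (cayley S)" by blast
    have "S i \<noteq> {}" for i 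
    proof -
      obtain C where "int (card C) = 1 + 1" "S i = convex hull C" using S[of i] unfolding lattice_simplex_def by blast
      then show ?thesis by (auto simp: convex_hull_eq_empty)
    qed
    then show central using cayley_imp_central[of S] iso assms(2) by simp
  qed
  \<comment> \<open>Statements (4) and (5) are reached by the cycle central, (4), (5),
    central.\<close>
  have four: "?four \<longleftrightarrow> central" by (rule iffI[OF iii[OF ii] i])
  have five: "?five \<longleftrightarrow> central" by (rule iffI[OF iii ii[OF i]])
  show ?thesis unfolding one two three four five tfae_def by simp
qed

end
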